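(* Let $S,T$ be domains in $\mathbb{R}^2$. Let $a\neq 0$, $(\hat x_0,\hat y_0)\in S^\circ$, $(\hat u_0,\hat v_0)\in T^\circ$, and $(\hat p_0,\hat q_0)\in\mathbb{R}^2\setminus\{0\}$. Suppose $(\hat u,\hat v):S\to T$ is $C^1$, satisfies $$\frac{\partial \hat u}{\partial x}=\frac{\partial \hat v}{\partial y},\qquad \frac{\partial \hat v}{\partial x}=-2\bigl(\hat v^2+y^2+a^2\bigr)^{1/2}\frac{\partial \hat u}{\partial y}\quad\text{on } S,$$ and satisfies $$\hat u(\hat x_0,\hat y_0)=\hat u_0,\quad \hat v(\hat x_0,\hat y_0)=\hat v_0,\quad \frac{\partial\hat v}{\partial x}(\hat x_0,\hat y_0)=\hat p_0\quad\text{and}\quad \frac{\partial\hat v}{\partial y}(\hat x_0,\hat y_0)=\hat q_0.$$ Define $x_0=\hat u_0$, $y_0=\hat v_0$, $u_0=\hat x_0$, $v_0=\hat y_0$, $$p_0=-\frac{\hat p_0}{\frac12(\hat v_0^2+\hat y_0^2+a^2)^{-1/2}\hat p_0^2+\hat q_0^2}\quad\text{and}\quad q_0=\frac{\hat q_0}{\frac12(\hat v_0^2+\hat y_0^2+a^2)^{-1/2}\hat p_0^2+\hat q_0^2}.$$ Then there does not exist $(u,v):T\to S^\circ$ which is $C^1$, satisfies $$\frac{\partial u}{\partial x}=\frac{\partial v}{\partial y},\qquad \frac{\partial v}{\partial x}=-2\bigl(v^2+y^2+a^2\bigr)^{1/2}\frac{\partial u}{\partial y}\quad\text{on } T,$$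 and satisfies $$u(x_0,y_0)=u_0,\quad v(x_0,y_0)=v_0,\quad \frac{\partial v}{\partial x}(x_0,y_0)=p_0\quad\text{and}\quad \frac{\partial v}{\partial y}(x_0,y_0)=q_0.$$
   Context: A domain in $\mathbb{R}^2$ is a closed, bounded, contractible subset $S\subset\mathbb{R}^2$ which is a disjoint union $S=S^\circ\cup\partial S$, where the interior $S^\circ$ is a connected open set with $S=\overline{S^\circ}$, and $\partial S=S\setminus S^\circ$ is a compact embedded hypersurface (smooth embedded curve). $C^1$ on a domain means continuous with continuous first derivatives on the whole closed domain. In the differential equations, $(x,y)$ are the standard coordinates on the domain of definition of the map. *)

theory Defs
  imports "HOL-Analysis.Analysis"
begin

text \<open>
  The plane is \<^typ>\<open>real \<times> real\<close>, with coordinates \<open>(x, y)\<close>.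
\<close>

text \<open>
  \<open>Ck_on k f U\<close>, intended for open \<open>U\<close>: \<open>f\<close> is \<open>k\<close> times continuously differentiable on \<open>U\<close>.
  The functions \<open>fx\<close> and \<open>fy\<close> are the partial derivatives of \<open>f\<close>.
\<close>

primrec Ck_on :: "nat \<Rightarrow> (real \<times> real \<Rightarrow> real \<times> real) \<Rightarrow> (real \<times> real) set \<Rightarrow> bool" where
  "Ck_on 0 f U \<longleftrightarrow> continuous_on U f"
| "Ck_on (Suc k) f U \<longleftrightarrow>
     (\<exists>fx fy. (\<forall>z\<in>U. (f has_derivative (\<lambda>h. fst h *\<^sub>R fx z + snd h *\<^sub>R fy z)) (at z)) \<and>
              Ck_on k fx U \<and> Ck_on k fy U)"

definition smooth_on :: "(real \<times> real) set \<Rightarrow> (real \<times> real \<Rightarrow> real \<times> real) \<Rightarrow> bool" where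
  "smooth_on U f \<longleftrightarrow> (\<forall>k. Ck_on k f U)"

text \<open>
  One-dimensional smooth embedded submanifolds of the plane (without boundary, not necessarily
  connected), described by slice charts: \<open>\<phi>\<close> is a diffeomorphism from \<open>U\<close> onto \<open>V\<close>, with
  inverse \<open>\<psi>\<close>, that straightens \<open>M\<close> to the horizontal axis.
\<close>

definition smooth_embedded_curve :: "(real \<times> real) set \<Rightarrow> bool" where
  "smooth_embedded_curve M \<longleftrightarrow>
     (\<forall>z\<in>M. \<exists>U V \<phi> \<psi>. open U \<and> z \<in> U \<and> open V \<and> homeomorphism U V \<phi> \<psi> \<and>
        smooth_on U \<phi> \<and> smooth_on V \<psi> \<and>
        \<phi> ` (U \<inter> M) = V \<inter> {w. snd w = 0})"

text \<open>
  The library's \<^const>\<open>contractible\<close> holds for the empty set, which is excluded separately.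
\<close>

definition planar_domain :: "(real \<times> real) set \<Rightarrow> bool" where
  "planar_domain S \<longleftrightarrow>
     S \<noteq> {} \<and> closed S \<and> bounded S \<and> contractible S \<and>
     connected (interior S) \<and> S = closure (interior S) \<and>
     compact (S - interior S) \<and> smooth_embedded_curve (S - interior S)"

text \<open>
  Partial derivatives on a closed domain \<open>S\<close>, boundary points included, are read off from the
  derivative within \<open>S\<close>. That derivative is unique if it exists, since \<open>S\<close> is locally a
  half-plane, up to diffeomorphism, near each of its boundary points.
\<close>

definition partial_x :: "(real \<times> real) set \<Rightarrow> (real \<times> real \<Rightarrow> real) \<Rightarrow> real \<times> real \<Rightarrow> real" where
  "partial_x S f z = frechet_derivative f (at z within S) (1, 0)"

definition partial_y :: "(real \<times> real) set \<Rightarrow> (real \<times> real \<Rightarrow> real) \<Rightarrow> real \<times> real \<Rightarrow> real" where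
  "partial_y S f z = frechet_derivative f (at z within S) (0, 1)"

definition C1_on :: "(real \<times> real) set \<Rightarrow> (real \<times> real \<Rightarrow> real) \<Rightarrow> bool" where
  "C1_on S f \<longleftrightarrow>
     f differentiable_on S \<and> continuous_on S (partial_x S f) \<and> continuous_on S (partial_y S f)"

definition solves_system ::
  "real \<Rightarrow> (real \<times> real) set \<Rightarrow> (real \<times> real \<Rightarrow> real) \<Rightarrow> (real \<times> real \<Rightarrow> real) \<Rightarrow> bool" where
  "solves_system a S u v \<longleftrightarrow>
     (\<forall>(x, y)\<in>S.
        partial_x S u (x, y) = partial_y S v (x, y) \<and>
        partial_x S v (x, y) =
          - 2 * ((v (x, y))\<^sup>2 + y\<^sup>2 + a\<^sup>2) powr (1/2) * partial_y S u (x, y))"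

end

theory Submission
  imports Defs "HOL-Complex_Analysis.Complex_Analysis"
begin

text \<open>
  Write \<open>f = (u, v)\<close> and \<open>f' = (uh, vh)\<close>, and suppose that \<open>f\<close> exists. The contradiction is a count of the
  zeros of \<open>F = f \<circ> f' - id\<close> in the interior of \<open>S\<close>.

  The count is one. The map \<open>f \<circ> f'\<close> sends \<open>S\<close> into a compact subset of the interior of \<open>S\<close>, and
  this interior is a topological disc. Contracting the image to the point \<open>s0 = (xh0, yh0)\<close> inside
  the disc deforms \<open>F\<close> into \<open>s0 - id\<close> without zeros near the boundary
  (\<open>conformal_parametrisation\<close>, \<open>self_map_logarithm\<close>).

  The count is at least two. Both derivatives have the form \<open>q + p N\<close> with
  \<open>N = [[0, -c], [1, 0]]\<close>, \<open>N\<^sup>2 = -c\<close>, where \<open>c\<close> is half of \<open>(v\<^sup>2 + y\<^sup>2 + a\<^sup>2) powr (- 1/2)\<close>, and the values of \<open>c\<close> at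
  \<open>z\<close> and at \<open>f' z\<close> differ by a multiple of the second component of \<open>F z\<close>, because \<open>c\<close> is symmetric in
  \<open>v\<close> and \<open>y\<close>. Hence \<open>F\<close> satisfies a linear elliptic first order system with leading part of
  Cauchy--Riemann type and with a bounded term of order zero (\<open>composed_system\<close>). For such maps zeros count
  positively, and double zeros count at least twice. The prescribed data say that the derivative of \<open>f\<close> at
  \<open>f' s0\<close> is the inverse of the derivative of \<open>f'\<close> at \<open>s0\<close>, so \<open>F\<close> has a double zero at \<open>s0\<close>.

  The zeros of \<open>F\<close> are not known to be isolated, and the coefficients of the system are only \<open>C\<^sup>1\<close> in the leading
  part and continuous in the other terms; so the count is carried out by integrals. In a conformal coordinate
  \<open>w\<close> on the disc, with \<open>s0\<close> at the origin, \<open>F\<close> becomes a map \<open>h = (a, b)\<close> with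
  \<open>\<nabla>a = Q \<nabla>b + O(|h|)\<close>, \<open>Q\<^sup>2 = -1\<close>. Let \<open>A = ln (|h|\<^sup>2 + \<epsilon>\<^sup>2) / 2\<close> and let
  \<open>T = (a \<nabla>b - b \<nabla>a) / (|h|\<^sup>2 + \<epsilon>\<^sup>2)\<close> be the regularised gradient of the argument of \<open>h\<close>.
  Then \<open>T = - Q \<nabla>A + O(1)\<close>, and the curl of \<open>T\<close> is a density which counts zeros as
  \<open>\<epsilon> \<rightarrow> 0\<close> and whose negative part tends to zero (\<open>angular_form_curl\<close>, \<open>mass_density_ge\<close>). Testing with
  \<open>G w = \<Phi> (|w|\<^sup>2)\<close> turns this into an identity for the integral of \<open>A\<close> against the divergence of
  \<open>P \<nabla>G\<close>, where \<open>P\<close> is the symmetric matrix belonging to \<open>Q\<close> (\<open>flux_identity\<close>). The same identity for the map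
  \<open>w\<close> itself, which has the same total mass (\<open>total_mass_difference_tendsto\<close>), all of it at the maximum of
  \<open>G\<close>, is subtracted. If \<open>G\<close> is a regularised multiple of \<open>- ln |w|\<close> that is superharmonic for \<open>P\<close>
  (\<open>profile_estimates\<close>), the result is a bound from above, independent of the regularisation, for a weighted
  mean of \<open>ln (|w| / |h|)\<close> close to the origin. A double zero makes these means tend to infinity
  (\<open>no_degenerate_zero\<close>).
\<close>

section \<open>Continuously differentiable functions on the plane\<close>

text \<open>
  The partial derivatives are carried along as explicit functions, since the arguments below are pointwise
  identities between them.
\<close>

definition C1_grad :: "(real \<times> real) set \<Rightarrow> (real \<times> real \<Rightarrow> real) \<Rightarrow> (real \<times> real \<Rightarrow> real) \<Rightarrow>
    (real \<times> real \<Rightarrow> real) \<Rightarrow> bool" where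
  "C1_grad U f fx fy \<longleftrightarrow>
     (\<forall>z\<in>U. (f has_derivative (\<lambda>h. fx z * fst h + fy z * snd h)) (at z)) \<and>
     continuous_on U fx \<and> continuous_on U fy"

lemma C1_gradD:
  assumes "C1_grad U f fx fy"
  shows "z \<in> U \<Longrightarrow> (f has_derivative (\<lambda>h. fx z * fst h + fy z * snd h)) (at z)"
    and "continuous_on U f" and "continuous_on U fx" and "continuous_on U fy"
  using assms unfolding C1_grad_def
  by (auto intro!: continuous_at_imp_continuous_on has_derivative_continuous)

lemma C1_grad_subset: "C1_grad U f fx fy \<Longrightarrow> V \<subseteq> U \<Longrightarrow> C1_grad V f fx fy"
  unfolding C1_grad_def using continuous_on_subset by blast

lemma C1_grad_const: "C1_grad U (\<lambda>_. c) (\<lambda>_. 0) (\<lambda>_. 0)"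
  unfolding C1_grad_def by (auto intro!: derivative_eq_intros)

lemma C1_grad_fst: "C1_grad U fst (\<lambda>_. 1) (\<lambda>_. 0)"
  unfolding C1_grad_def by (auto intro!: derivative_eq_intros)

lemma C1_grad_snd: "C1_grad U snd (\<lambda>_. 0) (\<lambda>_. 1)"
  unfolding C1_grad_def by (auto intro!: derivative_eq_intros)

lemma C1_grad_add:
  assumes "C1_grad U f fx fy" "C1_grad U g gx gy"
  shows "C1_grad U (\<lambda>z. f z + g z) (\<lambda>z. fx z + gx z) (\<lambda>z. fy z + gy z)"
  unfolding C1_grad_def
  apply (intro conjI ballI)
    apply (rule derivative_eq_intros C1_gradD(1)[OF assms(1)] C1_gradD(1)[OF assms(2)] | assumption)+
    apply (simp add: algebra_simps)
  using assms by (auto intro!: continuous_intros simp: C1_grad_def)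

lemma C1_grad_mult:
  assumes "C1_grad U f fx fy" "C1_grad U g gx gy"
  shows "C1_grad U (\<lambda>z. f z * g z) (\<lambda>z. fx z * g z + f z * gx z) (\<lambda>z. fy z * g z + f z * gy z)"
  unfolding C1_grad_def
  apply (intro conjI ballI)
    apply (rule derivative_eq_intros C1_gradD(1)[OF assms(1)] C1_gradD(1)[OF assms(2)] | assumption)+
    apply (simp add: algebra_simps)
  using assms C1_gradD(2)[OF assms(1)] C1_gradD(2)[OF assms(2)]
  by (auto intro!: continuous_intros simp: C1_grad_def)

lemma C1_grad_cmult:
  assumes "C1_grad U f fx fy"
  shows "C1_grad U (\<lambda>z. c * f z) (\<lambda>z. c * fx z) (\<lambda>z. c * fy z)"
  using C1_grad_mult[OF C1_grad_const assms, of c] by simp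

lemma C1_grad_diff:
  assumes "C1_grad U f fx fy" "C1_grad U g gx gy"
  shows "C1_grad U (\<lambda>z. f z - g z) (\<lambda>z. fx z - gx z) (\<lambda>z. fy z - gy z)"
  using C1_grad_add[OF assms(1) C1_grad_cmult[OF assms(2), of "-1"]] by simp

lemma C1_grad_chain:
  assumes f: "C1_grad U f fx fy"
    and g: "\<And>z. z \<in> U \<Longrightarrow> (g has_real_derivative g' (f z)) (at (f z))"
    and c: "continuous_on U (\<lambda>z. g' (f z))"
  shows "C1_grad U (\<lambda>z. g (f z)) (\<lambda>z. g' (f z) * fx z) (\<lambda>z. g' (f z) * fy z)"
  unfolding C1_grad_def
proof (intro conjI ballI)
  fix z assume z: "z \<in> U"
  have "(g has_derivative (*) (g' (f z))) (at (f z))"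
    using g[OF z] by (simp add: has_field_derivative_def)
  from diff_chain_at[OF C1_gradD(1)[OF f z] this]
  show "((\<lambda>z. g (f z)) has_derivative (\<lambda>h. g' (f z) * fx z * fst h + g' (f z) * fy z * snd h)) (at z)"
    by (simp add: o_def algebra_simps)
qed (use f c in \<open>auto intro!: continuous_intros simp: C1_grad_def\<close>)

lemma C1_grad_compose:
  assumes f: "C1_grad V f fx fy" and X: "C1_grad U X Xx Xy" and Y: "C1_grad U Y Yx Yy"
    and UV: "\<And>z. z \<in> U \<Longrightarrow> (X z, Y z) \<in> V"
  shows "C1_grad U (\<lambda>z. f (X z, Y z)) (\<lambda>z. fx (X z, Y z) * Xx z + fy (X z, Y z) * Yx z)
    (\<lambda>z. fx (X z, Y z) * Xy z + fy (X z, Y z) * Yy z)"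
  unfolding C1_grad_def
proof (intro conjI ballI)
  fix z assume z: "z \<in> U"
  have "((\<lambda>z. (X z, Y z)) has_derivative (\<lambda>h. (Xx z * fst h + Xy z * snd h, Yx z * fst h + Yy z * snd h))) (at z)"
    by (rule has_derivative_Pair[OF C1_gradD(1)[OF X z] C1_gradD(1)[OF Y z]])
  from diff_chain_at[OF this C1_gradD(1)[OF f UV[OF z]]]
  show "((\<lambda>z. f (X z, Y z)) has_derivative (\<lambda>h. (fx (X z, Y z) * Xx z + fy (X z, Y z) * Yx z) * fst h +
      (fx (X z, Y z) * Xy z + fy (X z, Y z) * Yy z) * snd h)) (at z)"
    by (simp add: o_def algebra_simps)
next
  have c: "continuous_on U (\<lambda>z. (X z, Y z))" using C1_gradD(2)[OF X] C1_gradD(2)[OF Y] by (intro continuous_intros)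
  have "continuous_on U (\<lambda>z. fx (X z, Y z))" "continuous_on U (\<lambda>z. fy (X z, Y z))"
    by (rule continuous_on_compose2[OF C1_gradD(3)[OF f] c] continuous_on_compose2[OF C1_gradD(4)[OF f] c]; use UV in blast)+
  then show "continuous_on U (\<lambda>z. fx (X z, Y z) * Xx z + fy (X z, Y z) * Yx z)"
    "continuous_on U (\<lambda>z. fx (X z, Y z) * Xy z + fy (X z, Y z) * Yy z)"
    using C1_gradD(3,4)[OF X] C1_gradD(3,4)[OF Y] by (auto intro!: continuous_intros)
qed

definition C1_fun :: "(real \<times> real) set \<Rightarrow> (real \<times> real \<Rightarrow> real) \<Rightarrow> bool" where
  "C1_fun U f \<longleftrightarrow> (\<exists>fx fy. C1_grad U f fx fy)"

lemma C1_funI: "C1_grad U f fx fy \<Longrightarrow> C1_fun U f" by (auto simp: C1_fun_def)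

lemma C1_fun_arith:
  assumes "C1_fun U f" "C1_fun U g"
  shows "C1_fun U (\<lambda>z. f z + g z)" "C1_fun U (\<lambda>z. f z - g z)" "C1_fun U (\<lambda>z. f z * g z)"
proof -
  obtain fx fy gx gy where f: "C1_grad U f fx fy" and g: "C1_grad U g gx gy"
    using assms unfolding C1_fun_def by blast
  show "C1_fun U (\<lambda>z. f z + g z)" by (rule C1_funI[OF C1_grad_add[OF f g]])
  show "C1_fun U (\<lambda>z. f z - g z)" by (rule C1_funI[OF C1_grad_diff[OF f g]])
  show "C1_fun U (\<lambda>z. f z * g z)" by (rule C1_funI[OF C1_grad_mult[OF f g]])
qed

lemma C1_fun_inverse:
  assumes "C1_fun U f" "\<And>z. z \<in> U \<Longrightarrow> f z \<noteq> 0"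
  shows "C1_fun U (\<lambda>z. inverse (f z))"
proof -
  obtain fx fy where f: "C1_grad U f fx fy" using assms(1) by (auto simp: C1_fun_def)
  show ?thesis
  proof (rule C1_funI[OF C1_grad_chain[OF f]])
    fix z assume "z \<in> U"
    then show "(inverse has_real_derivative - ((inverse (f z))\<^sup>2)) (at (f z))"
      using DERIV_inverse[OF assms(2), of z UNIV] by (simp add: numeral_2_eq_2)
  next
    show "continuous_on U (\<lambda>z. - ((inverse (f z))\<^sup>2))"
      using assms(2) C1_gradD(2)[OF f] by (intro continuous_intros) auto
  qed
qed

lemma C1_grad_cong:
  assumes "C1_grad U f fx fy" "open U" "\<And>z. z \<in> U \<Longrightarrow> f z = f' z"
    "\<And>z. z \<in> U \<Longrightarrow> fx z = fx' z" "\<And>z. z \<in> U \<Longrightarrow> fy z = fy' z"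
  shows "C1_grad U f' fx' fy'"
  unfolding C1_grad_def
proof (intro conjI ballI)
  fix z assume z: "z \<in> U"
  show "(f' has_derivative (\<lambda>h. fx' z * fst h + fy' z * snd h)) (at z)"
    using has_derivative_transform_within_open[OF C1_gradD(1)[OF assms(1) z] assms(2) z assms(3)]
      assms(4,5)[OF z] by simp
next
  show "continuous_on U fx'" "continuous_on U fy'"
    using C1_gradD(3,4)[OF assms(1)] assms(4,5) by (simp_all cong: continuous_on_cong_simp)
qed

lemma C1_grad_Un:
  assumes "C1_grad U f fx fy" "C1_grad V f fx fy" "open U" "open V"
  shows "C1_grad (U \<union> V) f fx fy"
  using assms unfolding C1_grad_def by (auto intro: continuous_on_open_Un)

text \<open>
  The factor \<open>f\<close> may be arbitrary outside \<open>U\<close>: the product is zero near every point there.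
\<close>

lemma C1_grad_extend:
  assumes q: "C1_grad UNIV q qx qy" and K: "closed K" "\<And>z. z \<notin> K \<Longrightarrow> q z = 0 \<and> qx z = 0 \<and> qy z = 0"
    and U: "open U" "K \<subseteq> U" and f: "C1_grad U f fx fy"
  shows "C1_grad UNIV (\<lambda>z. q z * f z) (\<lambda>z. qx z * f z + q z * fx z) (\<lambda>z. qy z * f z + q z * fy z)"
proof -
  have 1: "C1_grad U (\<lambda>z. q z * f z) (\<lambda>z. qx z * f z + q z * fx z) (\<lambda>z. qy z * f z + q z * fy z)"
    by (rule C1_grad_mult[OF C1_grad_subset[OF q subset_UNIV] f])
  have 2: "C1_grad (- K) (\<lambda>z. q z * f z) (\<lambda>z. qx z * f z + q z * fx z) (\<lambda>z. qy z * f z + q z * fy z)"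
    by (rule C1_grad_cong[OF C1_grad_const[of _ 0]]) (use K in auto)
  have "U \<union> - K = UNIV" using U by auto
  with C1_grad_Un[OF 1 2 U(1)] K(1) show ?thesis by (simp add: open_Compl)
qed

lemma continuous_on_extend:
  fixes q f :: "real \<times> real \<Rightarrow> real"
  assumes "continuous_on UNIV q" "closed K" "\<And>z. z \<notin> K \<Longrightarrow> q z = 0" "open U" "K \<subseteq> U" "continuous_on U f"
  shows "continuous_on UNIV (\<lambda>z. q z * f z)"
proof -
  have 1: "continuous_on (- K) (\<lambda>z. q z * f z)"
    by (rule continuous_on_eq[OF continuous_on_const[of _ 0]]) (use assms(3) in auto)
  have 2: "continuous_on U (\<lambda>z. q z * f z)"
    using assms(6) continuous_on_subset[OF assms(1) subset_UNIV] by (intro continuous_on_mult)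
  have "U \<union> - K = UNIV" using assms(5) by auto
  with continuous_on_open_Un[OF assms(4) _ 2 1] assms(2) show ?thesis by (simp add: open_Compl)
qed

text \<open>
  The partial derivatives are required to vanish off the disc of radius \<open>r\<close> as well, so that expressions in
  \<open>q\<close>, \<open>qx\<close>, \<open>qy\<close> and functions on the unit disc are zero there without case distinctions.
\<close>

definition cutoff :: "real \<Rightarrow> (real \<times> real \<Rightarrow> real) \<Rightarrow> (real \<times> real \<Rightarrow> real) \<Rightarrow>
    (real \<times> real \<Rightarrow> real) \<Rightarrow> bool" where
  "cutoff r q qx qy \<longleftrightarrow> C1_grad UNIV q qx qy \<and>
     (\<forall>z. r < norm z \<longrightarrow> q z = 0 \<and> qx z = 0 \<and> qy z = 0)"

lemma cutoffD:
  assumes "cutoff r q qx qy"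
  shows "continuous_on UNIV q" "continuous_on UNIV qx" "continuous_on UNIV qy"
    "\<And>z. r < norm z \<Longrightarrow> q z = 0" "\<And>z. r < norm z \<Longrightarrow> qx z = 0" "\<And>z. r < norm z \<Longrightarrow> qy z = 0"
  using assms C1_gradD(2-4)[of UNIV q qx qy] by (auto simp: cutoff_def)

lemma continuous_on_cutoff_mult:
  fixes q f :: "real \<times> real \<Rightarrow> real"
  assumes "continuous_on UNIV q" "\<And>z. r < norm z \<Longrightarrow> q z = 0" "r < 1" "continuous_on (ball 0 1) f"
  shows "continuous_on UNIV (\<lambda>z. q z * f z)"
proof (rule continuous_on_extend[OF assms(1) closed_cball _ open_ball _ assms(4)])
  show "q z = 0" if "z \<notin> cball 0 r" for z using assms(2) that by simp
  show "cball 0 r \<subseteq> ball (0 :: real \<times> real) 1" using assms(3) by auto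
qed

lemma cutoff_mult:
  assumes q: "cutoff r q qx qy" and r: "r < 1" and f: "C1_grad (ball 0 1) f fx fy"
  shows "cutoff r (\<lambda>z. q z * f z) (\<lambda>z. qx z * f z + q z * fx z) (\<lambda>z. qy z * f z + q z * fy z)"
proof -
  have q1: "C1_grad UNIV q qx qy" and q0: "\<And>z. r < norm z \<Longrightarrow> q z = 0 \<and> qx z = 0 \<and> qy z = 0"
    using q by (auto simp: cutoff_def)
  have off: "q z = 0 \<and> qx z = 0 \<and> qy z = 0" if "z \<notin> cball 0 r" for z
    using q0[of z] that by simp
  have sub: "cball 0 r \<subseteq> ball (0 :: real \<times> real) 1" using r by auto
  show ?thesis
    unfolding cutoff_def
    by (intro conjI C1_grad_extend[OF q1 closed_cball off open_ball sub f] allI impI) (use q0 in auto)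
qed

lemma norm_ge_fst_snd: "\<bar>fst z\<bar> \<le> norm z" "\<bar>snd z\<bar> \<le> norm z" for z :: "real \<times> real"
  using norm_fst_le[of "fst z" "snd z"] norm_snd_le[of "snd z" "fst z"] by simp_all

lemma bounded_on_cball:
  fixes f :: "real \<times> real \<Rightarrow> real"
  assumes "continuous_on (ball 0 1) f" "r < 1"
  obtains M where "M > 0" "\<And>z. z \<in> cball 0 r \<Longrightarrow> \<bar>f z\<bar> \<le> M"
proof -
  have "compact (f ` cball 0 r)"
    using assms by (intro compact_continuous_image continuous_on_subset[OF assms(1)]) auto
  then have "bounded (f ` cball 0 r)" by (rule compact_imp_bounded)
  then show thesis using that unfolding bounded_pos by auto
qed

lemma C1_lipschitz_at_0:
  assumes f: "C1_grad (ball 0 1) f fx fy" and r: "0 \<le> r" "r < 1"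
  obtains L where "L > 0" "\<And>z. z \<in> cball 0 r \<Longrightarrow> \<bar>f z - f 0\<bar> \<le> L * norm z"
proof -
  have "compact ((\<lambda>z. \<bar>fx z\<bar> + \<bar>fy z\<bar>) ` cball 0 r)"
  proof (rule compact_continuous_image)
    have "cball 0 r \<subseteq> ball (0::real \<times> real) 1" using r by auto
    then show "continuous_on (cball 0 r) (\<lambda>z. \<bar>fx z\<bar> + \<bar>fy z\<bar>)"
      using continuous_on_subset[OF C1_gradD(3)[OF f]] continuous_on_subset[OF C1_gradD(4)[OF f]]
      by (intro continuous_on_add continuous_on_rabs)
  qed simp
  then have "bounded ((\<lambda>z. \<bar>fx z\<bar> + \<bar>fy z\<bar>) ` cball 0 r)" by (rule compact_imp_bounded)
  then obtain L where "L > 0" "\<forall>x\<in>(\<lambda>z. \<bar>fx z\<bar> + \<bar>fy z\<bar>) ` cball 0 r. norm x \<le> L"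
    unfolding bounded_pos by blast
  then have L: "L > 0" "\<And>z. z \<in> cball 0 r \<Longrightarrow> \<bar>fx z\<bar> + \<bar>fy z\<bar> \<le> L"
    by fastforce+
  show thesis
  proof (rule that[OF L(1)])
    fix z :: "real \<times> real" assume z: "z \<in> cball 0 r"
    have "norm (f z - f 0) \<le> L * norm (z - 0)"
    proof (rule differentiable_bound[where S="cball 0 r" and f'="\<lambda>z h. fx z * fst h + fy z * snd h"])
      fix x :: "real \<times> real" assume x: "x \<in> cball 0 r"
      then have "x \<in> ball 0 1" using r by auto
      then show "(f has_derivative (\<lambda>h. fx x * fst h + fy x * snd h)) (at x within cball 0 r)"
        by (rule has_derivative_at_withinI[OF C1_gradD(1)[OF f]])
      show "onorm (\<lambda>h. fx x * fst h + fy x * snd h) \<le> L"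
      proof (rule onorm_le)
        fix h :: "real \<times> real"
        have "norm (fx x * fst h + fy x * snd h) \<le> \<bar>fx x\<bar> * \<bar>fst h\<bar> + \<bar>fy x\<bar> * \<bar>snd h\<bar>"
          using abs_triangle_ineq[of "fx x * fst h" "fy x * snd h"] by (simp add: abs_mult)
        also have "\<dots> \<le> \<bar>fx x\<bar> * norm h + \<bar>fy x\<bar> * norm h"
          by (intro add_mono mult_left_mono norm_ge_fst_snd abs_ge_zero)
        also have "\<dots> \<le> L * norm h" using L(2)[OF x] by (simp add: ring_distribs[symmetric] mult_right_mono)
        finally show "norm (fx x * fst h + fy x * snd h) \<le> L * norm h" .
      qed
    qed (use r z in auto)
    then show "\<bar>f z - f 0\<bar> \<le> L * norm z" by simp
  qed
qed

lemma C1_little_o_at_0: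
  assumes f: "C1_grad (ball 0 1) f fx fy" and "f 0 = 0" "fx 0 = 0" "fy 0 = 0" and \<omega>: "\<omega> > 0"
  obtains d where "d > 0" "\<And>z. norm z < d \<Longrightarrow> \<bar>f z\<bar> \<le> \<omega> * norm z"
proof -
  have "(f has_derivative (\<lambda>h. 0)) (at 0)"
    using C1_gradD(1)[OF f, of 0] assms by simp
  then have "\<forall>e>0. \<exists>d>0. \<forall>y. norm (y - 0) < d \<longrightarrow> norm (f y - f 0 - 0) \<le> e * norm (y - 0)"
    unfolding has_derivative_at_alt by (rule conjunct2)
  from this[rule_format, OF \<omega>] obtain d where d: "d > 0" and dd: "\<forall>y. norm (y - 0) < d \<longrightarrow> norm (f y - f 0 - 0) \<le> \<omega> * norm (y - 0)"
    by blast
  show thesis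
  proof (rule that[OF d])
    fix z :: "real \<times> real" assume "norm z < d"
    then show "\<bar>f z\<bar> \<le> \<omega> * norm z" using dd[rule_format, of z] assms(2) by simp
  qed
qed

section \<open>Integrals of partial derivatives and of Jacobians\<close>

abbreviation square :: "(real \<times> real) set" where "square \<equiv> cbox (-1, -1) (1, 1)"

lemma C1_grad_slices:
  assumes "C1_grad UNIV k kx ky"
  shows "((\<lambda>x. k (x, y)) has_real_derivative kx (x, y)) (at x within A)"
    and "((\<lambda>y. k (x, y)) has_real_derivative ky (x, y)) (at y within A)"
proof -
  have d: "(k has_derivative (\<lambda>h. kx (x,y) * fst h + ky (x,y) * snd h)) (at (x,y))"
    by (rule C1_gradD(1)[OF assms]) simp
  have "((\<lambda>x. (x,y)) has_derivative (\<lambda>h. (h, 0))) (at x)"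
    by (auto intro!: derivative_eq_intros)
  from diff_chain_at[OF this d]
  have "((\<lambda>x. k (x, y)) has_real_derivative kx (x, y)) (at x)"
    by (simp add: o_def has_field_derivative_def)
  then show "((\<lambda>x. k (x, y)) has_real_derivative kx (x, y)) (at x within A)"
    by (rule has_field_derivative_at_within)
  have "((\<lambda>y. (x,y)) has_derivative (\<lambda>h. (0, h))) (at y)"
    by (auto intro!: derivative_eq_intros)
  from diff_chain_at[OF this d]
  have "((\<lambda>y. k (x, y)) has_real_derivative ky (x, y)) (at y)"
    by (simp add: o_def has_field_derivative_def)
  then show "((\<lambda>y. k (x, y)) has_real_derivative ky (x, y)) (at y within A)"
    by (rule has_field_derivative_at_within)
qed

text \<open>
  By Fubini, from the fundamental theorem of calculus on each line parallel to an axis.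
\<close>

lemma integral_partial_eq_0:
  assumes "cutoff r k kx ky" "r < 1"
  shows "integral square kx = 0" "integral square ky = 0"
proof -
  have k: "C1_grad UNIV k kx ky" and k0: "\<And>z. r < norm z \<Longrightarrow> k z = 0"
    using assms by (auto simp: cutoff_def)
  have e: "k (1, t) = 0 \<and> k (-1, t) = 0 \<and> k (t, 1) = 0 \<and> k (t, -1) = 0" for t
    using norm_ge_fst_snd(1)[of "(1,t)"] norm_ge_fst_snd(1)[of "(-1,t)"] norm_ge_fst_snd(2)[of "(t,1)"] 
      norm_ge_fst_snd(2)[of "(t,-1)"] assms(2) by (auto intro!: k0)
  have c: "continuous_on square kx" "continuous_on square ky"
    using C1_gradD(3,4)[OF k] continuous_on_subset by blast+
  have x: "integral {-1..1} (\<lambda>x. kx (x, y)) = 0" for y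
    using fundamental_theorem_of_calculus[of "-1" 1 "\<lambda>x. k (x,y)" "\<lambda>x. kx (x,y)"] C1_grad_slices(1)[OF k] e
    by (simp add: has_real_derivative_iff_has_vector_derivative integral_unique)
  have y: "integral {-1..1} (\<lambda>y. ky (x, y)) = 0" for x
    using fundamental_theorem_of_calculus[of "-1" 1 "\<lambda>y. k (x,y)" "\<lambda>y. ky (x,y)"] C1_grad_slices(2)[OF k] e
    by (simp add: has_real_derivative_iff_has_vector_derivative integral_unique)
  show "integral square ky = 0"
    by (subst integral_prod_continuous[OF c(2)]) (simp add: y)
  show "integral square kx = 0"
    apply (subst integral_prod_continuous[OF c(1)])
    apply (subst integral_swap_continuous)
    using c(1) apply (simp add: case_prod_beta)
    apply (simp add: x)
    done
qed

lemma C1_shift: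
  assumes "C1_grad UNIV b bx by"
  shows "C1_grad UNIV (\<lambda>z. b (fst z, snd z + t)) (\<lambda>z. bx (fst z, snd z + t)) (\<lambda>z. by (fst z, snd z + t))"
  unfolding C1_grad_def
proof (intro conjI ballI)
  fix z :: "real \<times> real"
  have "((\<lambda>z. (fst z, snd z + t)) has_derivative (\<lambda>h. h)) (at z)"
    by (auto intro!: derivative_eq_intros)
  from diff_chain_at[OF this C1_gradD(1)[OF assms]]
  show "((\<lambda>z. b (fst z, snd z + t)) has_derivative
     (\<lambda>h. bx (fst z, snd z + t) * fst h + by (fst z, snd z + t) * snd h)) (at z)"
    by (simp add: o_def)
qed (auto intro!: continuous_intros continuous_on_compose2[OF C1_gradD(3)[OF assms]] 
      continuous_on_compose2[OF C1_gradD(4)[OF assms]])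

text \<open>
  If \<open>B\<close> is a primitive of \<open>f\<close>, the quotient \<open>(f (y + t) - f y) / t\<close> is the derivative of
  \<open>(B (y + t) - B y) / t\<close>, which is a value of \<open>f\<close> at a point between \<open>y\<close> and \<open>y + t\<close> and hence \<open>w\<close>-close to
  \<open>f y\<close>. In this form integration by parts applies to a merely continuous \<open>f\<close>.
\<close>

lemma difference_quotient_by_parts:
  fixes k f :: "real \<Rightarrow> real"
  assumes k: "\<And>y. (k has_real_derivative k' y) (at y)" and k': "continuous_on UNIV k'"
    and k0: "k (-1) = 0" "k 1 = 0" and f: "continuous_on UNIV f" and t: "0 < t" "t \<le> 1"
    and w: "\<And>y s. y \<in> {-1..1} \<Longrightarrow> y \<le> s \<Longrightarrow> s \<le> y + t \<Longrightarrow> \<bar>f s - f y\<bar> \<le> w"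
    and C: "\<And>y. y \<in> {-1..1} \<Longrightarrow> \<bar>k' y\<bar> \<le> C"
  shows "\<bar>integral {-1..1} (\<lambda>y. k y * ((f (y + t) - f y) / t)) + integral {-1..1} (\<lambda>y. k' y * f y)\<bar> \<le> 2 * C * w"
proof -
  obtain B where B: "\<And>x. x \<in> {-2..3} \<Longrightarrow> (B has_vector_derivative f x) (at x within {-2..3})"
    using antiderivative_continuous[of "-2" 3 f] continuous_on_subset[OF f] by blast
  have B': "(B has_real_derivative f x) (at x)" if "-2 < x" "x < 3" for x
    using B[of x] that at_within_interior[of x "{-2..3}"]
    by (simp add: has_real_derivative_iff_has_vector_derivative)
  define M where "M y = (B (y + t) - B y) / t" for y
  have M': "(M has_real_derivative (f (y + t) - f y) / t) (at y)" if "y \<in> {-1..1}" for y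
  proof -
    have "((\<lambda>y. B (y + t)) has_real_derivative f (y + t)) (at y)"
      using B'[of "y + t"] that t by (subst DERIV_shift[symmetric]) auto
    from DERIV_cdivide[OF DERIV_diff[OF this B'], of t] that show ?thesis
      unfolding M_def by simp
  qed
  have ck: "continuous_on {-1..1} k"
    by (rule DERIV_continuous_on[where D=k']) (rule has_field_derivative_at_within[OF k])
  have ct: "continuous_on {-1..1} k'" "continuous_on {-1..1} f" "continuous_on {-1..1} (\<lambda>y. f (y+t))"
    by (rule continuous_on_subset[OF k'] continuous_on_subset[OF f] subset_UNIV
        continuous_on_compose2[OF f] continuous_intros)+
  note ct = ck ct
  have cM: "continuous_on {-1..1} M"
    by (rule DERIV_continuous_on[where D="\<lambda>y. (f (y + t) - f y) / t"])
      (use M' in \<open>auto intro: has_field_derivative_at_within\<close>)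
  have ff: "((\<lambda>y. k y * ((f (y + t) - f y) / t) + k' y * M y) has_integral k 1 * M 1 - k (-1) * M (-1)) {-1..1}"
  proof (rule fundamental_theorem_of_calculus)
    fix y assume "y \<in> {-1..1::real}"
    then have "((\<lambda>y. k y * M y) has_real_derivative k y * ((f (y + t) - f y) / t) + k' y * M y) (at y)"
      using k M' by (auto intro!: derivative_eq_intros)
    then show "((\<lambda>y. k y * M y) has_vector_derivative k y * ((f (y + t) - f y) / t) + k' y * M y) (at y within {-1..1})"
      using has_real_derivative_iff_has_vector_derivative has_vector_derivative_at_within by blast
  qed simp
  have Mf: "\<bar>M y - f y\<bar> \<le> w" if y: "y \<in> {-1..1}" for y
  proof -
    have "\<exists>z>y. z < y + t \<and> B (y + t) - B y = (y + t - y) * f z"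
      using t y by (intro MVT2) (auto intro!: B')
    then obtain z where z: "y < z" "z < y + t" "B (y + t) - B y = t * f z" by auto
    then have "M y = f z" using t by (simp add: M_def)
    then show ?thesis using w[of y z] z y by auto
  qed
  have i: "(\<lambda>y. k y * ((f (y + t) - f y) / t)) integrable_on {-1..1}" "(\<lambda>y. k' y * M y) integrable_on {-1..1}"
     "(\<lambda>y. k' y * f y) integrable_on {-1..1}"
    using ct cM t by (auto intro!: integrable_continuous_interval continuous_intros)
  have "integral {-1..1} (\<lambda>y. k y * ((f (y + t) - f y) / t)) + integral {-1..1} (\<lambda>y. k' y * M y) = 0"
    using integral_unique[OF ff] k0 i by (simp add: integral_add)
  then have "integral {-1..1} (\<lambda>y. k y * ((f (y + t) - f y) / t)) + integral {-1..1} (\<lambda>y. k' y * f y)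
     = integral {-1..1} (\<lambda>y. k' y * f y - k' y * M y)"
    using i by (simp add: integral_diff)
  also have "\<bar>\<dots>\<bar> \<le> (C * w) * (1 - (-1))"
  proof (rule integral_bound[where 'a=real, simplified real_norm_def])
    fix y assume y: "y \<in> {-1..1::real}"
    have "\<bar>k' y * f y - k' y * M y\<bar> = \<bar>k' y\<bar> * \<bar>M y - f y\<bar>"
      by (simp add: abs_mult[symmetric] right_diff_distrib abs_minus_commute)
    also have "\<dots> \<le> C * w" using C[OF y] Mf[OF y] by (intro mult_mono) auto
    finally show "\<bar>k' y * f y - k' y * M y\<bar> \<le> C * w" .
  qed (use ct cM in \<open>auto intro!: continuous_intros\<close>)
  finally show ?thesis by (simp add: mult_ac)
qed

lemma measure_square: "measure lborel square = 4"
  by (subst content_Pair) simp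

lemma integral_square_bound:
  fixes f :: "real \<times> real \<Rightarrow> real"
  assumes "f integrable_on square" "\<And>z. z \<in> square \<Longrightarrow> \<bar>f z\<bar> \<le> B"
  shows "\<bar>integral square f\<bar> \<le> 4 * B"
proof -
  have "norm (integral square f) \<le> integral square (\<lambda>_. B)"
    using assms by (intro integral_norm_bound_integral) auto
  then show ?thesis using measure_square by simp
qed

text \<open>
  For \<open>b\<close> with continuous second derivatives this is two integrations by parts. Here \<open>by\<close> is replaced by a
  difference quotient \<open>D\<close> of \<open>b\<close> in the direction of \<open>y\<close>, which has an \<open>x\<close>-derivative. After the integration by parts in
  \<open>x\<close>, the quotient of \<open>bx\<close> is removed by an integration by parts in \<open>y\<close> along each vertical line.
\<close>

lemma integral_jacobian_eq_0_global:
  assumes k: "cutoff r k kx ky" and r: "r < 1" and b: "C1_grad UNIV b bx by"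
  shows "integral square (\<lambda>z. kx z * by z - ky z * bx z) = 0"
proof -
  have k1: "C1_grad UNIV k kx ky" and k0: "\<And>z. r < norm z \<Longrightarrow> k z = 0"
    using k by (auto simp: cutoff_def)
  note ck = C1_gradD(2-4)[OF k1] and cb = C1_gradD(2-4)[OF b]
  have cs: "continuous_on square k" "continuous_on square kx" "continuous_on square ky" 
    "continuous_on square bx" "continuous_on square by"
    using ck cb continuous_on_subset by blast+
  have "bounded (kx ` square)" "bounded (ky ` square)"
    using cs compact_cbox by (auto intro!: compact_imp_bounded compact_continuous_image)
  then obtain C1 C2 where "\<And>z. z \<in> square \<Longrightarrow> \<bar>kx z\<bar> \<le> C1" "\<And>z. z \<in> square \<Longrightarrow> \<bar>ky z\<bar> \<le> C2"
    unfolding bounded_iff by fastforce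
  then obtain C where C: "\<And>z. z \<in> square \<Longrightarrow> \<bar>kx z\<bar> \<le> C" "\<And>z. z \<in> square \<Longrightarrow> \<bar>ky z\<bar> \<le> C"
    by (metis linorder_linear order_trans)
  have e: "k (x, 1) = 0 \<and> k (x, -1) = 0" for x
    using norm_ge_fst_snd(2)[of "(x,1)"] norm_ge_fst_snd(2)[of "(x,-1)"] r by (auto intro!: k0)
  have C0: "0 \<le> C" using C(1)[of "(0,0)"] by simp
  let ?I = "integral square (\<lambda>z. kx z * by z - ky z * bx z)"
  have main: "\<bar>?I\<bar> \<le> 8 * C * w" if w: "w > 0" for w
  proof -
    let ?R = "cbox (-1,-1) (1,3) :: (real\<times>real) set"
    have "uniformly_continuous_on ?R bx" "uniformly_continuous_on ?R by"
      using cb continuous_on_subset by (auto intro!: compact_uniformly_continuous)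
    then obtain d1 d2 where d: "d1 > 0" "d2 > 0" 
       "\<And>z z'. z \<in> ?R \<Longrightarrow> z' \<in> ?R \<Longrightarrow> dist z' z < d1 \<Longrightarrow> dist (bx z') (bx z) < w"
       "\<And>z z'. z \<in> ?R \<Longrightarrow> z' \<in> ?R \<Longrightarrow> dist z' z < d2 \<Longrightarrow> dist (by z') (by z) < w"
      unfolding uniformly_continuous_on_def using w by metis
    define t where "t = min 1 (min d1 d2) / 2"
    have t: "0 < t" "t \<le> 1" "t < d1" "t < d2" using d by (auto simp: t_def)
    have osc: "\<bar>bx (x,s) - bx (x,y)\<bar> \<le> w" "\<bar>by (x,s) - by (x,y)\<bar> \<le> w"
      if "x \<in> {-1..1}" "y \<in> {-1..1}" "y \<le> s" "s \<le> y + t" for x y s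
      using d(3)[of "(x,y)" "(x,s)"] d(4)[of "(x,y)" "(x,s)"] that t
      by (auto simp: dist_Pair_Pair dist_real_def)
    define D where "D z = 1/t * (b (fst z, snd z + t) - b z)" for z
    define Dx where "Dx z = 1/t * (bx (fst z, snd z + t) - bx z)" for z
    define Dy where "Dy z = 1/t * (by (fst z, snd z + t) - by z)" for z
    have D: "C1_grad UNIV D Dx Dy"
      unfolding D_def Dx_def Dy_def by (intro C1_grad_cmult C1_grad_diff C1_shift b)
    have D': "\<bar>D z - by z\<bar> \<le> w" if z: "z \<in> square" for z
    proof -
      obtain x y where [simp]: "z = (x,y)" by (cases z)
      have xy: "x \<in> {-1..1}" "y \<in> {-1..1}" using z by (auto simp: cbox_Pair_eq)
      have "\<exists>s>y. s < y + t \<and> b (x, y + t) - b (x, y) = (y + t - y) * by (x, s)"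
        using t by (intro MVT2) (auto intro!: C1_grad_slices(2)[OF b])
      then obtain s where s: "y < s" "s < y + t" "b (x, y + t) - b (x, y) = t * by (x, s)" by auto
      then have "D z = by (x, s)" using t by (simp add: D_def)
      then show ?thesis using osc(2)[of x y s] xy s by simp
    qed
    note cD = continuous_on_subset[OF C1_gradD(2)[OF D] subset_UNIV] 
       continuous_on_subset[OF C1_gradD(3)[OF D] subset_UNIV]
    have "cutoff r (\<lambda>z. k z * D z) (\<lambda>z. kx z * D z + k z * Dx z) (\<lambda>z. ky z * D z + k z * Dy z)"
      by (rule cutoff_mult[OF k r C1_grad_subset[OF D]]) simp
    from integral_partial_eq_0(1)[OF this r]
    have 1: "integral square (\<lambda>z. kx z * D z) + integral square (\<lambda>z. k z * Dx z) = 0"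
      using cs cD by (subst integral_add[symmetric]) (auto intro!: integrable_continuous continuous_intros)
    have 2: "\<bar>integral square (\<lambda>z. kx z * D z) - integral square (\<lambda>z. kx z * by z)\<bar> \<le> 4 * (C * w)"
    proof -
      have "integral square (\<lambda>z. kx z * D z) - integral square (\<lambda>z. kx z * by z)
          = integral square (\<lambda>z. kx z * (D z - by z))"
        using cs cD by (subst integral_diff[symmetric])
          (auto intro!: integrable_continuous continuous_intros simp: right_diff_distrib)
      also have "\<bar>\<dots>\<bar> \<le> 4 * (C * w)"
        using cs cD C(1) D' C0 by (intro integral_square_bound)
          (auto intro!: integrable_continuous continuous_intros mult_mono simp: abs_mult)
      finally show ?thesis .
    qed
    have 3: "\<bar>integral square (\<lambda>z. k z * Dx z) + integral square (\<lambda>z. ky z * bx z)\<bar> \<le> 4 * (C * w)"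
    proof -
      have c1: "continuous_on square (\<lambda>z. k z * Dx z)" "continuous_on square (\<lambda>z. ky z * bx z)"
        using cs cD by (auto intro!: continuous_intros)
      let ?J = "\<lambda>x. integral {-1..1} (\<lambda>y. k (x,y) * Dx (x,y)) + integral {-1..1} (\<lambda>y. ky (x,y) * bx (x,y))"
      have i: "(\<lambda>x. integral {-1..1} (\<lambda>y. k (x,y) * Dx (x,y))) integrable_on {-1..1}"
         "(\<lambda>x. integral {-1..1} (\<lambda>y. ky (x,y) * bx (x,y))) integrable_on {-1..1}"
        using integral_integrable_2dim[OF c1(1)] integral_integrable_2dim[OF c1(2)] by simp_all
      have "integral square (\<lambda>z. k z * Dx z) + integral square (\<lambda>z. ky z * bx z) = integral {-1..1} ?J"
        using integral_prod_continuous[OF c1(1)] integral_prod_continuous[OF c1(2)] i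
        by (simp add: integral_add)
      also have "\<bar>\<dots>\<bar> \<le> integral {-1..1} (\<lambda>x::real. 2 * C * w)"
      proof (rule integral_norm_bound_integral[where 'a=real, simplified real_norm_def])
        show "?J integrable_on {-1..1}" using i by (rule integrable_add)
        fix x assume x: "x \<in> {-1..1::real}"
        have "\<bar>integral {-1..1} (\<lambda>y. k (x,y) * ((bx (x, y + t) - bx (x, y)) / t)) + integral {-1..1} (\<lambda>y. ky (x,y) * bx (x,y))\<bar> \<le> 2 * C * w"
        proof (rule difference_quotient_by_parts)
          show "((\<lambda>y. k (x, y)) has_real_derivative ky (x, y)) (at y)" for y by (rule C1_grad_slices(2)[OF k1])
          show "continuous_on UNIV (\<lambda>y. ky (x, y))"
            by (rule continuous_on_compose2[OF ck(3)]) (auto intro!: continuous_intros)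
          show "continuous_on UNIV (\<lambda>y. bx (x, y))"
            by (rule continuous_on_compose2[OF cb(2)]) (auto intro!: continuous_intros)
          show "\<bar>bx (x,s) - bx (x,y)\<bar> \<le> w" if "y \<in> {-1..1}" "y \<le> s" "s \<le> y + t" for y s
            using osc(1)[OF x that] .
          show "\<bar>ky (x,y)\<bar> \<le> C" if "y \<in> {-1..1}" for y
            using x that by (intro C(2)) (auto simp: cbox_Pair_eq)
        qed (use e t in auto)
        then show "\<bar>?J x\<bar> \<le> 2 * C * w" by (simp add: Dx_def)
      qed auto
      finally show ?thesis by simp
    qed
    have "?I = integral square (\<lambda>z. kx z * by z) - integral square (\<lambda>z. ky z * bx z)"
      using cs by (subst integral_diff[symmetric]) (auto intro!: integrable_continuous continuous_intros)
    with 1 2 3 show ?thesis by linarith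
  qed
  have "0 \<le> \<bar>C\<bar>" by simp
  have "\<bar>?I\<bar> \<le> 0 + e" if "e > 0" for e
  proof -
    have "\<bar>?I\<bar> \<le> 8 * C * (e / (8 * \<bar>C\<bar> + 1))" using that by (intro main) (auto simp: add_nonneg_pos)
    also have "\<dots> \<le> e"
    proof -
      have "8 * C * e \<le> e * (8 * \<bar>C\<bar> + 1)" using that C0 by (simp add: algebra_simps)
      then show ?thesis by (simp add: divide_le_eq add_nonneg_pos)
    qed
    finally show ?thesis by simp
  qed
  then have "\<bar>?I\<bar> \<le> 0" by (rule field_le_epsilon)
  then show ?thesis by simp
qed

section \<open>Radial functions\<close>

lemma max_0_power_deriv:
  "((\<lambda>s::real. (max 0 s) ^ (n + 2)) has_real_derivative (of_nat (n + 2)) * (max 0 s) ^ (n + 1)) (at s)"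
proof -
  consider "s > 0" | "s < 0" | "s = 0" by linarith
  then show ?thesis
  proof cases
    case 1
    have "((\<lambda>s::real. s ^ (n + 2)) has_real_derivative (of_nat (n + 2)) * s ^ (n + 1)) (at s)"
      using DERIV_pow[where n="n + 2" and x=s and s=UNIV] by (simp del: power_Suc add: numeral_eq_Suc)
    then have "((\<lambda>s::real. (max 0 s) ^ (n + 2)) has_real_derivative (of_nat (n + 2)) * s ^ (n + 1)) (at s)"
      by (rule has_field_derivative_transform_within_open[where S="{0<..}"]) (use 1 in \<open>simp_all add: max_def\<close>)
    then show ?thesis using 1 by (simp add: max_def)
  next
    case 2
    have "((\<lambda>s::real. (max 0 s) ^ (n + 2)) has_real_derivative 0) (at s)"
      by (rule has_field_derivative_transform_within_open[OF DERIV_const[where k=0], where S="{..<0}"]) (use 2 in \<open>simp_all add: max_def\<close>)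
    then show ?thesis using 2 by (simp add: max_def)
  next
    case 3
    have "((\<lambda>h::real. max 0 h ^ (n + 2) / h) \<longlongrightarrow> 0) (at 0)"
    proof (rule tendsto_rabs_zero_cancel, rule tendsto_0_le[where K=1])
      show "((\<lambda>h::real. \<bar>h\<bar> ^ (n+1)) \<longlongrightarrow> 0) (at 0)"
        by (auto intro!: tendsto_eq_intros)
      show "\<forall>\<^sub>F h::real in at 0. norm \<bar>max 0 h ^ (n + 2) / h\<bar> \<le> norm (\<bar>h\<bar> ^ (n+1)) * 1"
        by (intro always_eventually allI) (simp add: max_def mult_nonpos_nonneg)
    qed
    then show ?thesis unfolding 3 DERIV_def by simp
  qed
qed

text \<open>
  With \<open>P s = (max 0 s)\<^sup>3\<close>, which has two continuous derivatives, and \<open>S\<close> the affine function that is \<open>0\<close>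
  at \<open>\<alpha>\<close> and \<open>1\<close> at \<open>\<beta>\<close>, the function \<open>P (1 - P S)\<close> has the required properties.
\<close>

lemma C2_step_function:
  fixes \<alpha> \<beta> :: real
  assumes "\<alpha> < \<beta>"
  obtains Z Z1 Z2 where "\<And>t. (Z has_real_derivative Z1 t) (at t)" "\<And>t. (Z1 has_real_derivative Z2 t) (at t)"
    "continuous_on UNIV Z2" "\<And>t. t \<le> \<alpha> \<Longrightarrow> Z t = 1 \<and> Z1 t = 0 \<and> Z2 t = 0" "\<And>t. t \<ge> \<beta> \<Longrightarrow> Z t = 0 \<and> Z1 t = 0 \<and> Z2 t = 0"
    "\<And>t. 0 \<le> Z t" "\<And>t. Z t \<le> 1" 
proof -
  define c where "c = 1 / (\<beta> - \<alpha>)"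
  have c: "c > 0" using assms by (simp add: c_def)
  define P where "P s = (max 0 s) ^ 3" for s :: real
  define P1 where "P1 s = 3 * (max 0 s) ^ 2" for s :: real
  define P2 where "P2 s = 6 * (max 0 s) ^ 1" for s :: real
  have P: "(P has_real_derivative P1 s) (at s)" for s
    using max_0_power_deriv[of 1 s] by (simp add: P_def[abs_def] P1_def numeral_eq_Suc)
  have P1: "(P1 has_real_derivative P2 s) (at s)" for s
    using DERIV_cmult[OF max_0_power_deriv[of 0 s], of 3] by (simp add: P1_def[abs_def] P2_def numeral_eq_Suc)
  define S where "S t = 1 - c * (\<beta> - t)" for t
  have S: "(S has_real_derivative c) (at t)" for t unfolding S_def by (auto intro!: derivative_eq_intros)
  define Z where "Z t = P (1 - P (S t))" for t
  define Z1 where "Z1 t = P1 (1 - P (S t)) * (- (P1 (S t) * c))" for t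
  define Z2 where "Z2 t = P2 (1 - P (S t)) * (- (P1 (S t) * c)) * (- (P1 (S t) * c)) + P1 (1 - P (S t)) * (- (P2 (S t) * c * c))" for t
  have Pc: "continuous_on A P" "continuous_on A P1" "continuous_on A P2" "continuous_on A S" for A
    unfolding P_def P1_def P2_def S_def by (auto intro!: continuous_intros)
  have PS: "((\<lambda>t. P (S t)) has_real_derivative P1 (S t) * c) (at t)" for t
    using DERIV_chain2[OF P S] .
  have P1S: "((\<lambda>t. P1 (S t)) has_real_derivative P2 (S t) * c) (at t)" for t
    using DERIV_chain2[OF P1 S] .
  have in1: "((\<lambda>t. 1 - P (S t)) has_real_derivative - (P1 (S t) * c)) (at t)" for t
    using DERIV_diff[OF DERIV_const[of 1] PS] by simp
  have neg: "P s = 0 \<and> P1 s = 0 \<and> P2 s = 0" if "s \<le> 0" for s using that by (simp add: P_def P1_def P2_def max_def)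
  have P_ge: "P s \<ge> 0" for s by (simp add: P_def)
  have one: "P s \<ge> 1" if "s \<ge> 1" for s using that by (simp add: P_def max_def one_le_power)
  show thesis
  proof (rule that[of Z Z1 Z2])
    fix t
    show "(Z has_real_derivative Z1 t) (at t)"
      unfolding Z_def Z1_def using DERIV_chain2[OF P in1] .
    show "(Z1 has_real_derivative Z2 t) (at t)"
      unfolding Z1_def Z2_def
      using DERIV_mult'[OF DERIV_chain2[OF P1 in1] DERIV_minus[OF DERIV_cmult_right[OF P1S, where c=c]]]
      by (simp add: algebra_simps)
    show "Z t = 1 \<and> Z1 t = 0 \<and> Z2 t = 0" if "t \<le> \<alpha>"
    proof -
      have "c * (\<beta> - t) \<ge> c * (\<beta> - \<alpha>)" using that c by (intro mult_left_mono) auto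
      then have "S t \<le> 0" using assms by (simp add: S_def c_def)
      then show ?thesis using neg by (simp add: Z_def Z1_def Z2_def) (simp add: P_def)
    qed
    show "Z t = 0 \<and> Z1 t = 0 \<and> Z2 t = 0" if "t \<ge> \<beta>"
    proof -
      have "c * (\<beta> - t) \<le> 0" using that c by (simp add: mult_nonneg_nonpos)
      then have "1 - P (S t) \<le> 0" using one[of "S t"] by (simp add: S_def)
      then show ?thesis using neg by (simp add: Z_def Z1_def Z2_def)
    qed
    show "0 \<le> Z t" using P_ge by (simp add: Z_def)
    show "Z t \<le> 1" using P_ge[of "S t"] by (simp add: Z_def P_def[of "1 - _"] power_le_one max_def)
  next
    show "continuous_on UNIV Z2"
      unfolding Z2_def by (auto intro!: continuous_intros continuous_on_compose2[OF Pc(1) _ subset_UNIV]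
          continuous_on_compose2[OF Pc(2) _ subset_UNIV] continuous_on_compose2[OF Pc(3) _ subset_UNIV] Pc(4))
  qed
qed

definition sqn :: "real \<times> real \<Rightarrow> real" where "sqn z = (fst z)\<^sup>2 + (snd z)\<^sup>2"

lemma sqn_eq: "sqn z = (norm z)\<^sup>2"
  by (simp add: sqn_def norm_prod_def)

lemma sqn_ge_0 [simp]: "0 \<le> sqn z" by (simp add: sqn_def)

lemma C1_grad_sqn: "C1_grad U sqn (\<lambda>z. 2 * fst z) (\<lambda>z. 2 * snd z)"
  using C1_grad_add[OF C1_grad_mult[OF C1_grad_fst C1_grad_fst] C1_grad_mult[OF C1_grad_snd C1_grad_snd], of U]
  by (simp add: sqn_def[abs_def] power2_eq_square)

lemma continuous_on_sqn [continuous_intros]: "continuous_on A sqn"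
  unfolding sqn_def by (intro continuous_intros)

lemma C1_grad_radial:
  assumes "\<And>t. t \<ge> 0 \<Longrightarrow> (F has_real_derivative F' t) (at t)" "continuous_on {0..} F'"
  shows "C1_grad U (\<lambda>z. F (sqn z)) (\<lambda>z. F' (sqn z) * (2 * fst z)) (\<lambda>z. F' (sqn z) * (2 * snd z))"
  by (rule C1_grad_chain[OF C1_grad_sqn]) 
    (auto intro!: assms continuous_on_compose2[OF assms(2)] continuous_intros)

lemma cutoff_radial:
  assumes "\<And>t. t \<ge> 0 \<Longrightarrow> (F has_real_derivative F' t) (at t)" "continuous_on {0..} F'"
    and "\<And>t. t \<ge> r\<^sup>2 \<Longrightarrow> F t = 0 \<and> F' t = 0" "r \<ge> 0"
  shows "cutoff r (\<lambda>z. F (sqn z)) (\<lambda>z. F' (sqn z) * (2 * fst z)) (\<lambda>z. F' (sqn z) * (2 * snd z))"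
  using C1_grad_radial[OF assms(1,2)] assms(3,4)
  by (auto simp: cutoff_def sqn_eq power_mono)

lemma cutoff_exists:
  assumes "0 \<le> r" "r < r'"
  obtains q qx qy where "cutoff r' q qx qy" "\<And>z. norm z \<le> r \<Longrightarrow> q z = 1 \<and> qx z = 0 \<and> qy z = 0"
proof -
  have "r\<^sup>2 < r'\<^sup>2" using assms by (simp add: power_strict_mono)
  obtain Z Z1 Z2 where Z: "\<And>t. (Z has_real_derivative Z1 t) (at t)" "\<And>t. (Z1 has_real_derivative Z2 t) (at t)"
    "continuous_on UNIV Z2" "\<And>t. t \<le> r\<^sup>2 \<Longrightarrow> Z t = 1 \<and> Z1 t = 0 \<and> Z2 t = 0" "\<And>t. t \<ge> r'\<^sup>2 \<Longrightarrow> Z t = 0 \<and> Z1 t = 0 \<and> Z2 t = 0"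
    "\<And>t. 0 \<le> Z t" "\<And>t. Z t \<le> 1"
    by (rule C2_step_function[OF \<open>r\<^sup>2 < r'\<^sup>2\<close>]) (rule that)
  have "continuous_on A Z1" for A
    by (rule DERIV_continuous_on[where D=Z2]) (rule has_field_derivative_at_within[OF Z(2)])
  then have "cutoff r' (\<lambda>z. Z (sqn z)) (\<lambda>z. Z1 (sqn z) * (2 * fst z)) (\<lambda>z. Z1 (sqn z) * (2 * snd z))"
    using assms Z by (intro cutoff_radial) auto
  then show thesis
    by (rule that) (use Z(4) in \<open>auto simp: sqn_eq power_mono\<close>)
qed

text \<open>
  Only the values of \<open>b\<close> on the support of \<open>k\<close> matter, so \<open>b\<close> may be replaced by a global function.
\<close>

lemma integral_jacobian_eq_0:
  assumes k: "cutoff r k kx ky" and r: "0 \<le> r" "r < 1" and b: "C1_grad (ball 0 1) b bx by"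
  shows "integral square (\<lambda>z. kx z * by z - ky z * bx z) = 0"
proof -
  obtain r' where r': "r < r'" "r' < 1" using r dense by blast
  obtain q qx qy where q: "cutoff r' q qx qy" "\<And>z. norm z \<le> r \<Longrightarrow> q z = 1 \<and> qx z = 0 \<and> qy z = 0"
    using cutoff_exists[OF r(1) r'(1)] by metis
  have "C1_grad UNIV (\<lambda>z. q z * b z) (\<lambda>z. qx z * b z + q z * bx z) (\<lambda>z. qy z * b z + q z * by z)"
    using cutoff_mult[OF q(1) r'(2) b] by (simp add: cutoff_def)
  from integral_jacobian_eq_0_global[OF k r(2) this]
  have "integral square (\<lambda>z. kx z * (qy z * b z + q z * by z) - ky z * (qx z * b z + q z * bx z)) = 0" .
  also have "(\<lambda>z. kx z * (qy z * b z + q z * by z) - ky z * (qx z * b z + q z * bx z)) = 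
      (\<lambda>z. kx z * by z - ky z * bx z)"
  proof
    fix z show "kx z * (qy z * b z + q z * by z) - ky z * (qx z * b z + q z * bx z) = kx z * by z - ky z * bx z"
    proof (cases "norm z \<le> r")
      case False
      then have "kx z = 0 \<and> ky z = 0" using k unfolding cutoff_def by (metis not_le)
      then show ?thesis by simp
    qed (use q(2)[of z] in simp)
  qed
  finally show ?thesis .
qed

section \<open>The regularised argument and almost holomorphic maps\<close>

lemma integrable_cutoff:
  fixes q f :: "real \<times> real \<Rightarrow> real"
  assumes "continuous_on UNIV q" "\<And>z. r < norm z \<Longrightarrow> q z = 0" "r < 1" "continuous_on (ball 0 1) f"
  shows "(\<lambda>z. q z * f z) integrable_on square"
  using continuous_on_subset[OF continuous_on_cutoff_mult[OF assms]] by (intro integrable_continuous) auto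

text \<open>
  The pull-back under \<open>(a, b)\<close> of a rotationally symmetric density on the plane of total mass \<open>2 * pi\<close>, which
  concentrates at the origin as \<open>\<epsilon> \<rightarrow> 0\<close>. In the limit it counts the zeros of \<open>(a, b)\<close> with their multiplicities.
\<close>

definition mass_density :: "real \<Rightarrow> (real \<times> real \<Rightarrow> real) \<Rightarrow> (real \<times> real \<Rightarrow> real) \<Rightarrow> (real \<times> real \<Rightarrow> real) \<Rightarrow>
    (real \<times> real \<Rightarrow> real) \<Rightarrow> (real \<times> real \<Rightarrow> real) \<Rightarrow> (real \<times> real \<Rightarrow> real) \<Rightarrow> real \<times> real \<Rightarrow> real" where
  "mass_density \<epsilon> a ax ay b bx by z =
     2 * \<epsilon>\<^sup>2 * (ax z * by z - ay z * bx z) / ((a z)\<^sup>2 + (b z)\<^sup>2 + \<epsilon>\<^sup>2)\<^sup>2"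

text \<open>
  The curl of the regularised gradient of the argument is the mass density. The statement is in weak form because
  the field involves first derivatives of \<open>a\<close> and \<open>b\<close>, which need not be differentiable. It combines the
  Jacobian identity for the pairs \<open>(q a / N, b)\<close> and \<open>(q b / N, a)\<close>.
\<close>

lemma angular_form_curl:
  assumes a: "C1_grad (ball 0 1) a ax ay" and b: "C1_grad (ball 0 1) b bx by"
    and q: "cutoff r q qx qy" and r: "0 \<le> r" "r < 1" and \<epsilon>: "\<epsilon> > 0"
  defines "N \<equiv> \<lambda>z. (a z)\<^sup>2 + (b z)\<^sup>2 + \<epsilon>\<^sup>2"
  shows "integral square (\<lambda>z. qx z * ((a z * by z - b z * ay z) / N z)
            - qy z * ((a z * bx z - b z * ax z) / N z) + q z * mass_density \<epsilon> a ax ay b bx by z) = 0"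
    (is "integral square ?F = 0")
proof -
  have N0: "N z > 0" for z using \<epsilon> by (auto simp: N_def intro: add_nonneg_pos)
  have CN: "C1_grad (ball 0 1) N (\<lambda>z. 2 * a z * ax z + 2 * b z * bx z) (\<lambda>z. 2 * a z * ay z + 2 * b z * by z)"
    using C1_grad_add[OF C1_grad_add[OF C1_grad_mult[OF a a] C1_grad_mult[OF b b]] C1_grad_const[of _ "\<epsilon>\<^sup>2"]]
    by (simp add: N_def power2_eq_square algebra_simps)
  have CI: "C1_grad (ball 0 1) (\<lambda>z. inverse (N z)) (\<lambda>z. - (inverse (N z) ^ 2) * (2 * a z * ax z + 2 * b z * bx z))
    (\<lambda>z. - (inverse (N z) ^ 2) * (2 * a z * ay z + 2 * b z * by z))"
  proof (rule C1_grad_chain[OF CN])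
    show "(inverse has_real_derivative - ((inverse (N z))\<^sup>2)) (at (N z))" for z
      using DERIV_inverse[of "N z" UNIV] N0[of z] by (simp add: numeral_2_eq_2)
    show "continuous_on (ball 0 1) (\<lambda>z. - (inverse (N z))\<^sup>2)"
      using N0 C1_gradD(2)[OF CN] by (intro continuous_intros) (auto simp: less_imp_neq[symmetric])
  qed
  note k1 = cutoff_mult[OF q r(2) C1_grad_mult[OF a CI]]
  note k2 = cutoff_mult[OF q r(2) C1_grad_mult[OF b CI]]
  let ?k1x = "\<lambda>z. qx z * (a z * inverse (N z)) + q z * (ax z * inverse (N z) + a z * (- (inverse (N z) ^ 2) * (2 * a z * ax z + 2 * b z * bx z)))"
  let ?k1y = "\<lambda>z. qy z * (a z * inverse (N z)) + q z * (ay z * inverse (N z) + a z * (- (inverse (N z) ^ 2) * (2 * a z * ay z + 2 * b z * by z)))"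
  let ?k2x = "\<lambda>z. qx z * (b z * inverse (N z)) + q z * (bx z * inverse (N z) + b z * (- (inverse (N z) ^ 2) * (2 * a z * ax z + 2 * b z * bx z)))"
  let ?k2y = "\<lambda>z. qy z * (b z * inverse (N z)) + q z * (by z * inverse (N z) + b z * (- (inverse (N z) ^ 2) * (2 * a z * ay z + 2 * b z * by z)))"
  have i: "(\<lambda>z. ?k1x z * by z) integrable_on square" "(\<lambda>z. ?k1y z * bx z) integrable_on square"
    "(\<lambda>z. ?k2x z * ay z) integrable_on square" "(\<lambda>z. ?k2y z * ax z) integrable_on square"
    by (rule integrable_cutoff[OF cutoffD(2)[OF k1] cutoffD(5)[OF k1] r(2) C1_gradD(4)[OF b]]
        integrable_cutoff[OF cutoffD(3)[OF k1] cutoffD(6)[OF k1] r(2) C1_gradD(3)[OF b]]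
        integrable_cutoff[OF cutoffD(2)[OF k2] cutoffD(5)[OF k2] r(2) C1_gradD(4)[OF a]]
        integrable_cutoff[OF cutoffD(3)[OF k2] cutoffD(6)[OF k2] r(2) C1_gradD(3)[OF a]]; assumption)+
  have "integral square (\<lambda>z. (?k1x z * by z - ?k1y z * bx z) - (?k2x z * ay z - ?k2y z * ax z)) = 0"
    using integral_jacobian_eq_0[OF k1 r b] integral_jacobian_eq_0[OF k2 r a] i
    by (subst integral_diff) (simp_all add: integrable_diff)
  also have "(\<lambda>z. (?k1x z * by z - ?k1y z * bx z) - (?k2x z * ay z - ?k2y z * ax z)) = ?F"
  proof
    fix z
    define i where "i = inverse (N z)"
    have iN: "i * N z = 1" using N0[of z] by (simp add: i_def)
    have "?F z = qx z * (a z * by z - b z * ay z) * i - qy z * (a z * bx z - b z * ax z) * i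
        + q z * (2 * \<epsilon>\<^sup>2 * (ax z * by z - ay z * bx z) * i\<^sup>2)"
      by (simp add: mass_density_def N_def i_def divide_inverse power_inverse)
    also have "q z * (2 * \<epsilon>\<^sup>2 * (ax z * by z - ay z * bx z) * i\<^sup>2) =
        q z * (2 * (ax z * by z - ay z * bx z) * (i - ((a z)\<^sup>2 + (b z)\<^sup>2) * i\<^sup>2))"
    proof -
      have "i - ((a z)\<^sup>2 + (b z)\<^sup>2) * i\<^sup>2 = \<epsilon>\<^sup>2 * i\<^sup>2"
        using arg_cong[OF iN, of "\<lambda>t. t * i"] unfolding N_def by (simp add: power2_eq_square algebra_simps)
      then show ?thesis by (simp only: mult_ac)
    qed
    also have "qx z * (a z * by z - b z * ay z) * i - qy z * (a z * bx z - b z * ax z) * i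
        + q z * (2 * (ax z * by z - ay z * bx z) * (i - ((a z)\<^sup>2 + (b z)\<^sup>2) * i\<^sup>2)) =
        (?k1x z * by z - ?k1y z * bx z) - (?k2x z * ay z - ?k2y z * ax z)"
      unfolding i_def[symmetric] power2_eq_square by (simp only: ring_distribs mult_ac minus_mult_left[symmetric] minus_mult_right[symmetric])
    finally show "(?k1x z * by z - ?k1y z * bx z) - (?k2x z * ay z - ?k2y z * ax z) = ?F z" by simp
  qed
  finally show ?thesis .
qed

text \<open>
  The matrix with entries \<open>k\<close>, \<open>e\<close>, \<open>e\<close>, \<open>g\<close> has determinant one, so its smaller eigenvalue is at least the
  reciprocal of its trace.
\<close>

lemma quadratic_form_ge:
  fixes e g k p q :: real
  assumes "g * k - e\<^sup>2 = 1" "k > 0"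
  shows "g > 0" and "k * p\<^sup>2 + 2 * e * p * q + g * q\<^sup>2 \<ge> (p\<^sup>2 + q\<^sup>2) / (k + g)"
    and "k + g \<ge> 2"
proof -
  have "g * k > 0" using assms(1) zero_le_power2[of e] by linarith
  then show g: "g > 0" using assms(2) by (simp add: zero_less_mult_iff)
  have "(k + g) * (k * p\<^sup>2 + 2 * e * p * q + g * q\<^sup>2) - (p\<^sup>2 + q\<^sup>2) = (k * p + e * q)\<^sup>2 + (e * p + g * q)\<^sup>2"
    (is "?l = ?r")
  proof -
    have "?l = (k + g) * (k * p\<^sup>2 + 2 * e * p * q + g * q\<^sup>2) - (g * k - e\<^sup>2) * (p\<^sup>2 + q\<^sup>2)"
      using assms(1) by simp
    also have "\<dots> = ?r" by (simp add: power2_eq_square algebra_simps)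
    finally show ?thesis .
  qed
  then have "(k + g) * (k * p\<^sup>2 + 2 * e * p * q + g * q\<^sup>2) \<ge> (p\<^sup>2 + q\<^sup>2)"
    using zero_le_power2[of "k * p + e * q"] zero_le_power2[of "e * p + g * q"] by linarith
  then show "k * p\<^sup>2 + 2 * e * p * q + g * q\<^sup>2 \<ge> (p\<^sup>2 + q\<^sup>2) / (k + g)"
    using g assms(2) by (subst pos_divide_le_eq) (auto simp only: mult.commute)
  have "(k + g)\<^sup>2 = (k - g)\<^sup>2 + 4 * e\<^sup>2 + 4 * (g * k - e\<^sup>2)" by (simp add: power2_eq_square algebra_simps)
  then have "(k + g)\<^sup>2 \<ge> 2\<^sup>2" using assms(1) by simp
  then show "k + g \<ge> 2" by (rule power2_le_imp_le) (use g assms(2) in linarith)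
qed

text \<open>
  \<open>\<Phi> (|w|\<^sup>2)\<close> is the test function; it has the gradient \<open>- 2 f (|w|\<^sup>2) w\<close>.
\<close>

definition radial_profile :: "real \<Rightarrow> (real \<Rightarrow> real) \<Rightarrow> (real \<Rightarrow> real) \<Rightarrow> (real \<Rightarrow> real) \<Rightarrow> bool" where
  "radial_profile r f f' \<Phi> \<longleftrightarrow>
     (\<forall>t\<ge>0. (f has_real_derivative f' t) (at t)) \<and> continuous_on {0..} f' \<and>
     (\<forall>t\<ge>r\<^sup>2. f t = 0 \<and> f' t = 0 \<and> \<Phi> t = 0) \<and>
     (\<forall>t\<ge>0. (\<Phi> has_real_derivative - f t) (at t)) \<and> (\<forall>t\<ge>0. f t \<ge> 0)"

text \<open>
  The matrix \<open>Q = [[e, g], [- k, - e]]\<close> satisfies \<open>Q\<^sup>2 = -1\<close>: it is an almost complex structure on the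
  disc, standard at the origin. The symmetric matrix \<open>P = [[k, e], [e, g]]\<close> describes the conformal structure, in the
  sense that solutions of \<open>\<nabla>a = Q \<nabla>b\<close> have components annihilated by the divergence of \<open>P \<nabla>\<close>.
\<close>

locale conformal_disc =
  fixes e ex ey g gx gy k kx ky :: "real \<times> real \<Rightarrow> real"
  assumes e: "C1_grad (ball 0 1) e ex ey" and g: "C1_grad (ball 0 1) g gx gy"
    and k: "C1_grad (ball 0 1) k kx ky"
    and det1: "z \<in> ball 0 1 \<Longrightarrow> g z * k z - (e z)\<^sup>2 = 1" and k_pos: "z \<in> ball 0 1 \<Longrightarrow> k z > 0"
    and at_0: "e 0 = 0" "g 0 = 1" "k 0 = 1"
begin

text \<open>
  The components of \<open>\<nabla>a - Q \<nabla>b\<close>.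
\<close>

definition res1 where "res1 ax bx by z = ax z - (e z * bx z + g z * by z)"
definition res2 where "res2 ay bx by z = ay z + (k z * bx z + e z * by z)"

definition almost_solution where
  "almost_solution a ax ay b bx by \<longleftrightarrow> C1_grad (ball 0 1) a ax ay \<and> C1_grad (ball 0 1) b bx by \<and>
     (\<forall>r<1. \<exists>K. \<forall>z\<in>cball 0 r. \<bar>res1 ax bx by z\<bar> \<le> K * sqrt ((a z)\<^sup>2 + (b z)\<^sup>2) \<and>
                        \<bar>res2 ay bx by z\<bar> \<le> K * sqrt ((a z)\<^sup>2 + (b z)\<^sup>2))"

lemma coefficient_bound:
  assumes "r < 1"
  obtains M where "M \<ge> 1" "\<And>z. z \<in> cball 0 r \<Longrightarrow> \<bar>e z\<bar> \<le> M \<and> \<bar>g z\<bar> \<le> M \<and> \<bar>k z\<bar> \<le> M"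
proof -
  obtain M1 where M1: "M1 > 0" "\<And>z. z \<in> cball 0 r \<Longrightarrow> \<bar>e z\<bar> \<le> M1"
    by (rule bounded_on_cball[OF C1_gradD(2)[OF e] assms]) (rule that)
  obtain M2 where M2: "M2 > 0" "\<And>z. z \<in> cball 0 r \<Longrightarrow> \<bar>g z\<bar> \<le> M2"
    by (rule bounded_on_cball[OF C1_gradD(2)[OF g] assms]) (rule that)
  obtain M3 where M3: "M3 > 0" "\<And>z. z \<in> cball 0 r \<Longrightarrow> \<bar>k z\<bar> \<le> M3"
    by (rule bounded_on_cball[OF C1_gradD(2)[OF k] assms]) (rule that)
  show thesis
  proof (rule that[of "M1 + M2 + M3 + 1"])
    show "1 \<le> M1 + M2 + M3 + 1" using M1 M2 M3 by simp
    fix z :: "real \<times> real" assume "z \<in> cball 0 r"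
    from M1(2)[OF this] M2(2)[OF this] M3(2)[OF this] M1(1) M2(1) M3(1)
    show "\<bar>e z\<bar> \<le> M1 + M2 + M3 + 1 \<and> \<bar>g z\<bar> \<le> M1 + M2 + M3 + 1 \<and> \<bar>k z\<bar> \<le> M1 + M2 + M3 + 1" by linarith
  qed
qed

text \<open>
  The Jacobian is a positive definite quadratic form in \<open>\<nabla>b\<close> up to an error \<open>O(|h| |\<nabla>b|)\<close>; completing the
  square leaves \<open>- O(|h|\<^sup>2)\<close>. The remaining factor \<open>|h|\<^sup>2 \<epsilon>\<^sup>2 / (|h|\<^sup>2 + \<epsilon>\<^sup>2)\<^sup>2\<close> is bounded and tends to zero pointwise.
\<close>

lemma mass_density_ge:
  assumes sol: "almost_solution a ax ay b bx by" and r: "r < 1"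
  obtains C where "C \<ge> 0" "\<And>\<epsilon> z. z \<in> cball 0 r \<Longrightarrow> 
     mass_density \<epsilon> a ax ay b bx by z \<ge> - C * (((a z)\<^sup>2 + (b z)\<^sup>2) * \<epsilon>\<^sup>2 / ((a z)\<^sup>2 + (b z)\<^sup>2 + \<epsilon>\<^sup>2)\<^sup>2)"
proof -
  obtain K where K: "\<forall>z\<in>cball 0 r. \<bar>res1 ax bx by z\<bar> \<le> K * sqrt ((a z)\<^sup>2 + (b z)\<^sup>2) \<and>
      \<bar>res2 ay bx by z\<bar> \<le> K * sqrt ((a z)\<^sup>2 + (b z)\<^sup>2)"
    using sol r unfolding almost_solution_def by blast
  obtain M where M: "M \<ge> 1" "\<And>z. z \<in> cball 0 r \<Longrightarrow> \<bar>e z\<bar> \<le> M \<and> \<bar>g z\<bar> \<le> M \<and> \<bar>k z\<bar> \<le> M"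
    by (rule coefficient_bound[OF r]) (rule that)
  show thesis
  proof (rule that[of "2 * (M * K\<^sup>2)"])
    show "0 \<le> 2 * (M * K\<^sup>2)" using M(1) by simp
    fix \<epsilon> :: real and z :: "real \<times> real" assume z: "z \<in> cball 0 r"
    then have zb: "z \<in> ball 0 1" using r by auto
    define n where "n = (a z)\<^sup>2 + (b z)\<^sup>2"
    define u where "u = res1 ax bx by z" define v where "v = res2 ay bx by z"
    define p where "p = bx z" define q where "q = by z"
    define S where "S = k z + g z"
    have n0: "n \<ge> 0" by (simp add: n_def)
    have sq: "x\<^sup>2 \<le> K\<^sup>2 * n" if "\<bar>x\<bar> \<le> K * sqrt n" for x
    proof -
      have "\<bar>x\<bar>\<^sup>2 \<le> (K * sqrt n)\<^sup>2" using that by (intro power_mono) auto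
      then show ?thesis using n0 by (simp add: power_mult_distrib)
    qed
    have uv: "u\<^sup>2 \<le> K\<^sup>2 * n" "v\<^sup>2 \<le> K\<^sup>2 * n"
      using sq[of u] sq[of v] bspec[OF K z] unfolding u_def v_def n_def by blast+
    have S: "2 \<le> S" "S \<le> 2 * M" using quadratic_form_ge(3)[OF det1[OF zb] k_pos[OF zb]] M(2)[OF z] unfolding S_def by linarith+
    have J: "ax z * by z - ay z * bx z = k z * p\<^sup>2 + 2 * e z * p * q + g z * q\<^sup>2 + u * q - v * p"
      by (simp add: u_def v_def p_def q_def res1_def res2_def algebra_simps power2_eq_square)
    have "S * (ax z * by z - ay z * bx z) \<ge> p\<^sup>2 + q\<^sup>2 + S * u * q - S * v * p"
      using quadratic_form_ge(2)[OF det1[OF zb] k_pos[OF zb], of p q] S(1)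
      unfolding J S_def[symmetric] by (simp add: divide_le_eq algebra_simps)
    also have "p\<^sup>2 + q\<^sup>2 + S * u * q - S * v * p = (q + S * u / 2)\<^sup>2 + (p - S * v / 2)\<^sup>2 - S\<^sup>2 * (u\<^sup>2 + v\<^sup>2) / 4"
      by (simp add: power2_eq_square field_simps)
    finally have "S * (ax z * by z - ay z * bx z) \<ge> - S\<^sup>2 * (u\<^sup>2 + v\<^sup>2) / 4"
      using zero_le_power2[of "q + S * u / 2"] zero_le_power2[of "p - S * v / 2"] by linarith
    then have "S * (- (S * (u\<^sup>2 + v\<^sup>2) / 4)) \<le> S * (ax z * by z - ay z * bx z)"
      by (simp add: power2_eq_square)
    then have "- (S * (u\<^sup>2 + v\<^sup>2) / 4) \<le> ax z * by z - ay z * bx z"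
      by (rule mult_left_le_imp_le) (use S in linarith)
    moreover have "S * (u\<^sup>2 + v\<^sup>2) \<le> (2 * M) * (2 * (K\<^sup>2 * n))"
    proof (rule mult_mono)
      show "u\<^sup>2 + v\<^sup>2 \<le> 2 * (K\<^sup>2 * n)" using uv by linarith
      show "0 \<le> u\<^sup>2 + v\<^sup>2" by simp
    qed (use S M(1) in linarith)+
    ultimately have "ax z * by z - ay z * bx z \<ge> - (M * K\<^sup>2 * n)" by simp
    then have "2 * \<epsilon>\<^sup>2 * (- (M * K\<^sup>2 * n)) \<le> 2 * \<epsilon>\<^sup>2 * (ax z * by z - ay z * bx z)"
      by (rule mult_left_mono) simp
    moreover have "2 * \<epsilon>\<^sup>2 * (- (M * K\<^sup>2 * n)) = - (2 * (M * K\<^sup>2)) * (n * \<epsilon>\<^sup>2)"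
      by (simp only: mult_ac mult_minus_left mult_minus_right)
    ultimately have "- (2 * (M * K\<^sup>2)) * (n * \<epsilon>\<^sup>2) \<le> 2 * \<epsilon>\<^sup>2 * (ax z * by z - ay z * bx z)"
      by (simp only:)
    then have "- (2 * (M * K\<^sup>2)) * (n * \<epsilon>\<^sup>2) / (n + \<epsilon>\<^sup>2)\<^sup>2 \<le> 2 * \<epsilon>\<^sup>2 * (ax z * by z - ay z * bx z) / (n + \<epsilon>\<^sup>2)\<^sup>2"
      by (rule divide_right_mono) simp
    then show "mass_density \<epsilon> a ax ay b bx by z \<ge> - (2 * (M * K\<^sup>2)) * (((a z)\<^sup>2 + (b z)\<^sup>2) * \<epsilon>\<^sup>2 / ((a z)\<^sup>2 + (b z)\<^sup>2 + \<epsilon>\<^sup>2)\<^sup>2)"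
      unfolding mass_density_def n_def by (simp only: times_divide_eq_right)
  qed
qed

text \<open>
  The components of \<open>P w\<close> for the position vector \<open>w\<close>, and their partial derivatives.
\<close>

definition Pw1 where "Pw1 z = k z * fst z + e z * snd z"
definition Pw2 where "Pw2 z = e z * fst z + g z * snd z"
definition Pw1_x where "Pw1_x z = kx z * fst z + k z + ex z * snd z"
definition Pw1_y where "Pw1_y z = ky z * fst z + ey z * snd z + e z"
definition Pw2_x where "Pw2_x z = ex z * fst z + e z + gx z * snd z"
definition Pw2_y where "Pw2_y z = ey z * fst z + gy z * snd z + g z"

lemma C1_Pw1: "C1_grad (ball 0 1) Pw1 Pw1_x Pw1_y"
  using C1_grad_add[OF C1_grad_mult[OF k C1_grad_fst] C1_grad_mult[OF e C1_grad_snd]]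
  by (simp add: Pw1_def[abs_def] Pw1_x_def[abs_def] Pw1_y_def[abs_def] add.assoc)

lemma C1_Pw2: "C1_grad (ball 0 1) Pw2 Pw2_x Pw2_y"
  using C1_grad_add[OF C1_grad_mult[OF e C1_grad_fst] C1_grad_mult[OF g C1_grad_snd]]
  by (simp add: Pw2_def[abs_def] Pw2_x_def[abs_def] Pw2_y_def[abs_def] add.assoc)

text \<open>
  Minus the divergence of \<open>P \<nabla>G\<close> for a radial function \<open>G\<close> with \<open>\<nabla>G = - 2 f (|w|\<^sup>2) w\<close>.
\<close>

definition flux_density where
  "flux_density f f' z = 2 * (2 * f' (sqn z) * (fst z * Pw1 z + snd z * Pw2 z) + f (sqn z) * (Pw1_x z + Pw2_y z))"

text \<open>
  The weak curl identity for \<open>T\<close>, tested with \<open>G\<close>, in which \<open>T\<close> is replaced by \<open>- Q \<nabla>A + E\<close>. The term with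
  \<open>Q \<nabla>A\<close> is integrated by parts, which is possible since \<open>P \<nabla>G\<close> is continuously differentiable. The error \<open>E\<close> is
  bounded independently of \<open>\<epsilon>\<close>, as it has the form \<open>O(|h|\<^sup>2) / (|h|\<^sup>2 + \<epsilon>\<^sup>2)\<close>; the essential point is that the constant
  depends neither on \<open>\<epsilon>\<close> nor on the test function.
\<close>

lemma flux_identity:
  assumes sol: "almost_solution a ax ay b bx by" and r: "0 \<le> r" "r < 1"
  obtains C where "C \<ge> 0" "\<And>\<epsilon> f f' \<Phi>. \<epsilon> > 0 \<Longrightarrow> radial_profile r f f' \<Phi> \<Longrightarrow>
     \<bar>integral square (\<lambda>z. ln ((a z)\<^sup>2 + (b z)\<^sup>2 + \<epsilon>\<^sup>2) / 2 * flux_density f f' z +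
         \<Phi> (sqn z) * mass_density \<epsilon> a ax ay b bx by z)\<bar> \<le> C * integral square (\<lambda>z. f (sqn z) * norm z)"
proof -
  have a: "C1_grad (ball 0 1) a ax ay" and b: "C1_grad (ball 0 1) b bx by"
    using sol by (auto simp: almost_solution_def)
  obtain K where K: "\<forall>z\<in>cball 0 r. \<bar>res1 ax bx by z\<bar> \<le> K * sqrt ((a z)\<^sup>2 + (b z)\<^sup>2) \<and>
      \<bar>res2 ay bx by z\<bar> \<le> K * sqrt ((a z)\<^sup>2 + (b z)\<^sup>2)"
    using sol r unfolding almost_solution_def by blast
  obtain M where M: "M \<ge> 1" "\<And>z. z \<in> cball 0 r \<Longrightarrow> \<bar>e z\<bar> \<le> M \<and> \<bar>g z\<bar> \<le> M \<and> \<bar>k z\<bar> \<le> M"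
    by (rule coefficient_bound[OF r(2)]) (rule that)
  \<comment> \<open>The components of \<open>E\<close> times \<open>|h|\<^sup>2 + \<epsilon>\<^sup>2\<close>, obtained by solving the system for \<open>\<nabla>b\<close>.\<close>
  define E1 where "E1 z = a z * (e z * res1 ax bx by z + g z * res2 ay bx by z) - b z * res1 ax bx by z" for z
  define E2 where "E2 z = - (a z * (k z * res1 ax bx by z + e z * res2 ay bx by z)) - b z * res2 ay bx by z" for z
  have E_bound: "\<bar>fst z * E2 z - snd z * E1 z\<bar> \<le> norm z * (6 * M * \<bar>K\<bar> * ((a z)\<^sup>2 + (b z)\<^sup>2))"
    if z: "z \<in> cball 0 r" for z
  proof -
    define n where "n = sqrt ((a z)\<^sup>2 + (b z)\<^sup>2)"
    define u where "u = res1 ax bx by z" define v where "v = res2 ay bx by z"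
    have ab: "\<bar>a z\<bar> \<le> n" "\<bar>b z\<bar> \<le> n" "n \<ge> 0" by (simp_all add: n_def real_le_rsqrt)
    have "K * n \<le> \<bar>K\<bar> * n" using ab(3) by (intro mult_right_mono) auto
    then have uv: "\<bar>u\<bar> \<le> \<bar>K\<bar> * n" "\<bar>v\<bar> \<le> \<bar>K\<bar> * n"
      using bspec[OF K z] unfolding u_def v_def n_def by linarith+
    have prod3: "\<bar>c * (d * w)\<bar> \<le> n * (M * (\<bar>K\<bar> * n))" if "\<bar>c\<bar> \<le> n" "\<bar>d\<bar> \<le> M" "\<bar>w\<bar> \<le> \<bar>K\<bar> * n" for c d w
    proof -
      have "\<bar>d\<bar> * \<bar>w\<bar> \<le> M * (\<bar>K\<bar> * n)" using that M(1) by (intro mult_mono) linarith+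
      then show ?thesis unfolding abs_mult using that ab(3) M(1) 
        by (intro mult_mono) (linarith | rule mult_nonneg_nonneg abs_ge_zero)+
    qed
    have "1 * (\<bar>K\<bar> * n) \<le> M * (\<bar>K\<bar> * n)" using M(1) ab(3) by (intro mult_right_mono) auto
    then have 1: "\<bar>1::real\<bar> \<le> M" using M(1) by simp
    let ?B = "n * (M * (\<bar>K\<bar> * n))"
    have "E1 z = a z * (e z * u) + a z * (g z * v) - b z * (1 * u)"
      by (simp add: E1_def u_def v_def algebra_simps)
    moreover have "\<bar>a z * (e z * u)\<bar> \<le> ?B" "\<bar>a z * (g z * v)\<bar> \<le> ?B" "\<bar>b z * (1 * u)\<bar> \<le> ?B"
      using M(2)[OF z] ab uv 1 by (intro prod3; blast)+
    ultimately have e1: "\<bar>E1 z\<bar> \<le> 3 * ?B" by linarith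
    have "E2 z = - (a z * (k z * u)) - a z * (e z * v) - b z * (1 * v)"
      by (simp add: E2_def u_def v_def algebra_simps)
    moreover have "\<bar>a z * (k z * u)\<bar> \<le> ?B" "\<bar>a z * (e z * v)\<bar> \<le> ?B" "\<bar>b z * (1 * v)\<bar> \<le> ?B"
      using M(2)[OF z] ab uv 1 by (intro prod3; blast)+
    ultimately have e2: "\<bar>E2 z\<bar> \<le> 3 * ?B" by linarith
    have "\<bar>fst z * E2 z\<bar> \<le> norm z * (3 * ?B)" "\<bar>snd z * E1 z\<bar> \<le> norm z * (3 * ?B)"
      unfolding abs_mult by (rule mult_mono[OF norm_ge_fst_snd(1) e2 norm_ge_zero abs_ge_zero]
          mult_mono[OF norm_ge_fst_snd(2) e1 norm_ge_zero abs_ge_zero])+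
    then have "\<bar>fst z * E2 z - snd z * E1 z\<bar> \<le> norm z * (6 * ?B)" by linarith
    also have "6 * ?B = 6 * M * \<bar>K\<bar> * (n * n)" by (simp only: mult_ac)
    also have "n * n = (a z)\<^sup>2 + (b z)\<^sup>2" by (simp add: n_def)
    finally show ?thesis .
  qed
  show thesis
  proof (rule that[of "12 * M * \<bar>K\<bar>"])
    show "0 \<le> 12 * M * \<bar>K\<bar>" using M(1) by simp
    fix \<epsilon> :: real and f f' \<Phi> :: "real \<Rightarrow> real"
    assume \<epsilon>: "\<epsilon> > 0" and "radial_profile r f f' \<Phi>"
    then have f: "\<And>t. t \<ge> 0 \<Longrightarrow> (f has_real_derivative f' t) (at t)" "continuous_on {0..} f'"
      and f0: "\<And>t. t \<ge> r\<^sup>2 \<Longrightarrow> f t = 0 \<and> f' t = 0 \<and> \<Phi> t = 0"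
      and \<Phi>: "\<And>t. t \<ge> 0 \<Longrightarrow> (\<Phi> has_real_derivative - f t) (at t)" and f_ge: "\<And>t. t \<ge> 0 \<Longrightarrow> f t \<ge> 0"
      unfolding radial_profile_def by blast+
    define N where "N z = (a z)\<^sup>2 + (b z)\<^sup>2 + \<epsilon>\<^sup>2" for z
    have N0: "N z > 0" for z using \<epsilon> by (auto simp: N_def intro: add_nonneg_pos)
    define Ax where "Ax z = (a z * ax z + b z * bx z) / N z" for z
    define Ay where "Ay z = (a z * ay z + b z * by z) / N z" for z
    have CN: "C1_grad (ball 0 1) N (\<lambda>z. 2 * a z * ax z + 2 * b z * bx z) (\<lambda>z. 2 * a z * ay z + 2 * b z * by z)"
      using C1_grad_add[OF C1_grad_add[OF C1_grad_mult[OF a a] C1_grad_mult[OF b b]] C1_grad_const[of _ "\<epsilon>\<^sup>2"]]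
      by (simp add: N_def[abs_def] power2_eq_square algebra_simps)
    have CA: "C1_grad (ball 0 1) (\<lambda>z. ln (N z) / 2) Ax Ay"
    proof -
      have "C1_grad (ball 0 1) (\<lambda>z. ln (N z) / 2) (\<lambda>z. 1 / (2 * N z) * (2 * a z * ax z + 2 * b z * bx z))
         (\<lambda>z. 1 / (2 * N z) * (2 * a z * ay z + 2 * b z * by z))"
      proof (rule C1_grad_chain[OF CN])
        show "((\<lambda>t. ln t / 2) has_real_derivative 1 / (2 * N z)) (at (N z))" for z
          using N0[of z] by (auto intro!: derivative_eq_intros)
        show "continuous_on (ball 0 1) (\<lambda>z. 1 / (2 * N z))"
          using N0 C1_gradD(2)[OF CN] by (intro continuous_intros) (auto simp: less_imp_neq[symmetric])
      qed
      moreover have "1 / (2 * N z) * (2 * p + 2 * q) = (p + q) / N z" for z p q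
        using N0[of z] by (simp add: field_simps)
      ultimately show ?thesis unfolding Ax_def Ay_def by (simp add: mult.assoc)
    qed
    have cf: "continuous_on {0..} (\<lambda>t. - f t)"
      by (rule continuous_on_minus, rule DERIV_continuous_on[where D=f'], rule has_field_derivative_at_within[OF f(1)]) simp
    have q: "cutoff r (\<lambda>z. f (sqn z)) (\<lambda>z. f' (sqn z) * (2 * fst z)) (\<lambda>z. f' (sqn z) * (2 * snd z))"
      by (rule cutoff_radial[OF f]) (use f0 r in auto)
    have G: "cutoff r (\<lambda>z. \<Phi> (sqn z)) (\<lambda>z. - f (sqn z) * (2 * fst z)) (\<lambda>z. - f (sqn z) * (2 * snd z))"
      by (rule cutoff_radial[OF \<Phi> cf]) (use f0 r in auto)
    note c1 = cutoff_mult[OF q r(2) C1_grad_mult[OF C1_Pw1 CA]] and c2 = cutoff_mult[OF q r(2) C1_grad_mult[OF C1_Pw2 CA]]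
    let ?X = "\<lambda>z. f' (sqn z) * (2 * fst z) * (Pw1 z * (ln (N z) / 2)) + f (sqn z) * (Pw1_x z * (ln (N z) / 2) + Pw1 z * Ax z)"
    let ?Y = "\<lambda>z. f' (sqn z) * (2 * snd z) * (Pw2 z * (ln (N z) / 2)) + f (sqn z) * (Pw2_y z * (ln (N z) / 2) + Pw2 z * Ay z)"
    have div: "integral square ?X = 0" "integral square ?Y = 0"
      using integral_partial_eq_0[OF c1 r(2)] integral_partial_eq_0[OF c2 r(2)] by auto
    have divi: "?X integrable_on square" "?Y integrable_on square"
      using cutoffD(2)[OF c1] cutoffD(3)[OF c2] by (auto intro!: integrable_continuous intro: continuous_on_subset)
    let ?C = "\<lambda>z. - f (sqn z) * (2 * fst z) * ((a z * by z - b z * ay z) / N z)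
            - - f (sqn z) * (2 * snd z) * ((a z * bx z - b z * ax z) / N z) + \<Phi> (sqn z) * mass_density \<epsilon> a ax ay b bx by z"
    have curl: "integral square ?C = 0"
      using angular_form_curl[OF a b G r \<epsilon>] unfolding N_def .
    have cN: "continuous_on (ball 0 1) N" using C1_gradD(2)[OF CN] .
    have mdc: "continuous_on (ball 0 1) (mass_density \<epsilon> a ax ay b bx by)"
      unfolding mass_density_def N_def[symmetric] using N0 
      by (intro continuous_intros C1_gradD(3,4)[OF a] C1_gradD(3,4)[OF b] cN) (simp add: less_imp_neq[symmetric])
    have curli: "?C integrable_on square"
      using N0
      by (intro integrable_add integrable_diff integrable_cutoff[OF cutoffD(2)[OF G] cutoffD(5)[OF G] r(2)]
          integrable_cutoff[OF cutoffD(3)[OF G] cutoffD(6)[OF G] r(2)]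
          integrable_cutoff[OF cutoffD(1)[OF G] cutoffD(4)[OF G] r(2)] mdc continuous_intros C1_gradD(2-4)[OF a] C1_gradD(2-4)[OF b] cN)
        (simp_all add: less_imp_neq[symmetric])
    let ?R = "\<lambda>z. 2 * (f (sqn z) * ((fst z * E2 z - snd z * E1 z) / N z))"
    have pt: "ln (N z) / 2 * flux_density f f' z + \<Phi> (sqn z) * mass_density \<epsilon> a ax ay b bx by z =
       ?C z + 2 * (?X z + ?Y z) + ?R z" for z
    proof (cases "norm z \<le> r")
      case False
      then have "f (sqn z) = 0 \<and> f' (sqn z) = 0 \<and> \<Phi> (sqn z) = 0"
        using r by (intro f0) (simp add: sqn_eq power_mono)
      then show ?thesis by (simp add: flux_density_def)
    next
      case True
      define L where "L = ln (N z) / 2"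
      define u where "u = res1 ax bx by z" define v where "v = res2 ay bx by z"
      have det: "g z * k z - e z * e z = 1" using det1[of z] True r by (simp add: power2_eq_square)
      have X4: "e z * bx z + g z * by z + u = ax z" and X2: "k z * bx z + e z * by z - v = - ay z"
        by (simp_all add: u_def v_def res1_def res2_def)
      have "k z * ax z + e z * ay z - k z * u - e z * v = (g z * k z - e z * e z) * by z"
        unfolding X4[symmetric] using X2 by (simp add: u_def v_def res1_def res2_def algebra_simps)
      then have X1: "k z * ax z + e z * ay z - k z * u - e z * v = by z" using det by simp
      have "e z * ax z + g z * ay z - e z * u - g z * v = - (g z * k z - e z * e z) * bx z"
        by (simp add: u_def v_def res1_def res2_def algebra_simps)
      then have X3: "e z * ax z + g z * ay z - e z * u - g z * v = - bx z" using det by simp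
      have "Pw1 z * (a z * ax z + b z * bx z) + Pw2 z * (a z * ay z + b z * by z) + (fst z * E2 z - snd z * E1 z)
         = fst z * (a z * (k z * ax z + e z * ay z - k z * u - e z * v) + b z * (k z * bx z + e z * by z - v))
         + snd z * (a z * (e z * ax z + g z * ay z - e z * u - g z * v) + b z * (e z * bx z + g z * by z + u))"
        unfolding Pw1_def Pw2_def E1_def E2_def u_def[symmetric] v_def[symmetric] by (simp add: algebra_simps)
      also have "\<dots> = fst z * (a z * by z - b z * ay z) - snd z * (a z * bx z - b z * ax z)"
        unfolding X1 X2 X3 X4 by (simp add: algebra_simps)
      finally have P: "fst z * (a z * by z - b z * ay z) - snd z * (a z * bx z - b z * ax z) =
         Pw1 z * (a z * ax z + b z * bx z) + Pw2 z * (a z * ay z + b z * by z) + (fst z * E2 z - snd z * E1 z)" ..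
      have "?C z - \<Phi> (sqn z) * mass_density \<epsilon> a ax ay b bx by z =
          - 2 * f (sqn z) * ((fst z * (a z * by z - b z * ay z) - snd z * (a z * bx z - b z * ax z)) / N z)"
        by (simp add: divide_inverse algebra_simps)
      also have "\<dots> = - 2 * f (sqn z) * (Pw1 z * Ax z + Pw2 z * Ay z) - ?R z"
        unfolding P Ax_def Ay_def by (simp add: divide_inverse algebra_simps)
      finally have 1: "?C z = - 2 * f (sqn z) * (Pw1 z * Ax z + Pw2 z * Ay z) - ?R z + \<Phi> (sqn z) * mass_density \<epsilon> a ax ay b bx by z"
        by (simp only: diff_eq_eq)
      have "2 * (?X z + ?Y z) = L * flux_density f f' z + 2 * f (sqn z) * (Pw1 z * Ax z + Pw2 z * Ay z)"
        unfolding L_def[symmetric] flux_density_def by (simp add: algebra_simps)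
      then show ?thesis unfolding 1 L_def[symmetric] by linarith
    qed
    note coef = C1_gradD(2)[OF e] C1_gradD(2)[OF g] C1_gradD(2)[OF k]
    have cE: "continuous_on (ball 0 1) (\<lambda>z. (fst z * E2 z - snd z * E1 z) / N z)"
      unfolding E1_def E2_def res1_def res2_def using N0
      by (intro continuous_intros C1_gradD(2-4)[OF a] C1_gradD(2-4)[OF b] cN coef) (simp add: less_imp_neq[symmetric])
    have Ri: "?R integrable_on square"
      by (rule integrable_on_mult_right[OF integrable_cutoff[OF cutoffD(1)[OF q] cutoffD(4)[OF q] r(2) cE]])
    have nf: "(\<lambda>z. f (sqn z) * norm z) integrable_on square"
      by (rule integrable_cutoff[OF cutoffD(1)[OF q] cutoffD(4)[OF q] r(2)]) (auto intro!: continuous_intros)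
    have "integral square (\<lambda>z. ln (N z) / 2 * flux_density f f' z + \<Phi> (sqn z) * mass_density \<epsilon> a ax ay b bx by z)
       = integral square ?C + 2 * (integral square ?X + integral square ?Y) + integral square ?R"
      unfolding pt using divi curli Ri 
      by (simp only: integral_add integrable_add integral_mult_right integrable_on_mult_right)
    also have "\<dots> = integral square ?R" using div curl by simp
    also have "\<bar>\<dots>\<bar> \<le> integral square (\<lambda>z. (12 * M * \<bar>K\<bar>) * (f (sqn z) * norm z))"
    proof (rule integral_norm_bound_integral[where 'a=real, simplified real_norm_def, OF Ri])
      show "(\<lambda>z. (12 * M * \<bar>K\<bar>) * (f (sqn z) * norm z)) integrable_on square"
        using nf by (rule integrable_on_mult_right)
      fix z
      show "\<bar>?R z\<bar> \<le> (12 * M * \<bar>K\<bar>) * (f (sqn z) * norm z)"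
      proof (cases "norm z \<le> r")
        case False
        then have "f (sqn z) = 0" using r f0[of "sqn z"] by (simp add: sqn_eq power_mono)
        then show ?thesis by simp
      next
        case True
        have "\<bar>fst z * E2 z - snd z * E1 z\<bar> \<le> norm z * (6 * M * \<bar>K\<bar> * ((a z)\<^sup>2 + (b z)\<^sup>2))"
          using True by (intro E_bound) simp
        also have "\<dots> \<le> norm z * (6 * M * \<bar>K\<bar> * N z)"
          using M(1) by (intro mult_left_mono) (simp_all add: N_def)
        finally have "\<bar>fst z * E2 z - snd z * E1 z\<bar> / N z \<le> norm z * (6 * M * \<bar>K\<bar>)"
          using N0[of z] by (simp add: divide_le_eq mult_ac)
        then have "f (sqn z) * (\<bar>fst z * E2 z - snd z * E1 z\<bar> / N z) \<le> f (sqn z) * (norm z * (6 * M * \<bar>K\<bar>))"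
          using f_ge[of "sqn z"] by (intro mult_left_mono) auto
        moreover have "\<bar>?R z\<bar> = 2 * (f (sqn z) * (\<bar>fst z * E2 z - snd z * E1 z\<bar> / N z))"
          using f_ge[of "sqn z"] N0[of z] by (simp add: abs_mult)
        ultimately show ?thesis by (simp add: mult_ac)
      qed
    qed
    also have "\<dots> = (12 * M * \<bar>K\<bar>) * integral square (\<lambda>z. f (sqn z) * norm z)" by (rule integral_mult_right)
    finally show "\<bar>integral square (\<lambda>z. ln ((a z)\<^sup>2 + (b z)\<^sup>2 + \<epsilon>\<^sup>2) / 2 * flux_density f f' z +
         \<Phi> (sqn z) * mass_density \<epsilon> a ax ay b bx by z)\<bar> \<le> 12 * M * \<bar>K\<bar> * integral square (\<lambda>z. f (sqn z) * norm z)"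
      unfolding N_def .
  qed
qed

end

text \<open>
  \<open>Im l\<close> is the difference of the arguments of \<open>(a, b)\<close> and of \<open>w\<close>. Locally it is, up to a constant, the
  imaginary part of the principal logarithm of their quotient, by continuity of \<open>l\<close>.
\<close>

lemma C1_grad_argument:
  fixes l :: "real \<times> real \<Rightarrow> complex"
  assumes A: "open A" "0 \<notin> A" and a: "C1_grad A a ax ay" and b: "C1_grad A b bx by"
    and l: "continuous_on A l" and eq: "\<And>z. z \<in> A \<Longrightarrow> Complex (a z) (b z) = Complex (fst z) (snd z) * exp (l z)"
  shows "C1_grad A (\<lambda>z. Im (l z)) 
      (\<lambda>z. (a z * bx z - b z * ax z) / ((a z)\<^sup>2 + (b z)\<^sup>2) + snd z / sqn z)
      (\<lambda>z. (a z * by z - b z * ay z) / ((a z)\<^sup>2 + (b z)\<^sup>2) - fst z / sqn z)"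
proof -
  define H where "H z = Complex (a z) (b z)" for z
  define W where "W z = Complex (fst z) (snd z)" for z :: "real \<times> real"
  have W0: "W z \<noteq> 0" if "z \<in> A" for z
  proof -
    have "z \<noteq> 0" using that A by auto
    then show ?thesis by (cases z) (auto simp: W_def complex_eq_iff zero_prod_def)
  qed
  have H0: "H z \<noteq> 0" if "z \<in> A" for z using eq[OF that] W0[OF that] by (simp add: H_def W_def)
  have pos: "(a z)\<^sup>2 + (b z)\<^sup>2 \<noteq> 0" "sqn z \<noteq> 0" if "z \<in> A" for z
    using H0[OF that] W0[OF that] by (auto simp: H_def W_def sqn_def complex_eq_iff sum_power2_eq_zero_iff)
  have deriv: "((\<lambda>z. Im (l z)) has_derivative (\<lambda>h. ((a w * bx w - b w * ax w) / ((a w)\<^sup>2 + (b w)\<^sup>2) + snd w / sqn w) * fst h +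
       ((a w * by w - b w * ay w) / ((a w)\<^sup>2 + (b w)\<^sup>2) - fst w / sqn w) * snd h)) (at w)" if w: "w \<in> A" for w
  proof -
    define c where "c = H w / W w"
    have c0: "c \<noteq> 0" using H0[OF w] W0[OF w] by (simp add: c_def)
    define H' where "H' h = Complex (ax w * fst h + ay w * snd h) (bx w * fst h + by w * snd h)" for h
    have dH: "(H has_derivative H') (at w)"
    proof -
      have "((\<lambda>z. of_real (a z) + \<i> * of_real (b z)) has_derivative 
         (\<lambda>h. of_real (ax w * fst h + ay w * snd h) + \<i> * of_real (bx w * fst h + by w * snd h))) (at w)"
        by (intro has_derivative_add has_derivative_of_real has_derivative_mult_right C1_gradD(1)[OF a w] C1_gradD(1)[OF b w])
      then show ?thesis unfolding H_def[abs_def] H'_def[abs_def] Complex_eq .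
    qed
    have dW: "(W has_derivative W) (at w)"
    proof -
      have "((\<lambda>z. of_real (fst z) + \<i> * of_real (snd z)) has_derivative 
         (\<lambda>h. of_real (fst h) + \<i> * of_real (snd h))) (at w)"
        by (intro has_derivative_add has_derivative_of_real has_derivative_mult_right has_derivative_fst has_derivative_snd has_derivative_ident)
      then show ?thesis unfolding W_def[abs_def] Complex_eq .
    qed
    have dQ: "((\<lambda>z. (H z / W z) / c) has_derivative (\<lambda>h. ((H' h * W w - H w * W h) / (W w * W w)) / c)) (at w)"
      using has_derivative_divide'[OF dH dW W0[OF w]] by (rule bounded_linear.has_derivative[OF bounded_linear_divide])
    have "H w / W w / c = 1" using c0 by (simp add: c_def)
    then have "(Ln has_field_derivative 1) (at (H w / W w / c))" by (auto intro!: derivative_eq_intros)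
    from diff_chain_at[OF dQ this[unfolded has_field_derivative_def]]
    have "((\<lambda>z. Ln ((H z / W z) / c)) has_derivative (\<lambda>h. ((H' h * W w - H w * W h) / (W w * W w)) / c)) (at w)"
      by (simp add: o_def)
    then have dL: "((\<lambda>z. Im (l w + Ln ((H z / W z) / c))) has_derivative (\<lambda>h. Im (0 + ((H' h * W w - H w * W h) / (W w * W w)) / c))) (at w)"
      by (intro has_derivative_Im has_derivative_add has_derivative_const)
    have "isCont l w" using l A w by (simp add: continuous_on_eq_continuous_at)
    then have "\<forall>\<^sub>F z in nhds w. dist (l z) (l w) < 1"
      by (auto simp: isCont_def tendsto_iff eventually_at_filter elim!: eventually_mono dest!: spec[of _ 1])
        
    then have "\<forall>\<^sub>F z in nhds w. z \<in> A \<and> dist (l z) (l w) < 1"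
      using eventually_nhds_in_open[OF A(1) w] by eventually_elim auto
    then obtain S where S: "open S" "w \<in> S" "\<And>z. z \<in> S \<Longrightarrow> z \<in> A \<and> dist (l z) (l w) < 1"
      unfolding eventually_nhds by blast
    have eqL: "Im (l w + Ln ((H z / W z) / c)) = Im (l z)" if "z \<in> S" for z
    proof -
      have z: "z \<in> A" "dist (l z) (l w) < 1" using S(3)[OF that] by auto
      have "H z / W z = exp (l z)" "c = exp (l w)"
        using eq[OF z(1)] eq[OF w] W0[OF z(1)] W0[OF w] by (auto simp: H_def W_def c_def)
      then have "(H z / W z) / c = exp (l z - l w)" by (simp add: exp_diff)
      moreover have "\<bar>Im (l z - l w)\<bar> < 1" using z(2) abs_Im_le_cmod[of "l z - l w"] by (simp add: dist_norm)
      then have "Ln (exp (l z - l w)) = l z - l w" using pi_gt3 by (intro Ln_exp) linarith+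
      ultimately show ?thesis by simp
    qed
    have "((\<lambda>z. Im (l z)) has_derivative (\<lambda>h. Im (0 + ((H' h * W w - H w * W h) / (W w * W w)) / c))) (at w)"
      by (intro has_derivative_transform_within_open[OF dL S(1,2) eqL])
    moreover have "Im (0 + ((H' h * W w - H w * W h) / (W w * W w)) / c) = 
      ((a w * bx w - b w * ax w) / ((a w)\<^sup>2 + (b w)\<^sup>2) + snd w / sqn w) * fst h +
       ((a w * by w - b w * ay w) / ((a w)\<^sup>2 + (b w)\<^sup>2) - fst w / sqn w) * snd h" for h
    proof -
      have alg: "0 + ((x * w - y * v) / (w * w)) / (y / w) = x / y - v / w" if "w \<noteq> 0" "y \<noteq> 0" for x y v w :: complex
        using that by (simp add: field_simps)
      have "Im (0 + ((H' h * W w - H w * W h) / (W w * W w)) / c) = Im (H' h / H w) - Im (W h / W w)"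
        unfolding c_def alg[OF W0[OF w] H0[OF w]] by simp
      also have "Im (H' h / H w) = ((bx w * fst h + by w * snd h) * a w - (ax w * fst h + ay w * snd h) * b w) / ((a w)\<^sup>2 + (b w)\<^sup>2)"
        by (simp add: H'_def H_def Im_divide)
      also have "Im (W h / W w) = (snd h * fst w - fst h * snd w) / sqn w"
        by (simp add: W_def Im_divide sqn_def)
      finally show ?thesis by (simp add: divide_inverse algebra_simps)
    qed
    ultimately show ?thesis by simp
  qed
  show ?thesis
    unfolding C1_grad_def
    using deriv pos C1_gradD(2-4)[OF a] C1_gradD(2-4)[OF b] by (auto intro!: continuous_intros)
qed

lemma decreasing_primitive:
  fixes f :: "real \<Rightarrow> real"
  assumes c: "c > 0" and f: "continuous_on {-c..2} f" "\<And>t. t \<ge> \<rho> \<Longrightarrow> f t = 0" "0 \<le> \<rho>" "\<rho> < 1" "\<And>t. t \<ge> 0 \<Longrightarrow> f t \<ge> 0"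
  obtains \<Phi> where "\<And>t. t \<ge> 0 \<Longrightarrow> (\<Phi> has_real_derivative - f t) (at t)" "\<And>t. t \<ge> \<rho> \<Longrightarrow> \<Phi> t = 0"
    "\<And>t. t \<ge> 0 \<Longrightarrow> 0 \<le> \<Phi> t" "\<And>t. t \<ge> 0 \<Longrightarrow> \<Phi> t \<le> \<Phi> 0"
proof -
  obtain p where p: "\<And>x. x \<in> {-c..2} \<Longrightarrow> (p has_vector_derivative f x) (at x within {-c..2})"
    using antiderivative_continuous[OF f(1)] by blast
  have p': "(p has_real_derivative f x) (at x)" if "-c < x" "x < 2" for x
    using p[of x] that at_within_interior[of x "{-c..2}"]
    by (simp add: has_real_derivative_iff_has_vector_derivative)
  define \<Phi> where "\<Phi> t = (if t < 1 then p 1 - p t else 0)" for t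
  have p1: "p t = p 1" if "\<rho> \<le> t" "t < 1" for t
  proof -
    have "\<exists>z>t. z < 1 \<and> p 1 - p t = (1 - t) * f z"
      using that f c by (intro MVT2 p') auto
    then show ?thesis using f(2) that by auto
  qed
  have zero: "\<Phi> t = 0" if "t \<ge> \<rho>" for t using p1[of t] that by (auto simp: \<Phi>_def)
  have d: "(\<Phi> has_real_derivative - f t) (at t)" if t: "t \<ge> 0" for t
  proof (cases "t < 1")
    case True
    have "((\<lambda>t. p 1 - p t) has_real_derivative 0 - f t) (at t)"
      using t True c by (intro DERIV_diff DERIV_const p') auto
    then have "((\<lambda>t. p 1 - p t) has_real_derivative - f t) (at t)" by simp
    then show ?thesis
      by (rule has_field_derivative_transform_within_open[where S="{..<1}"]) (use True in \<open>simp_all add: \<Phi>_def\<close>)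
  next
    case False
    then have "f t = 0" using f by auto
    have "(\<Phi> has_real_derivative 0) (at t)"
      by (rule has_field_derivative_transform_within_open[OF DERIV_const[where k=0], where S="{\<rho><..}"]) (use False f zero in auto)
    then show ?thesis using \<open>f t = 0\<close> by simp
  qed
  have mono: "\<Phi> y \<le> \<Phi> x" if "0 \<le> x" "x \<le> y" for x y
  proof (rule DERIV_nonpos_imp_nonincreasing[OF that(2)])
    fix t assume "x \<le> t" "t \<le> y"
    then show "\<exists>y. (\<Phi> has_real_derivative y) (at t) \<and> y \<le> 0"
      using d[of t] f(5)[of t] that by (intro exI[of _ "- f t"]) auto
  qed
  show thesis
  proof (rule that[of \<Phi>, OF d zero])
    fix t :: real assume t: "t \<ge> 0"
    show "0 \<le> \<Phi> t" using mono[of t "max t 1"] zero[of "max t 1"] t f by auto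
    show "\<Phi> t \<le> \<Phi> 0" using mono[of 0 t] t by auto
  qed auto
qed

section \<open>The masses of two maps with homotopic boundary values\<close>

definition eps :: "nat \<Rightarrow> real" where "eps n = 1 / real (Suc n)"

lemma eps_pos: "eps n > 0" by (simp add: eps_def)

lemma eps_tendsto: "eps \<longlonglongrightarrow> 0"
  unfolding eps_def[abs_def] using LIMSEQ_inverse_real_of_nat by (simp add: inverse_eq_divide)

lemma kernel_bounds:
  fixes x d :: real
  assumes "x \<ge> 0" "d > 0"
  shows "0 \<le> x * d\<^sup>2 / (x + d\<^sup>2)\<^sup>2" "x * d\<^sup>2 / (x + d\<^sup>2)\<^sup>2 \<le> 1"
proof -
  have "x + d\<^sup>2 > 0" using assms by (simp add: add_nonneg_pos)
  then have p: "(x + d\<^sup>2)\<^sup>2 > 0" by simp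
  show "0 \<le> x * d\<^sup>2 / (x + d\<^sup>2)\<^sup>2" using assms by simp
  have "(x + d\<^sup>2)\<^sup>2 = x\<^sup>2 + 2 * (x * d\<^sup>2) + (d\<^sup>2)\<^sup>2" by (simp add: power2_sum)
  moreover have "0 \<le> x * d\<^sup>2" using assms by simp
  ultimately have "x * d\<^sup>2 \<le> (x + d\<^sup>2)\<^sup>2" using zero_le_power2[of x] zero_le_power2[of "d\<^sup>2"] by linarith
  then show "x * d\<^sup>2 / (x + d\<^sup>2)\<^sup>2 \<le> 1" using p by (simp add: divide_le_eq)
qed

lemma kernel_tendsto:
  fixes x :: real
  assumes "x \<ge> 0"
  shows "(\<lambda>n. x * (eps n)\<^sup>2 / (x + (eps n)\<^sup>2)\<^sup>2) \<longlonglongrightarrow> 0"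
proof (cases "x = 0")
  case False
  have "(\<lambda>n. x * (eps n)\<^sup>2 / (x + (eps n)\<^sup>2)\<^sup>2) \<longlonglongrightarrow> x * 0\<^sup>2 / (x + 0\<^sup>2)\<^sup>2"
    using False by (intro tendsto_intros eps_tendsto) auto
  then show ?thesis by simp
qed simp

lemma integral_kernel_tendsto:
  fixes q v :: "real \<times> real \<Rightarrow> real"
  assumes q: "continuous_on UNIV q" "\<And>z. r < norm z \<Longrightarrow> q z = 0" "r < 1"
    and v: "continuous_on (ball 0 1) v" "\<And>z. v z \<ge> 0"
  shows "(\<lambda>n. integral square (\<lambda>z. q z * (v z * (eps n)\<^sup>2 / (v z + (eps n)\<^sup>2)\<^sup>2))) \<longlonglongrightarrow> 0"
proof -
  have "(\<lambda>n. integral square (\<lambda>z. q z * (v z * (eps n)\<^sup>2 / (v z + (eps n)\<^sup>2)\<^sup>2))) \<longlonglongrightarrow> integral square (\<lambda>z. 0::real)"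
  proof (rule dominated_convergence(2)[where h="\<lambda>z. \<bar>q z\<bar>"])
    show "(\<lambda>z. q z * (v z * (eps n)\<^sup>2 / (v z + (eps n)\<^sup>2)\<^sup>2)) integrable_on square" for n
    proof (rule integrable_cutoff[OF q])
      have "v z + (eps n)\<^sup>2 > 0" for z using v(2)[of z] eps_pos[of n] by (simp add: add_nonneg_pos)
      then have "(v z + (eps n)\<^sup>2)\<^sup>2 \<noteq> 0" for z by (metis less_irrefl power_eq_0_iff)
      then show "continuous_on (ball 0 1) (\<lambda>z. v z * (eps n)\<^sup>2 / (v z + (eps n)\<^sup>2)\<^sup>2)"
        using v(1) by (intro continuous_intros) auto
    qed
    show "(\<lambda>z. \<bar>q z\<bar>) integrable_on square"
      using continuous_on_subset[OF q(1) subset_UNIV] by (intro integrable_continuous continuous_intros)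
    show "norm (q z * (v z * (eps n)\<^sup>2 / (v z + (eps n)\<^sup>2)\<^sup>2)) \<le> \<bar>q z\<bar>" for n z
    proof -
      have "\<bar>q z\<bar> * \<bar>v z * (eps n)\<^sup>2 / (v z + (eps n)\<^sup>2)\<^sup>2\<bar> \<le> \<bar>q z\<bar> * 1"
        using kernel_bounds[OF v(2) eps_pos[of n], of z] by (intro mult_left_mono) auto
      then show ?thesis by (simp only: real_norm_def abs_mult mult_1_right)
    qed
    show "(\<lambda>n. q z * (v z * (eps n)\<^sup>2 / (v z + (eps n)\<^sup>2)\<^sup>2)) \<longlonglongrightarrow> 0" for z
      using tendsto_mult_right_zero[OF kernel_tendsto[OF v(2)]] .
  qed
  then show ?thesis by simp
qed

lemma mass_density_identity:
  "mass_density \<epsilon> fst (\<lambda>_. 1) (\<lambda>_. 0) snd (\<lambda>_. 0) (\<lambda>_. 1) z = 2 * \<epsilon>\<^sup>2 / (sqn z + \<epsilon>\<^sup>2)\<^sup>2"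
  by (simp add: mass_density_def sqn_def)

lemma continuous_on_mass_density:
  assumes a: "C1_grad A a ax ay" and b: "C1_grad A b bx by" and "\<epsilon> > 0"
  shows "continuous_on A (mass_density \<epsilon> a ax ay b bx by)"
proof -
  have "(a z)\<^sup>2 + (b z)\<^sup>2 + \<epsilon>\<^sup>2 > 0" for z using assms(3) by (auto intro: add_nonneg_pos)
  then have "((a z)\<^sup>2 + (b z)\<^sup>2 + \<epsilon>\<^sup>2)\<^sup>2 \<noteq> 0" for z by (metis less_irrefl power_eq_0_iff)
  then show ?thesis unfolding mass_density_def 
    by (intro continuous_intros C1_gradD(2-4)[OF a] C1_gradD(2-4)[OF b]) auto
qed

text \<open>
  The angular derivative of \<open>L\<close> has mean zero on each circle. In cartesian terms, the integrand is a difference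
  of two partial derivatives of functions with compact support.
\<close>

lemma integral_rotation_eq_0:
  assumes r: "0 \<le> r0" "r0 < r1" "r1 < r2" "r2 < 1"
    and Z: "\<And>t. (Z1 has_real_derivative Z2 t) (at t)" "continuous_on UNIV Z2"
      "\<And>t. t \<le> r1\<^sup>2 \<or> t \<ge> r2\<^sup>2 \<Longrightarrow> Z1 t = 0 \<and> Z2 t = 0"
    and L: "C1_grad {z. r0 < norm z \<and> norm z < 1} L Lx Ly"
  shows "integral square (\<lambda>z. Z1 (sqn z) * (fst z * Ly z - snd z * Lx z)) = 0"
proof -
  let ?U = "{z::real\<times>real. r0 < norm z \<and> norm z < 1}" and ?K = "{z::real\<times>real. r1 \<le> norm z \<and> norm z \<le> r2}"
  have U: "open ?U" by (intro open_Collect_conj open_Collect_less continuous_intros)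
  have K: "closed ?K" by (intro closed_Collect_conj closed_Collect_le continuous_intros)
  have KU: "?K \<subseteq> ?U" using r by auto
  have off: "Z1 (sqn z) = 0 \<and> Z2 (sqn z) = 0" if "z \<notin> ?K" for z
    using that r by (intro Z(3)) (auto simp: sqn_eq not_le intro!: power_mono)
  have q: "C1_grad UNIV (\<lambda>z. Z1 (sqn z)) (\<lambda>z. Z2 (sqn z) * (2 * fst z)) (\<lambda>z. Z2 (sqn z) * (2 * snd z))"
    by (rule C1_grad_radial) (use Z(1) continuous_on_subset[OF Z(2) subset_UNIV] in auto)
  note q1 = C1_grad_extend[OF C1_grad_mult[OF q C1_grad_fst] K _ U KU L]
  note q2 = C1_grad_extend[OF C1_grad_mult[OF q C1_grad_snd] K _ U KU L]
  let ?q1y = "\<lambda>z. (Z2 (sqn z) * (2 * snd z) * fst z + Z1 (sqn z) * 0) * L z + Z1 (sqn z) * fst z * Ly z"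
  let ?q2x = "\<lambda>z. (Z2 (sqn z) * (2 * fst z) * snd z + Z1 (sqn z) * 0) * L z + Z1 (sqn z) * snd z * Lx z"
  have c1: "cutoff r2 (\<lambda>z. Z1 (sqn z) * fst z * L z) (\<lambda>z. (Z2 (sqn z) * (2 * fst z) * fst z + Z1 (sqn z) * 1) * L z + Z1 (sqn z) * fst z * Lx z) ?q1y"
    unfolding cutoff_def by (intro conjI q1 allI impI) (use off in auto)
  have c2: "cutoff r2 (\<lambda>z. Z1 (sqn z) * snd z * L z) ?q2x (\<lambda>z. (Z2 (sqn z) * (2 * snd z) * snd z + Z1 (sqn z) * 1) * L z + Z1 (sqn z) * snd z * Ly z)"
    unfolding cutoff_def by (intro conjI q2 allI impI) (use off in auto)
  have i: "?q1y integrable_on square" "?q2x integrable_on square"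
    using cutoffD(3)[OF c1] cutoffD(2)[OF c2] continuous_on_subset by (blast intro: integrable_continuous)+
  have "integral square (\<lambda>z. ?q1y z - ?q2x z) = 0"
    using integral_partial_eq_0(2)[OF c1 r(4)] integral_partial_eq_0(1)[OF c2 r(4)] integral_diff[OF i] by simp
  also have "(\<lambda>z. ?q1y z - ?q2x z) = (\<lambda>z. Z1 (sqn z) * (fst z * Ly z - snd z * Lx z))"
    by (rule ext) (simp add: algebra_simps)
  finally show ?thesis .
qed

text \<open>
  Both masses are integrals of the respective fields \<open>T\<close> over the annulus on which the cutoff function varies. There
  the maps have no zeros, the fields converge boundedly to the gradients of the arguments, and by assumption these differ
  by the gradient of a single-valued function.
\<close>

lemma total_mass_difference_tendsto:
  assumes a: "C1_grad (ball 0 1) a ax ay" and b: "C1_grad (ball 0 1) b bx by"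
    and r: "0 \<le> r0" "r0 < r1" "r1 < r2" "r2 < 1"
    and l: "continuous_on {z. r0 < norm z \<and> norm z < 1} l"
    and eq: "\<And>z. r0 < norm z \<Longrightarrow> norm z < 1 \<Longrightarrow> Complex (a z) (b z) = Complex (fst z) (snd z) * exp (l z)"
    and Z: "\<And>t. (Z has_real_derivative Z1 t) (at t)" "\<And>t. (Z1 has_real_derivative Z2 t) (at t)" "continuous_on UNIV Z2"
      "\<And>t. t \<le> r1\<^sup>2 \<Longrightarrow> Z t = 1 \<and> Z1 t = 0 \<and> Z2 t = 0" "\<And>t. t \<ge> r2\<^sup>2 \<Longrightarrow> Z t = 0 \<and> Z1 t = 0 \<and> Z2 t = 0"
  shows "(\<lambda>n. integral square (\<lambda>z. Z (sqn z) * mass_density (eps n) a ax ay b bx by z)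
     - integral square (\<lambda>z. Z (sqn z) * mass_density (eps n) fst (\<lambda>_. 1) (\<lambda>_. 0) snd (\<lambda>_. 0) (\<lambda>_. 1) z)) \<longlonglongrightarrow> 0"
proof -
  let ?U = "{z::real\<times>real. r0 < norm z \<and> norm z < 1}" and ?K = "{z::real\<times>real. r1 \<le> norm z \<and> norm z \<le> r2}"
  have U: "open ?U" by (intro open_Collect_conj open_Collect_less continuous_intros)
  have K: "closed ?K" by (intro closed_Collect_conj closed_Collect_le continuous_intros)
  have KU: "?K \<subseteq> ?U" and UB: "?U \<subseteq> ball 0 1" using r by auto
  have U0: "0 \<notin> ?U" using r by auto
  have off: "Z1 (sqn z) = 0 \<and> Z2 (sqn z) = 0" if "z \<notin> ?K" for z
  proof -
    have "sqn z \<le> r1\<^sup>2 \<or> sqn z \<ge> r2\<^sup>2" using that r by (auto simp: sqn_eq not_le intro!: power_mono)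
    then show ?thesis using Z(4,5) by blast
  qed
  define n where "n z = (a z)\<^sup>2 + (b z)\<^sup>2" for z
  define P where "P z = fst z * (a z * by z - b z * ay z) - snd z * (a z * bx z - b z * ax z)" for z
  have n0: "n z > 0" if "z \<in> ?U" for z
  proof -
    have "z \<noteq> 0" using that U0 by metis
    then have "Complex (fst z) (snd z) \<noteq> 0" by (cases z) (auto simp: complex_eq_iff zero_prod_def)
    then have "Complex (a z) (b z) \<noteq> 0" using eq[of z] that by simp
    then show ?thesis by (auto simp: n_def complex_eq_iff sum_power2_gt_zero_iff)
  qed
  have sq0: "sqn z > 0" if "z \<in> ?U" for z
  proof -
    have "0 < norm z" by (rule le_less_trans[of _ r0]) (use that r in auto)
    then show ?thesis by (simp add: sqn_eq)
  qed
  \<comment> \<open>The difference of the two integrands \<open>\<nabla>\<chi> \<times> T\<close> for the parameter \<open>\<epsilon> = d\<close>; the limit case \<open>d = 0\<close> is included.\<close>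
  define D where "D d z = 2 * Z1 (sqn z) * (P z / (n z + d\<^sup>2) - sqn z / (sqn z + d\<^sup>2))" for d z
  have cont: "continuous_on ?U n" "continuous_on ?U P" "continuous_on (ball 0 1) n" "continuous_on (ball 0 1) P"
    unfolding n_def P_def
    by (intro continuous_intros continuous_on_subset[OF C1_gradD(2)[OF a]] continuous_on_subset[OF C1_gradD(3)[OF a]]
       continuous_on_subset[OF C1_gradD(4)[OF a]] continuous_on_subset[OF C1_gradD(2)[OF b]] 
       continuous_on_subset[OF C1_gradD(3)[OF b]] continuous_on_subset[OF C1_gradD(4)[OF b]] UB order_refl)+
  have cZ1: "continuous_on UNIV Z1" by (rule DERIV_continuous_on[where D=Z2]) (rule has_field_derivative_at_within[OF Z(2)])
  then have cZ1s: "continuous_on UNIV (\<lambda>z. 2 * Z1 (sqn z))" 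
    by (intro continuous_intros continuous_on_compose2[OF cZ1]) auto
  have \<chi>: "cutoff r2 (\<lambda>z. Z (sqn z)) (\<lambda>z. Z1 (sqn z) * (2 * fst z)) (\<lambda>z. Z1 (sqn z) * (2 * snd z))"
    using Z r continuous_on_subset[OF cZ1] by (intro cutoff_radial) auto
  have r2: "0 \<le> r2" using r by linarith
  have i\<chi>: "(\<lambda>z. Z (sqn z) * f z) integrable_on square" if "continuous_on (ball 0 1) f" for f
    by (rule integrable_cutoff[OF cutoffD(1)[OF \<chi>] cutoffD(4)[OF \<chi>] r(4) that])
  have Di: "D d integrable_on square" if "d > 0" for d
  proof -
    have "n z + d\<^sup>2 > 0" "sqn z + d\<^sup>2 > 0" for z using that by (auto simp: n_def intro: add_nonneg_pos)
    then have "continuous_on (ball 0 1) (\<lambda>z. P z / (n z + d\<^sup>2) - sqn z / (sqn z + d\<^sup>2))"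
      using cont by (intro continuous_intros) (auto simp: less_imp_neq[symmetric])
    then show ?thesis unfolding D_def
      using off r by (intro integrable_cutoff[OF cZ1s _ r(4)]) auto
  qed
  have mass: "integral square (\<lambda>z. Z (sqn z) * mass_density d a ax ay b bx by z)
     - integral square (\<lambda>z. Z (sqn z) * mass_density d fst (\<lambda>_. 1) (\<lambda>_. 0) snd (\<lambda>_. 0) (\<lambda>_. 1) z) 
     = - integral square (D d)" if d: "d > 0" for d
  proof -
    let ?m = "\<lambda>z. Z (sqn z) * mass_density d a ax ay b bx by z" 
    let ?mI = "\<lambda>z. Z (sqn z) * mass_density d fst (\<lambda>_. 1) (\<lambda>_. 0) snd (\<lambda>_. 0) (\<lambda>_. 1) z"
    have i1: "?m integrable_on square"
      by (rule i\<chi>[OF continuous_on_mass_density[OF a b d]])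
    have i2: "?mI integrable_on square"
      by (rule i\<chi>[OF continuous_on_mass_density[OF C1_grad_fst C1_grad_snd d]])
    note i = i1 i2
    let ?T = "\<lambda>z. Z1 (sqn z) * (2 * fst z) * ((a z * by z - b z * ay z) / (n z + d\<^sup>2))
            - Z1 (sqn z) * (2 * snd z) * ((a z * bx z - b z * ax z) / (n z + d\<^sup>2)) + ?m z"
    let ?TI = "\<lambda>z. Z1 (sqn z) * (2 * fst z) * ((fst z * 1 - snd z * 0) / (sqn z + d\<^sup>2))
            - Z1 (sqn z) * (2 * snd z) * ((fst z * 0 - snd z * 1) / (sqn z + d\<^sup>2)) + ?mI z"
    have T: "integral square ?T = 0" using angular_form_curl[OF a b \<chi> r2 r(4) d] unfolding n_def .
    have T0: "integral square ?TI = 0" using angular_form_curl[OF C1_grad_fst C1_grad_snd \<chi> r2 r(4) d] unfolding sqn_def .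
    have e: "?T z - ?TI z = D d z + (?m z - ?mI z)" for z
      unfolding D_def P_def by (simp add: sqn_def divide_inverse algebra_simps power2_eq_square)
    have i0: "?TI integrable_on square"
    proof -
      have "continuous_on UNIV (\<lambda>z. Z1 (sqn z))" by (intro continuous_intros continuous_on_compose2[OF cZ1]) auto
      moreover have "sqn z + d\<^sup>2 \<noteq> 0" for z
        using add_nonneg_pos[OF sqn_ge_0, of "d\<^sup>2" z] d by simp
      ultimately show ?thesis
        by (intro integrable_add i(2) integrable_continuous continuous_intros) (auto intro: continuous_on_subset)
    qed
    have "(\<lambda>z. ?TI z + (D d z + (?m z - ?mI z))) integrable_on square"
      by (intro integrable_add integrable_diff i i0 Di d)
    moreover have "?TI z + (D d z + (?m z - ?mI z)) = ?T z" for z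
      using e[of z] by linarith
    ultimately have "?T integrable_on square" by (simp only:)
    then have "0 = integral square (\<lambda>z. ?T z - ?TI z)" using T T0 i0 by (subst integral_diff) simp_all
    also have "\<dots> = integral square (D d) + (integral square ?m - integral square ?mI)"
      unfolding e using i Di[OF d] by (simp only: integral_add integral_diff integrable_diff)
    finally show ?thesis by simp
  qed
  have lim: "(\<lambda>k. integral square (D (eps k))) \<longlonglongrightarrow> integral square (D 0)"
  proof (rule dominated_convergence(2)[where h="\<lambda>z. \<bar>2 * Z1 (sqn z)\<bar> * (\<bar>P z\<bar> / n z + 1)"])
    show "D (eps k) integrable_on square" for k by (rule Di[OF eps_pos])
    have "continuous_on ?U (\<lambda>z. \<bar>P z\<bar> / n z + 1)"
      using cont n0 by (intro continuous_intros) (auto simp: less_imp_neq[symmetric])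
    then have "continuous_on UNIV (\<lambda>z. \<bar>2 * Z1 (sqn z)\<bar> * (\<bar>P z\<bar> / n z + 1))"
      by (intro continuous_on_extend[OF _ K _ U KU]) (use cZ1s off in \<open>auto intro!: continuous_intros\<close>)
    then show "(\<lambda>z. \<bar>2 * Z1 (sqn z)\<bar> * (\<bar>P z\<bar> / n z + 1)) integrable_on square"
      by (rule integrable_continuous[OF continuous_on_subset[OF _ subset_UNIV]])
    fix z :: "real \<times> real"
    show "norm (D (eps k) z) \<le> \<bar>2 * Z1 (sqn z)\<bar> * (\<bar>P z\<bar> / n z + 1)" for k
    proof (cases "z \<in> ?K")
      case False
      then show ?thesis using off[OF False] by (simp add: D_def)
    next
      case True
      then have z: "z \<in> ?U" using KU by blast
      have "\<bar>P z / (n z + (eps k)\<^sup>2) - sqn z / (sqn z + (eps k)\<^sup>2)\<bar> \<le> \<bar>P z / (n z + (eps k)\<^sup>2)\<bar> + \<bar>sqn z / (sqn z + (eps k)\<^sup>2)\<bar>"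
        by linarith
      also have "\<dots> \<le> \<bar>P z\<bar> / n z + 1"
      proof (rule add_mono)
        have "\<bar>P z / (n z + (eps k)\<^sup>2)\<bar> = \<bar>P z\<bar> / (n z + (eps k)\<^sup>2)" using n0[OF z] by (simp add: abs_divide)
        also have "\<dots> \<le> \<bar>P z\<bar> / n z" using n0[OF z] by (intro divide_left_mono) (auto intro!: mult_pos_pos add_pos_nonneg)
        finally show "\<bar>P z / (n z + (eps k)\<^sup>2)\<bar> \<le> \<bar>P z\<bar> / n z" .
        show "\<bar>sqn z / (sqn z + (eps k)\<^sup>2)\<bar> \<le> 1" using sq0[OF z] by (simp add: add_pos_nonneg)
      qed
      finally show ?thesis unfolding D_def real_norm_def abs_mult[of "2 * Z1 (sqn z)"]
        by (rule mult_left_mono) simp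
    qed
    show "(\<lambda>k. D (eps k) z) \<longlonglongrightarrow> D 0 z"
    proof (cases "z \<in> ?K")
      case False
      then show ?thesis using off[OF False] by (simp add: D_def)
    next
      case True
      then have z: "z \<in> ?U" using KU by blast
      show ?thesis unfolding D_def
        using n0[OF z] sq0[OF z] by (intro tendsto_intros eps_tendsto) auto
    qed
  qed
  have D0: "D 0 z = 2 * (Z1 (sqn z) * (fst z * ((a z * by z - b z * ay z) / ((a z)\<^sup>2 + (b z)\<^sup>2) - fst z / sqn z)
     - snd z * ((a z * bx z - b z * ax z) / ((a z)\<^sup>2 + (b z)\<^sup>2) + snd z / sqn z)))" for z
  proof (cases "z \<in> ?K")
    case False
    then show ?thesis using off[OF False] by (simp add: D_def)
  next
    case True
    have s: "sqn z / sqn z = (fst z * fst z + snd z * snd z) / sqn z"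
      by (simp only: sqn_def power2_eq_square)
    have "P z / n z - sqn z / sqn z = fst z * ((a z * by z - b z * ay z) / ((a z)\<^sup>2 + (b z)\<^sup>2) - fst z / sqn z)
     - snd z * ((a z * bx z - b z * ax z) / ((a z)\<^sup>2 + (b z)\<^sup>2) + snd z / sqn z)"
      unfolding P_def n_def s by (simp add: divide_inverse algebra_simps)
    then show ?thesis unfolding D_def by (simp add: mult.assoc)
  qed
  have "integral square (D 0) = 2 * integral square (\<lambda>z. (Z1 (sqn z) * (fst z * ((a z * by z - b z * ay z) / ((a z)\<^sup>2 + (b z)\<^sup>2) - fst z / sqn z)
     - snd z * ((a z * bx z - b z * ax z) / ((a z)\<^sup>2 + (b z)\<^sup>2) + snd z / sqn z))))"
    by (subst integral_mult_right[symmetric], rule integral_cong, rule D0)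
  also have "\<dots> = 0"
  proof -
    have "C1_grad ?U (\<lambda>z. Im (l z)) (\<lambda>z. (a z * bx z - b z * ax z) / ((a z)\<^sup>2 + (b z)\<^sup>2) + snd z / sqn z)
      (\<lambda>z. (a z * by z - b z * ay z) / ((a z)\<^sup>2 + (b z)\<^sup>2) - fst z / sqn z)"
      by (rule C1_grad_argument[OF U U0 C1_grad_subset[OF a UB] C1_grad_subset[OF b UB] l]) (use eq in auto)
    from integral_rotation_eq_0[OF r Z(2,3) _ this] Z(4,5) show ?thesis by auto
  qed
  finally have "(\<lambda>k. - integral square (D (eps k))) \<longlonglongrightarrow> 0" using tendsto_minus[OF lim] by simp
  then show ?thesis using mass[OF eps_pos] by simp
qed

context conformal_disc
begin

text \<open>
  For the identity map the residual is \<open>O(|Q w - Q 0|) = O(|w|)\<close>, which is of the admitted size.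
\<close>

lemma identity_almost_solution: "almost_solution fst (\<lambda>_. 1) (\<lambda>_. 0) snd (\<lambda>_. 0) (\<lambda>_. 1)"
  unfolding almost_solution_def
proof (intro conjI allI impI C1_grad_fst C1_grad_snd)
  fix r :: real assume "r < 1"
  then have r: "0 \<le> max 0 r" "max 0 r < 1" by auto
  obtain L1 where L1: "L1 > 0" "\<And>z. z \<in> cball 0 (max 0 r) \<Longrightarrow> \<bar>e z - e 0\<bar> \<le> L1 * norm z"
    by (rule C1_lipschitz_at_0[OF e r]) (rule that)
  obtain L2 where L2: "L2 > 0" "\<And>z. z \<in> cball 0 (max 0 r) \<Longrightarrow> \<bar>g z - g 0\<bar> \<le> L2 * norm z"
    by (rule C1_lipschitz_at_0[OF g r]) (rule that)
  show "\<exists>K. \<forall>z\<in>cball 0 r. \<bar>res1 (\<lambda>_. 1) (\<lambda>_. 0) (\<lambda>_. 1) z\<bar> \<le> K * sqrt ((fst z)\<^sup>2 + (snd z)\<^sup>2) \<and>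
        \<bar>res2 (\<lambda>_. 0) (\<lambda>_. 0) (\<lambda>_. 1) z\<bar> \<le> K * sqrt ((fst z)\<^sup>2 + (snd z)\<^sup>2)"
  proof (rule exI[of _ "L1 + L2"], rule ballI)
    fix z :: "real \<times> real" assume "z \<in> cball 0 r"
    then have z: "z \<in> cball 0 (max 0 r)" by auto
    have n: "sqrt ((fst z)\<^sup>2 + (snd z)\<^sup>2) = norm z" by (simp add: norm_prod_def)
    have "0 \<le> L1 * norm z" "0 \<le> L2 * norm z" using L1(1) L2(1) by auto
    moreover have "res1 (\<lambda>_. 1) (\<lambda>_. 0) (\<lambda>_. 1) z = - (g z - g 0)" "res2 (\<lambda>_. 0) (\<lambda>_. 0) (\<lambda>_. 1) z = e z - e 0"
      by (simp_all add: res1_def res2_def at_0)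
    ultimately show "\<bar>res1 (\<lambda>_. 1) (\<lambda>_. 0) (\<lambda>_. 1) z\<bar> \<le> (L1 + L2) * sqrt ((fst z)\<^sup>2 + (snd z)\<^sup>2) \<and>
        \<bar>res2 (\<lambda>_. 0) (\<lambda>_. 0) (\<lambda>_. 1) z\<bar> \<le> (L1 + L2) * sqrt ((fst z)\<^sup>2 + (snd z)\<^sup>2)"
      using L1(2)[OF z] L2(2)[OF z] unfolding n by (simp only: abs_minus_cancel distrib_right) linarith
  qed
qed

text \<open>
  In the limit the identity map has all its mass at the origin, where \<open>\<Phi>\<close> attains its maximum. The map \<open>(a, b)\<close> has the
  same total mass, and up to a negative part that tends to zero this mass is positive, so it cannot contribute more.
\<close>

lemma excess_mass_bound:
  assumes sol: "almost_solution a ax ay b bx by"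
    and r: "0 \<le> r0" "r0 < r1" "r1 < 1"
    and l: "continuous_on {z. r0 < norm z \<and> norm z < 1} l"
    and eq: "\<And>z. r0 < norm z \<Longrightarrow> norm z < 1 \<Longrightarrow> Complex (a z) (b z) = Complex (fst z) (snd z) * exp (l z)"
    and \<Phi>: "\<And>t. t \<ge> 0 \<Longrightarrow> (\<Phi> has_real_derivative - f t) (at t)" "\<And>t. t \<ge> r1\<^sup>2 \<Longrightarrow> \<Phi> t = 0"
    "\<And>t. t \<ge> 0 \<Longrightarrow> 0 \<le> \<Phi> t" "\<And>t. t \<ge> 0 \<Longrightarrow> \<Phi> t \<le> \<Phi> 0"
  obtains V where "V \<longlonglongrightarrow> 0"
    "\<And>n. integral square (\<lambda>z. \<Phi> (sqn z) * mass_density (eps n) a ax ay b bx by z)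
     - integral square (\<lambda>z. \<Phi> (sqn z) * mass_density (eps n) fst (\<lambda>_. 1) (\<lambda>_. 0) snd (\<lambda>_. 0) (\<lambda>_. 1) z) \<le> V n"
proof -
  have a: "C1_grad (ball 0 1) a ax ay" and b: "C1_grad (ball 0 1) b bx by"
    using sol by (auto simp: almost_solution_def)
  obtain r2 where r2: "r1 < r2" "r2 < 1" using r dense by blast
  have r2': "0 \<le> r2" and r1': "0 \<le> r1" using r r2 by linarith+
  have "r1\<^sup>2 < r2\<^sup>2" using r r2 by (intro power_strict_mono) auto
  obtain Z Z1 Z2 where Z: "\<And>t. (Z has_real_derivative Z1 t) (at t)" "\<And>t. (Z1 has_real_derivative Z2 t) (at t)"
    "continuous_on UNIV Z2" "\<And>t. t \<le> r1\<^sup>2 \<Longrightarrow> Z t = 1 \<and> Z1 t = 0 \<and> Z2 t = 0" "\<And>t. t \<ge> r2\<^sup>2 \<Longrightarrow> Z t = 0 \<and> Z1 t = 0 \<and> Z2 t = 0"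
    "\<And>t. 0 \<le> Z t" "\<And>t. Z t \<le> 1"
    by (rule C2_step_function[OF \<open>r1\<^sup>2 < r2\<^sup>2\<close>]) (rule that)
  let ?m = "\<lambda>n. mass_density (eps n) a ax ay b bx by"
  let ?mI = "\<lambda>n. mass_density (eps n) fst (\<lambda>_. 1) (\<lambda>_. 0) snd (\<lambda>_. 0) (\<lambda>_. 1)"
  define \<tau> where "\<tau> = \<Phi> 0"
  have \<tau>: "\<tau> \<ge> 0" using \<Phi>(3)[of 0] by (simp add: \<tau>_def)
  define D where "D n = integral square (\<lambda>z. Z (sqn z) * ?m n z) - integral square (\<lambda>z. Z (sqn z) * ?mI n z)" for n
  have D: "D \<longlonglongrightarrow> 0" unfolding D_def
    by (rule total_mass_difference_tendsto[OF a b r(1,2) r2 l eq Z(1-5)])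
  have cZ: "continuous_on UNIV Z" by (rule DERIV_continuous_on[where D=Z1]) (rule has_field_derivative_at_within[OF Z(1)])
  have c\<Phi>: "continuous_on {0..} \<Phi>" by (rule DERIV_continuous_on[where D="\<lambda>t. - f t"]) (rule has_field_derivative_at_within[OF \<Phi>(1)], simp)
  have cZs: "continuous_on UNIV (\<lambda>z. Z (sqn z))" by (intro continuous_intros continuous_on_compose2[OF cZ]) auto
  have c\<Phi>s: "continuous_on UNIV (\<lambda>z. \<Phi> (sqn z))" by (intro continuous_intros continuous_on_compose2[OF c\<Phi>]) auto
  have Z0: "Z (sqn z) = 0" if "r2 < norm z" for z using that r2' by (intro conjunct1[OF Z(5)]) (simp add: sqn_eq power_mono)
  have \<Phi>0: "\<Phi> (sqn z) = 0" if "r2 < norm z" for z using that r2(1) r1' by (intro \<Phi>(2)) (simp add: sqn_eq power_mono)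
  have iZ: "(\<lambda>z. Z (sqn z) * h z) integrable_on square" if "continuous_on (ball 0 1) h" for h
    by (rule integrable_cutoff[OF cZs Z0 r2(2) that])
  have i\<Phi>: "(\<lambda>z. \<Phi> (sqn z) * h z) integrable_on square" if "continuous_on (ball 0 1) h" for h
    by (rule integrable_cutoff[OF c\<Phi>s \<Phi>0 r2(2) that])
  have cm: "continuous_on (ball 0 1) (?m n)" for n by (rule continuous_on_mass_density[OF a b eps_pos])
  have cmI: "continuous_on A (?mI n)" for n A by (rule continuous_on_mass_density[OF C1_grad_fst C1_grad_snd eps_pos])
  obtain C where C: "C \<ge> 0" "\<And>\<epsilon> z. z \<in> cball 0 r2 \<Longrightarrow> 
     mass_density \<epsilon> a ax ay b bx by z \<ge> - C * (((a z)\<^sup>2 + (b z)\<^sup>2) * \<epsilon>\<^sup>2 / ((a z)\<^sup>2 + (b z)\<^sup>2 + \<epsilon>\<^sup>2)\<^sup>2)"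
    by (rule mass_density_ge[OF sol r2(2)]) (rule that)
  define kern where "kern n z = ((a z)\<^sup>2 + (b z)\<^sup>2) * (eps n)\<^sup>2 / ((a z)\<^sup>2 + (b z)\<^sup>2 + (eps n)\<^sup>2)\<^sup>2" for n z
  have cab: "continuous_on (ball 0 1) (\<lambda>z. (a z)\<^sup>2 + (b z)\<^sup>2)"
    by (intro continuous_intros C1_gradD(2)[OF a] C1_gradD(2)[OF b])
  have ck: "continuous_on (ball 0 1) (kern n)" for n
  proof -
    have "((a z)\<^sup>2 + (b z)\<^sup>2) + (eps n)\<^sup>2 > 0" for z using eps_pos[of n] by (intro add_nonneg_pos) auto
    then have "((a z)\<^sup>2 + (b z)\<^sup>2 + (eps n)\<^sup>2)\<^sup>2 \<noteq> 0" for z by (metis less_irrefl power_eq_0_iff)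
    then show ?thesis unfolding kern_def using C1_gradD(2)[OF a] C1_gradD(2)[OF b] by (intro continuous_intros) auto
  qed
  have kern: "(\<lambda>n. integral square (\<lambda>z. Z (sqn z) * kern n z)) \<longlonglongrightarrow> 0"
    unfolding kern_def by (rule integral_kernel_tendsto[OF cZs Z0 r2(2) cab]) (auto intro!: add_nonneg_nonneg)
  have \<Phi>Z: "0 \<le> \<tau> * Z (sqn z) - \<Phi> (sqn z)" "\<tau> * Z (sqn z) - \<Phi> (sqn z) \<le> \<tau> * Z (sqn z)" for z
  proof -
    show "\<tau> * Z (sqn z) - \<Phi> (sqn z) \<le> \<tau> * Z (sqn z)" using \<Phi>(3)[of "sqn z"] by simp
    show "0 \<le> \<tau> * Z (sqn z) - \<Phi> (sqn z)"
      using Z(4)[of "sqn z"] \<Phi>(2)[of "sqn z"] \<Phi>(4)[of "sqn z"] \<tau> Z(6)[of "sqn z"]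
      by (cases "sqn z \<le> r1\<^sup>2") (auto simp: \<tau>_def)
  qed
  have up: "integral square (\<lambda>z. \<Phi> (sqn z) * ?m n z) \<le> \<tau> * integral square (\<lambda>z. Z (sqn z) * ?m n z) + \<tau> * C * integral square (\<lambda>z. Z (sqn z) * kern n z)" for n
  proof -
    have "integral square (\<lambda>z. \<Phi> (sqn z) * ?m n z) \<le> integral square (\<lambda>z. \<tau> * (Z (sqn z) * ?m n z) + \<tau> * C * (Z (sqn z) * kern n z))"
    proof (rule integral_le[OF i\<Phi>[OF cm]])
      show "(\<lambda>z. \<tau> * (Z (sqn z) * ?m n z) + \<tau> * C * (Z (sqn z) * kern n z)) integrable_on square"
        by (rule integrable_add[OF integrable_on_mult_right[OF iZ[OF cm]] integrable_on_mult_right[OF iZ[OF ck]]])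
      fix z
      show "\<Phi> (sqn z) * ?m n z \<le> \<tau> * (Z (sqn z) * ?m n z) + \<tau> * C * (Z (sqn z) * kern n z)"
      proof (cases "r2 < norm z")
        case True then show ?thesis using Z0 \<Phi>0 by simp
      next
        case False
        then have "- (C * kern n z) \<le> ?m n z" using C(2)[of z "eps n"] by (simp add: kern_def)
        from mult_left_mono[OF this \<Phi>Z(1)[of z]]
        have "(\<tau> * Z (sqn z) - \<Phi> (sqn z)) * - (C * kern n z) \<le> (\<tau> * Z (sqn z) - \<Phi> (sqn z)) * ?m n z" .
        moreover have "(\<tau> * Z (sqn z) - \<Phi> (sqn z)) * (C * kern n z) \<le> \<tau> * Z (sqn z) * (C * kern n z)"
          by (rule mult_right_mono[OF \<Phi>Z(2)]) (use C(1) in \<open>simp add: kern_def\<close>)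
        ultimately show ?thesis by (simp add: algebra_simps)
      qed
    qed
    also have "\<dots> = \<tau> * integral square (\<lambda>z. Z (sqn z) * ?m n z) + \<tau> * C * integral square (\<lambda>z. Z (sqn z) * kern n z)"
      by (subst integral_add[OF integrable_on_mult_right[OF iZ[OF cm]] integrable_on_mult_right[OF iZ[OF ck]]]) simp
    finally show ?thesis .
  qed
  define R where "R n = integral square (\<lambda>z. (\<tau> * Z (sqn z) - \<Phi> (sqn z)) * ?mI n z)" for n
  have low: "integral square (\<lambda>z. \<Phi> (sqn z) * ?mI n z) = \<tau> * integral square (\<lambda>z. Z (sqn z) * ?mI n z) - R n" for n
  proof -
    have "R n = integral square (\<lambda>z. \<tau> * (Z (sqn z) * ?mI n z) - \<Phi> (sqn z) * ?mI n z)"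
      unfolding R_def by (simp only: left_diff_distrib mult.assoc)
    also have "\<dots> = \<tau> * integral square (\<lambda>z. Z (sqn z) * ?mI n z) - integral square (\<lambda>z. \<Phi> (sqn z) * ?mI n z)"
      by (subst integral_diff[OF integrable_on_mult_right[OF iZ[OF cmI]] i\<Phi>[OF cmI]]) simp
    finally show ?thesis by simp
  qed
  have R: "R \<longlonglongrightarrow> 0"
  proof -
    have Zsmall: "\<exists>B. \<forall>z\<in>square. \<tau> * Z (sqn z) - \<Phi> (sqn z) \<le> B * sqn z"
    proof -
      have "(\<Phi> has_derivative (*) (- f 0)) (at 0)"
        using \<Phi>(1)[of 0] unfolding has_field_derivative_def by simp
      then have "\<forall>e>0. \<exists>d>0. \<forall>y. norm (y - 0) < d \<longrightarrow> norm (\<Phi> y - \<Phi> 0 - (- f 0) * (y - 0)) \<le> e * norm (y - 0)"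
        unfolding has_derivative_at_alt by (rule conjunct2)
      from this[rule_format, OF zero_less_one] obtain d where "d > 0"
        "\<forall>y. norm (y - 0) < d \<longrightarrow> norm (\<Phi> y - \<Phi> 0 - (- f 0) * (y - 0)) \<le> 1 * norm (y - 0)" by blast
      then have d: "d > 0" "\<And>t. \<bar>t\<bar> < d \<Longrightarrow> \<bar>\<Phi> t - \<Phi> 0 - (- f 0 * t)\<bar> \<le> 1 * \<bar>t\<bar>"
        by simp_all
      have "\<tau> * Z (sqn z) - \<Phi> (sqn z) \<le> (\<bar>f 0\<bar> + 1 + \<tau> / d) * sqn z" for z
      proof -
        have tz: "\<tau> * Z (sqn z) \<le> \<tau>" using \<tau> Z(7)[of "sqn z"] by (simp add: mult_left_le)
        have f1: "0 \<le> (\<bar>f 0\<bar> + 1) * sqn z" "0 \<le> \<tau> / d * sqn z" using \<tau> d(1) by (auto intro!: mult_nonneg_nonneg)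
        show ?thesis
        proof (cases "sqn z < d")
          case True
          have "f 0 * sqn z \<le> \<bar>f 0\<bar> * sqn z" by (rule mult_right_mono) auto
          then have "\<Phi> 0 - \<Phi> (sqn z) \<le> (\<bar>f 0\<bar> + 1) * sqn z"
            using d(2)[of "sqn z"] True by (simp add: distrib_right)
          then show ?thesis using tz f1 unfolding \<tau>_def[symmetric] distrib_right[of _ "\<tau> / d"] by linarith
        next
          case False
          have "\<tau> = \<tau> / d * d" using d(1) by simp
          also have "\<dots> \<le> \<tau> / d * sqn z" using False \<tau> d(1) by (intro mult_left_mono) auto
          finally show ?thesis using tz f1 \<Phi>(3)[OF sqn_ge_0, of z] unfolding distrib_right[of _ "\<tau> / d"] by linarith
        qed
      qed
      then show ?thesis by blast
    qed
    then obtain B where B: "\<And>z. z \<in> square \<Longrightarrow> \<tau> * Z (sqn z) - \<Phi> (sqn z) \<le> B * sqn z" by blast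
    have "(\<lambda>n. R n) \<longlonglongrightarrow> integral square (\<lambda>z. 0::real)"
      unfolding R_def
    proof (rule dominated_convergence(2)[where h="\<lambda>z. 2 * \<bar>B\<bar>"])
      show "(\<lambda>z. (\<tau> * Z (sqn z) - \<Phi> (sqn z)) * ?mI n z) integrable_on square" for n
        using cZs c\<Phi>s by (intro integrable_continuous continuous_intros cmI) (auto intro: continuous_on_subset)
      fix z :: "real \<times> real" assume z: "z \<in> square"
      show "norm ((\<tau> * Z (sqn z) - \<Phi> (sqn z)) * ?mI n z) \<le> 2 * \<bar>B\<bar>" for n
      proof -
        have "?mI n z \<ge> 0" by (simp add: mass_density_identity)
        then have "norm ((\<tau> * Z (sqn z) - \<Phi> (sqn z)) * ?mI n z) = (\<tau> * Z (sqn z) - \<Phi> (sqn z)) * ?mI n z"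
          using \<Phi>Z(1)[of z] by simp
        also have "\<dots> \<le> (B * sqn z) * ?mI n z" by (rule mult_right_mono[OF B[OF z] \<open>?mI n z \<ge> 0\<close>])
        also have "\<dots> = 2 * B * (sqn z * (eps n)\<^sup>2 / (sqn z + (eps n)\<^sup>2)\<^sup>2)" by (simp add: mass_density_identity)
        also have "\<dots> \<le> 2 * \<bar>B\<bar> * 1"
          by (rule mult_mono) (use kernel_bounds[OF sqn_ge_0 eps_pos, of z n] in auto)
        finally show ?thesis by simp
      qed
      show "(\<lambda>n. (\<tau> * Z (sqn z) - \<Phi> (sqn z)) * ?mI n z) \<longlonglongrightarrow> 0"
      proof (cases "sqn z = 0")
        case True
        then have "\<tau> * Z (sqn z) - \<Phi> (sqn z) = 0" using Z(4)[of 0] by (simp add: \<tau>_def)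
        then show ?thesis by simp
      next
        case False
        have "(\<lambda>n. 2 * (eps n)\<^sup>2 / (sqn z + (eps n)\<^sup>2)\<^sup>2) \<longlonglongrightarrow> 2 * 0\<^sup>2 / (sqn z + 0\<^sup>2)\<^sup>2"
          using False by (intro tendsto_intros eps_tendsto) auto
        then have "(\<lambda>n. ?mI n z) \<longlonglongrightarrow> 0" by (simp add: mass_density_identity)
        then show ?thesis by (rule tendsto_mult_right_zero)
      qed
    qed auto
    then show ?thesis by simp
  qed
  show thesis
  proof (rule that[of "\<lambda>n. \<tau> * D n + \<tau> * C * integral square (\<lambda>z. Z (sqn z) * kern n z) + R n"])
    show "(\<lambda>n. \<tau> * D n + \<tau> * C * integral square (\<lambda>z. Z (sqn z) * kern n z) + R n) \<longlonglongrightarrow> 0"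
      using tendsto_add[OF tendsto_add[OF tendsto_mult_right_zero[OF D] tendsto_mult_right_zero[OF kern]] R] by simp
    fix n
    show "integral square (\<lambda>z. \<Phi> (sqn z) * ?m n z) - integral square (\<lambda>z. \<Phi> (sqn z) * ?mI n z)
       \<le> \<tau> * D n + \<tau> * C * integral square (\<lambda>z. Z (sqn z) * kern n z) + R n"
      using up[of n] unfolding low[of n] D_def by (simp add: algebra_simps)
  qed
qed

end

section \<open>A superharmonic test function\<close>

text \<open>
  For \<open>lam = 0\<close> and \<open>d = 0\<close> this is the derivative of \<open>ln t\<close>, with \<open>t = |w|\<^sup>2\<close>. The shift by \<open>d\<^sup>2\<close> regularises the
  logarithm at the origin. The exponential factor makes the radial function with derivative \<open>- bump_log lam d\<close>
  strictly superharmonic away from the origin, by a margin that absorbs the effect of variable coefficients.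
\<close>

definition bump_log :: "real \<Rightarrow> real \<Rightarrow> real \<Rightarrow> real" where
  "bump_log lam d t = exp (lam * sqrt (t + d\<^sup>2)) / (t + d\<^sup>2)"

definition bump_log' :: "real \<Rightarrow> real \<Rightarrow> real \<Rightarrow> real" where
  "bump_log' lam d t = bump_log lam d t * (lam / (2 * sqrt (t + d\<^sup>2)) - 1 / (t + d\<^sup>2))"

lemma bump_log_deriv:
  assumes "t + d\<^sup>2 > 0"
  shows "(bump_log lam d has_real_derivative bump_log' lam d t) (at t)"
proof -
  have s: "((\<lambda>t. sqrt (t + d\<^sup>2)) has_real_derivative inverse (sqrt (t + d\<^sup>2)) / 2) (at t)"
    using assms by (auto intro!: derivative_eq_intros)
  have 1: "((\<lambda>t. exp (lam * sqrt (t + d\<^sup>2))) has_real_derivative exp (lam * sqrt (t + d\<^sup>2)) * (lam * (inverse (sqrt (t + d\<^sup>2)) / 2))) (at t)"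
    by (rule DERIV_fun_exp[OF DERIV_cmult[OF s]])
  have 2: "((\<lambda>t. t + d\<^sup>2) has_real_derivative 1) (at t)" by (auto intro!: derivative_eq_intros)
  have "((\<lambda>t. exp (lam * sqrt (t + d\<^sup>2)) / (t + d\<^sup>2)) has_real_derivative
      (exp (lam * sqrt (t + d\<^sup>2)) * (lam * (inverse (sqrt (t + d\<^sup>2)) / 2)) * (t + d\<^sup>2) - exp (lam * sqrt (t + d\<^sup>2)) * 1) / ((t + d\<^sup>2) * (t + d\<^sup>2))) (at t)"
    by (rule DERIV_divide[OF 1 2]) (use assms in simp)
  also have "(exp (lam * sqrt (t + d\<^sup>2)) * (lam * (inverse (sqrt (t + d\<^sup>2)) / 2)) * (t + d\<^sup>2) - exp (lam * sqrt (t + d\<^sup>2)) * 1) / ((t + d\<^sup>2) * (t + d\<^sup>2)) = bump_log' lam d t"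
  proof -
    have alg: "(E * X * w - E * 1) / (w * w) = E / w * (X - 1 / w)" if "w \<noteq> 0" for E X w :: real
      using that by (simp add: diff_divide_distrib right_diff_distrib)
    have X: "lam * (inverse (sqrt (t + d\<^sup>2)) / 2) = lam / (2 * sqrt (t + d\<^sup>2))"
      by (simp only: inverse_eq_divide times_divide_eq_right divide_divide_eq_left mult_1_right mult.commute)
    have nz: "t + d\<^sup>2 \<noteq> 0" using assms by simp
    show ?thesis unfolding bump_log'_def bump_log_def alg[OF nz] X ..
  qed
  finally show ?thesis unfolding bump_log_def[abs_def] .
qed

lemma continuous_bump_log:
  assumes "\<And>t. t \<in> A \<Longrightarrow> t + d\<^sup>2 > 0"
  shows "continuous_on A (bump_log lam d)" "continuous_on A (bump_log' lam d)"
proof -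
  have nz: "\<forall>t\<in>A. t + d\<^sup>2 \<noteq> 0" "\<forall>t\<in>A. 2 * sqrt (t + d\<^sup>2) \<noteq> 0"
    using assms by fastforce+
  show "continuous_on A (bump_log lam d)"
    unfolding bump_log_def using nz by (intro continuous_intros)
  show "continuous_on A (bump_log' lam d)"
    unfolding bump_log'_def bump_log_def using nz by (intro continuous_intros)
qed

text \<open>
  The field \<open>w / \<sigma>\<close> with \<open>\<sigma> = sqrt (|w|\<^sup>2 + d\<^sup>2)\<close> has length at most one and divergence at least \<open>1 / \<sigma>\<close>, so the
  integral is bounded by that of the gradient of the cutoff function.
\<close>

lemma integral_inverse_radius_bound:
  assumes r: "0 \<le> r1" "r1 < r2" "r2 < 1"
    and Z: "\<And>t. (Z has_real_derivative Z1 t) (at t)" "\<And>t. (Z1 has_real_derivative Z2 t) (at t)"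
      "\<And>t. t \<ge> r2\<^sup>2 \<Longrightarrow> Z t = 0 \<and> Z1 t = 0" "\<And>t. 0 \<le> Z t"
  obtains C where "C \<ge> 0" "\<And>d. d > 0 \<Longrightarrow> integral square (\<lambda>z. Z (sqn z) / sqrt (sqn z + d\<^sup>2)) \<le> C"
proof -
  have cZ1: "continuous_on UNIV Z1" by (rule DERIV_continuous_on[where D=Z2]) (rule has_field_derivative_at_within[OF Z(2)])
  have cZ: "continuous_on UNIV Z" by (rule DERIV_continuous_on[where D=Z1]) (rule has_field_derivative_at_within[OF Z(1)])
  have cZs: "continuous_on A (\<lambda>z. Z (sqn z))" "continuous_on A (\<lambda>z. Z1 (sqn z))" for A
    by (intro continuous_intros continuous_on_compose2[OF cZ] continuous_on_compose2[OF cZ1]; simp)+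
  have "bounded (Z1 ` {0..2})"
    by (intro compact_imp_bounded compact_continuous_image continuous_on_subset[OF cZ1]) auto
  then obtain B where B: "B > 0" "\<And>t. 0 \<le> t \<Longrightarrow> t \<le> 2 \<Longrightarrow> \<bar>Z1 t\<bar> \<le> B"
    unfolding bounded_pos by auto
  show thesis
  proof (rule that[of "4 * (4 * B)"])
    show "0 \<le> 4 * (4 * B)" using B by simp
    fix d :: real assume d: "d > 0"
    define s where "s z = sqrt (sqn z + d\<^sup>2)" for z
    have s0: "s z > 0" for z using d add_nonneg_pos[OF sqn_ge_0, of "d\<^sup>2" z] by (simp add: s_def)
    have s2: "s z * s z = sqn z + d\<^sup>2" for z using add_nonneg_nonneg[OF sqn_ge_0, of "d\<^sup>2" z] by (simp add: s_def)
    have cs: "continuous_on A s" for A unfolding s_def by (intro continuous_intros)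
    have dI: "((\<lambda>t. 1 / sqrt (t + d\<^sup>2)) has_real_derivative - 1 / (2 * (sqrt (t + d\<^sup>2)) ^ 3)) (at t)" if "t \<ge> 0" for t
    proof -
      have "t + d\<^sup>2 > 0" using that d by (simp add: add_nonneg_pos)
      then show ?thesis
        by (auto intro!: derivative_eq_intros simp: power3_eq_cube divide_simps)
    qed
    have I: "C1_grad UNIV (\<lambda>z. 1 / s z) (\<lambda>z. - 1 / (2 * s z ^ 3) * (2 * fst z)) (\<lambda>z. - 1 / (2 * s z ^ 3) * (2 * snd z))"
      unfolding s_def
    proof (rule C1_grad_radial[OF dI])
      have "sqrt (t + d\<^sup>2) \<noteq> 0" if "t \<ge> 0" for t using that d add_nonneg_pos[of t "d\<^sup>2"] by simp
      then show "continuous_on {0..} (\<lambda>t. - 1 / (2 * sqrt (t + d\<^sup>2) ^ 3))" by (intro continuous_intros) auto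
    qed
    have q: "cutoff r2 (\<lambda>z. Z (sqn z)) (\<lambda>z. Z1 (sqn z) * (2 * fst z)) (\<lambda>z. Z1 (sqn z) * (2 * snd z))"
      using Z r continuous_on_subset[OF cZ1] by (intro cutoff_radial) auto
    note c1 = cutoff_mult[OF q r(3) C1_grad_mult[OF C1_grad_fst C1_grad_subset[OF I subset_UNIV]]]
    note c2 = cutoff_mult[OF q r(3) C1_grad_mult[OF C1_grad_snd C1_grad_subset[OF I subset_UNIV]]]
    let ?X = "\<lambda>z. Z1 (sqn z) * (2 * fst z) * (fst z * (1 / s z)) + Z (sqn z) * (1 * (1 / s z) + fst z * (- 1 / (2 * s z ^ 3) * (2 * fst z)))"
    let ?Y = "\<lambda>z. Z1 (sqn z) * (2 * snd z) * (snd z * (1 / s z)) + Z (sqn z) * (1 * (1 / s z) + snd z * (- 1 / (2 * s z ^ 3) * (2 * snd z)))"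
    have X: "integral square ?X = 0" and Y: "integral square ?Y = 0"
      using integral_partial_eq_0(1)[OF c1 r(3)] integral_partial_eq_0(2)[OF c2 r(3)] by simp_all
    have iX: "?X integrable_on square" and iY: "?Y integrable_on square"
      using cutoffD(2)[OF c1] cutoffD(3)[OF c2] by (auto intro!: integrable_continuous intro: continuous_on_subset)
    define E where "E z = 2 * sqn z * Z1 (sqn z) / s z" for z
    have iE: "E integrable_on square" unfolding E_def
      using s0 by (intro integrable_continuous continuous_intros cZs cs) (auto simp: less_imp_neq[symmetric])
    have le: "Z (sqn z) / s z \<le> ?X z + ?Y z - E z" for z
    proof -
      define i where "i = 1 / s z"
      have i0: "i \<ge> 0" using s0[of z] by (simp add: i_def)
      have i3: "1 / (s z ^ 3) = i * i * i" by (simp add: i_def power3_eq_cube)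
      have "sqn z * (i * i) \<le> 1"
      proof -
        have p: "sqn z + d\<^sup>2 > 0" using d add_nonneg_pos[OF sqn_ge_0, of "d\<^sup>2" z] by simp
        have "i * i = 1 / (s z * s z)" by (simp add: i_def)
        then have "sqn z * (i * i) = sqn z / (sqn z + d\<^sup>2)" unfolding s2 by simp
        also have "\<dots> \<le> 1" using p by (subst divide_le_eq_1_pos) auto
        finally show ?thesis .
      qed
      then have "sqn z * (i * i) * i \<le> 1 * i" by (rule mult_right_mono[OF _ i0])
      then have "i \<le> 2 * i - sqn z * (i * i * i)" by (simp add: mult.assoc)
      then have "Z (sqn z) * i \<le> Z (sqn z) * (2 * i - sqn z * (i * i * i))" by (rule mult_left_mono[OF _ Z(4)])
      also have "\<dots> = ?X z + ?Y z - E z"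
      proof -
        have h1: "- 1 / (2 * s z ^ 3) = - (i * i * i) / 2" using i3 by simp
        have h2: "E z = 2 * sqn z * Z1 (sqn z) * i" by (simp add: E_def i_def)
        have h3: "sqn z = fst z * fst z + snd z * snd z" by (simp add: sqn_def power2_eq_square)
        define u v where "u = Z (sqn z)" and "v = Z1 (sqn z)"
        show ?thesis unfolding h1 h2 i_def[symmetric] u_def[symmetric] v_def[symmetric] unfolding h3
          by (simp add: algebra_simps)
      qed
      finally show ?thesis by (simp add: i_def)
    qed
    have "integral square (\<lambda>z. Z (sqn z) / s z) \<le> integral square (\<lambda>z. ?X z + ?Y z - E z)"
    proof (rule integral_le[OF _ _ le])
      show "(\<lambda>z. Z (sqn z) / s z) integrable_on square"
        using s0 by (intro integrable_continuous continuous_intros cZs cs) (auto simp: less_imp_neq[symmetric])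
      show "(\<lambda>z. ?X z + ?Y z - E z) integrable_on square" by (intro integrable_diff integrable_add iX iY iE)
    qed
    also have "\<dots> = - integral square E"
      using X Y by (simp only: integral_diff[OF integrable_add[OF iX iY] iE] integral_add[OF iX iY])
    also have "\<dots> \<le> 4 * (4 * B)"
    proof -
      have "\<bar>integral square E\<bar> \<le> 4 * (4 * B)"
      proof (rule integral_square_bound[OF iE])
        fix z :: "real \<times> real" assume z: "z \<in> square"
        have sq2: "sqn z \<le> 2"
        proof -
          have "\<bar>fst z\<bar> \<le> 1" "\<bar>snd z\<bar> \<le> 1" using z by (cases z, auto simp: cbox_Pair_eq)+
          then have "(fst z)\<^sup>2 \<le> 1" "(snd z)\<^sup>2 \<le> 1" by (simp_all add: abs_square_le_1)
          then show ?thesis by (simp add: sqn_def)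
        qed
        have "sqn z \<le> 2 * s z"
        proof (rule power2_le_imp_le)
          have "sqn z * sqn z \<le> 2 * sqn z" using sq2 by (intro mult_right_mono) auto
          also have "\<dots> \<le> 4 * (s z * s z)" unfolding s2 by simp
          finally show "(sqn z)\<^sup>2 \<le> (2 * s z)\<^sup>2" by (simp add: power2_eq_square)
        qed (use s0[of z] in simp)
        then have "sqn z / s z \<le> 2" using s0[of z] by (simp add: divide_le_eq)
        then have "\<bar>Z1 (sqn z)\<bar> * (sqn z / s z) \<le> B * 2"
          using B s0[of z] sq2 by (intro mult_mono) auto
        moreover have "\<bar>E z\<bar> = 2 * (\<bar>Z1 (sqn z)\<bar> * (sqn z / s z))"
          using s0[of z] by (simp add: E_def abs_mult abs_divide)
        ultimately show "\<bar>E z\<bar> \<le> 4 * B" by simp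
      qed
      then show ?thesis by simp
    qed
    finally show "integral square (\<lambda>z. Z (sqn z) / sqrt (sqn z + d\<^sup>2)) \<le> 4 * (4 * B)" unfolding s_def .
  qed
qed

text \<open>
  The flux density of the regularised logarithm is a positive multiple of this expression, with \<open>s = |w|\<close>,
  \<open>w = \<sigma>\<^sup>2\<close>, \<open>Q\<close> the value of the quadratic form and \<open>D\<close> the divergence of \<open>P w\<close>. For constant standard
  coefficients, \<open>- 2 Q / w + D = 2 d\<^sup>2 / w\<close>. The deviation \<open>O(L s)\<close> is absorbed by the first term if
  \<open>t \<ge> d\<^sup>2\<close>, and by \<open>2 d\<^sup>2 / w \<ge> 1\<close> if \<open>t < d\<^sup>2\<close>.
\<close>

lemma bump_bracket:
  fixes t s \<sigma> w Q D L m d :: real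
  assumes s: "s \<ge> 0" "s * s = t" and w: "w = t + d * d" and \<sigma>: "\<sigma> > 0" "\<sigma> * \<sigma> = w" and d: "d > 0" "L * d \<le> 1/2"
    and L: "L > 0" "m > 0" and Q: "m * t \<le> Q" "Q \<le> t + L * s * t" and D: "D \<ge> 2 - L * s"
  shows "4 * L / m * Q / \<sigma> - 2 * Q / w + D \<ge> 0" "t < d * d \<Longrightarrow> 4 * L / m * Q / \<sigma> - 2 * Q / w + D \<ge> 1/2"
proof -
  have t0: "t \<ge> 0" using mult_nonneg_nonneg[OF s(1) s(1)] s(2) by linarith
  have w0: "w > 0" using t0 d w by (simp add: add_nonneg_pos)
  have "4 * L * t \<le> 4 * L / m * Q" using Q(1) L by (simp add: pos_le_divide_eq mult_ac)
  then have 1: "4 * L * t / \<sigma> \<le> 4 * L / m * Q / \<sigma>" using \<sigma>(1) by (intro divide_right_mono) auto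
  have "0 < d * d" using d(1) by simp
  then have "s * s \<le> \<sigma> * \<sigma>" unfolding s(2) \<sigma>(2) w by linarith
  then have s\<sigma>: "s \<le> \<sigma>" by (rule power2_le_imp_le[unfolded power2_eq_square]) (use \<sigma>(1) in simp)
  have "2 * Q / w \<le> 2 * (t + L * s * t) / w" using Q(2) w0 by (intro divide_right_mono) auto
  also have "\<dots> = 2 * t / w + 2 * L * (s * t / w)" by (simp add: add_divide_distrib mult_ac)
  also have "s * t / w \<le> \<sigma> * t / w" using s\<sigma> t0 w0 by (intro divide_right_mono mult_right_mono) auto
  also have "\<sigma> * t / w = t / \<sigma>" unfolding \<sigma>(2)[symmetric] using \<sigma>(1) by simp
  finally have 2: "2 * Q / w \<le> 2 * t / w + 2 * L * (t / \<sigma>)" using L by (simp add: mult_left_mono)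
  have 3: "2 - 2 * t / w = 2 * (d * d) / w" using w0 by (simp add: w field_simps)
  have 4: "4 * L / m * Q / \<sigma> - 2 * Q / w + D \<ge> 2 * L * (t / \<sigma>) + 2 * (d * d) / w - L * s"
    using 1 2 3 D by (simp add: mult.assoc)
  have n: "0 \<le> 2 * L * (t / \<sigma>)" using L t0 \<sigma>(1) by simp
  have small: "2 * L * (t / \<sigma>) + 2 * (d * d) / w - L * s \<ge> 1 / 2" if td: "t < d * d"
  proof -
    have "1 \<le> 2 * (d * d) / w" using w0 td w by (simp add: pos_le_divide_eq)
    moreover have "s < d"
    proof (rule ccontr)
      assume "\<not> s < d"
      then have "d * d \<le> s * s" using d(1) by (intro mult_mono) auto
      then show False using td s(2) by linarith
    qed
    then have "L * s \<le> L * d" using L by simp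
    ultimately show ?thesis using n d(2) by linarith
  qed
  then show "t < d * d \<Longrightarrow> 4 * L / m * Q / \<sigma> - 2 * Q / w + D \<ge> 1/2" using 4 by linarith
  show "4 * L / m * Q / \<sigma> - 2 * Q / w + D \<ge> 0"
  proof (cases "t < d * d")
    case True
    then show ?thesis using small 4 by linarith
  next
    case False
    have "\<sigma> \<le> 2 * s"
    proof (rule power2_le_imp_le[unfolded power2_eq_square])
      have "\<sigma> * \<sigma> \<le> 4 * (s * s)" unfolding s(2) \<sigma>(2) w using False t0 by linarith
      then show "\<sigma> * \<sigma> \<le> 2 * s * (2 * s)" by simp
    qed (use s(1) in simp)
    then have "s * \<sigma> \<le> s * (2 * s)" using s(1) by (rule mult_left_mono)
    then have "s \<le> 2 * (t / \<sigma>)" using \<sigma>(1) s(2) by (simp add: pos_le_divide_eq mult_ac)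
    then have "L * s \<le> L * (2 * (t / \<sigma>))" by (rule mult_left_mono) (use L(1) in simp)
    moreover have "0 \<le> 2 * (d * d) / w" using w0 by simp
    ultimately show ?thesis using 4 by (simp add: mult_ac)
  qed
qed

context conformal_disc
begin

lemma radial_form_bounds:
  assumes r: "0 \<le> r" "r < 1"
  obtains L m D where "L > 0" "m > 0" "D > 0"
    "\<And>z. z \<in> cball 0 r \<Longrightarrow> m * sqn z \<le> fst z * Pw1 z + snd z * Pw2 z"
    "\<And>z. z \<in> cball 0 r \<Longrightarrow> fst z * Pw1 z + snd z * Pw2 z \<le> sqn z + L * norm z * sqn z"
    "\<And>z. z \<in> cball 0 r \<Longrightarrow> Pw1_x z + Pw2_y z \<ge> 2 - L * norm z"
    "\<And>z. z \<in> cball 0 r \<Longrightarrow> \<bar>Pw1_x z + Pw2_y z\<bar> \<le> D"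
proof -
  obtain M where M: "M \<ge> 1" "\<And>z. z \<in> cball 0 r \<Longrightarrow> \<bar>e z\<bar> \<le> M \<and> \<bar>g z\<bar> \<le> M \<and> \<bar>k z\<bar> \<le> M"
    by (rule coefficient_bound[OF r(2)]) (rule that)
  obtain L1 where L1: "L1 > 0" "\<And>z. z \<in> cball 0 r \<Longrightarrow> \<bar>e z - e 0\<bar> \<le> L1 * norm z"
    by (rule C1_lipschitz_at_0[OF e r]) (rule that)
  obtain L2 where L2: "L2 > 0" "\<And>z. z \<in> cball 0 r \<Longrightarrow> \<bar>g z - g 0\<bar> \<le> L2 * norm z"
    by (rule C1_lipschitz_at_0[OF g r]) (rule that)
  obtain L3 where L3: "L3 > 0" "\<And>z. z \<in> cball 0 r \<Longrightarrow> \<bar>k z - k 0\<bar> \<le> L3 * norm z"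
    by (rule C1_lipschitz_at_0[OF k r]) (rule that)
  obtain N1 where N1: "N1 > 0" "\<And>z. z \<in> cball 0 r \<Longrightarrow> \<bar>kx z\<bar> \<le> N1"
    by (rule bounded_on_cball[OF C1_gradD(3)[OF k] r(2)]) (rule that)
  obtain N2 where N2: "N2 > 0" "\<And>z. z \<in> cball 0 r \<Longrightarrow> \<bar>ex z\<bar> \<le> N2"
    by (rule bounded_on_cball[OF C1_gradD(3)[OF e] r(2)]) (rule that)
  obtain N3 where N3: "N3 > 0" "\<And>z. z \<in> cball 0 r \<Longrightarrow> \<bar>ey z\<bar> \<le> N3"
    by (rule bounded_on_cball[OF C1_gradD(4)[OF e] r(2)]) (rule that)
  obtain N4 where N4: "N4 > 0" "\<And>z. z \<in> cball 0 r \<Longrightarrow> \<bar>gy z\<bar> \<le> N4"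
    by (rule bounded_on_cball[OF C1_gradD(4)[OF g] r(2)]) (rule that)
  define N where "N = N1 + N2 + N3 + N4"
  have N: "N > 0" using N1 N2 N3 N4 by (simp add: N_def)
  define L where "L = L1 + L2 + L3 + N"
  have L: "L > 0" using L1 L2 L3 N by (simp add: L_def)
  have rest: "\<bar>(Pw1_x z + Pw2_y z) - (k z + g z)\<bar> \<le> N * norm z" if z: "z \<in> cball 0 r" for z
  proof -
    have p: "\<bar>c * h\<bar> \<le> B * norm z" if "\<bar>c\<bar> \<le> B" "\<bar>h\<bar> \<le> norm z" for c h B
      unfolding abs_mult using that by (intro mult_mono) auto
    have "(Pw1_x z + Pw2_y z) - (k z + g z) = kx z * fst z + ex z * snd z + ey z * fst z + gy z * snd z"
      by (simp add: Pw1_x_def Pw2_y_def)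
    also have "\<bar>\<dots>\<bar> \<le> N1 * norm z + N2 * norm z + N3 * norm z + N4 * norm z"
      using p[OF N1(2)[OF z] norm_ge_fst_snd(1)] p[OF N2(2)[OF z] norm_ge_fst_snd(2)] 
        p[OF N3(2)[OF z] norm_ge_fst_snd(1)] p[OF N4(2)[OF z] norm_ge_fst_snd(2)] by linarith
    finally show ?thesis by (simp add: N_def distrib_right)
  qed
  show thesis
  proof (rule that[of L "1 / (2 * M)" "2 * M + N"])
    fix z :: "real \<times> real" assume z: "z \<in> cball 0 r"
    then have zb: "z \<in> ball 0 1" and z1: "norm z \<le> 1" using r by auto
    have Q: "fst z * Pw1 z + snd z * Pw2 z = k z * (fst z)\<^sup>2 + 2 * e z * fst z * snd z + g z * (snd z)\<^sup>2"
      by (simp add: Pw1_def Pw2_def power2_eq_square algebra_simps)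
    have S: "k z + g z \<ge> 2" using quadratic_form_ge(3)[OF det1[OF zb] k_pos[OF zb]] .
    have S2: "k z + g z \<le> 2 * M" using M(2)[OF z] by linarith
    have "1 / (2 * M) * sqn z = sqn z / (2 * M)" by simp
    also have "\<dots> \<le> sqn z / (k z + g z)" using S S2 M(1) by (intro divide_left_mono) auto
    also have "\<dots> \<le> fst z * Pw1 z + snd z * Pw2 z"
      unfolding Q sqn_def by (rule quadratic_form_ge(2)[OF det1[OF zb] k_pos[OF zb]])
    finally show "1 / (2 * M) * sqn z \<le> fst z * Pw1 z + snd z * Pw2 z" .
    show "fst z * Pw1 z + snd z * Pw2 z \<le> sqn z + L * norm z * sqn z"
    proof -
      let ?s = "norm z"
      have "k z \<le> 1 + L3 * ?s" "g z \<le> 1 + L2 * ?s" "\<bar>e z\<bar> \<le> L1 * ?s"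
        using L1(2)[OF z] L2(2)[OF z] L3(2)[OF z] unfolding at_0 by linarith+
      note b = this
      have "k z * (fst z)\<^sup>2 \<le> (1 + L3 * ?s) * (fst z)\<^sup>2" by (rule mult_right_mono[OF b(1)]) simp
      moreover have "g z * (snd z)\<^sup>2 \<le> (1 + L2 * ?s) * (snd z)\<^sup>2" by (rule mult_right_mono[OF b(2)]) simp
      moreover have "2 * e z * fst z * snd z \<le> (L1 * ?s) * sqn z"
      proof -
        have "2 * \<bar>fst z\<bar> * \<bar>snd z\<bar> \<le> sqn z"
          using zero_le_power2[of "\<bar>fst z\<bar> - \<bar>snd z\<bar>"] by (simp add: power2_diff sqn_def)
        then have "\<bar>e z\<bar> * (2 * \<bar>fst z\<bar> * \<bar>snd z\<bar>) \<le> (L1 * ?s) * sqn z"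
          using b(3) L1(1) by (intro mult_mono) auto
        moreover have "2 * e z * fst z * snd z \<le> \<bar>2 * e z * fst z * snd z\<bar>" by (rule abs_ge_self)
        ultimately show ?thesis by (simp add: abs_mult mult_ac)
      qed
      moreover have "L3 * ?s * (fst z)\<^sup>2 \<le> L3 * ?s * sqn z" "L2 * ?s * (snd z)\<^sup>2 \<le> L2 * ?s * sqn z"
        using L3(1) L2(1) by (auto intro!: mult_left_mono simp: sqn_def)
      moreover have "0 \<le> N * ?s * sqn z" using N by simp
      ultimately show ?thesis unfolding Q L_def distrib_right by (simp add: sqn_def algebra_simps)
    qed
    have "N * norm z \<le> L * norm z" using L1 L2 L3 by (intro mult_right_mono) (auto simp: L_def)
    then show "Pw1_x z + Pw2_y z \<ge> 2 - L * norm z" using rest[OF z] S by linarith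
    have "N * norm z \<le> N * 1" using N z1 by (intro mult_left_mono) auto
    then show "\<bar>Pw1_x z + Pw2_y z\<bar> \<le> 2 * M + N" using rest[OF z] S S2 by linarith
  qed (use L M(1) N in auto)
qed

lemma flux_density_integrable:
  assumes f: "\<And>t. t \<ge> 0 \<Longrightarrow> (f has_real_derivative f' t) (at t)" "continuous_on {0..} f'"
    and f0: "\<And>t. t \<ge> r\<^sup>2 \<Longrightarrow> f t = 0 \<and> f' t = 0" and r: "0 \<le> r" "r < 1"
  shows "continuous_on (ball 0 1) h \<Longrightarrow> (\<lambda>z. h z * flux_density f f' z) integrable_on square"
    and "integral square (flux_density f f') = 0"
proof -
  have q: "cutoff r (\<lambda>z. f (sqn z)) (\<lambda>z. f' (sqn z) * (2 * fst z)) (\<lambda>z. f' (sqn z) * (2 * snd z))"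
    by (rule cutoff_radial[OF f f0 r(1)]) auto
  have cf': "continuous_on UNIV (\<lambda>z. f' (sqn z))"
    by (rule continuous_on_compose2[OF f(2)]) (auto intro!: continuous_intros)
  have f'0: "f' (sqn z) = 0" if "r < norm z" for z
    using that r by (intro conjunct2[OF f0]) (simp add: sqn_eq power_mono)
  show "(\<lambda>z. h z * flux_density f f' z) integrable_on square" if h: "continuous_on (ball 0 1) h"
  proof -
    have "(\<lambda>z. f' (sqn z) * (4 * h z * (fst z * Pw1 z + snd z * Pw2 z)) + f (sqn z) * (2 * h z * (Pw1_x z + Pw2_y z))) integrable_on square"
    proof (rule integrable_add)
      show "(\<lambda>z. f' (sqn z) * (4 * h z * (fst z * Pw1 z + snd z * Pw2 z))) integrable_on square"
        by (rule integrable_cutoff[OF cf' f'0 r(2)])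
          (intro continuous_intros h C1_gradD(2)[OF C1_Pw1] C1_gradD(2)[OF C1_Pw2] | assumption)+
      show "(\<lambda>z. f (sqn z) * (2 * h z * (Pw1_x z + Pw2_y z))) integrable_on square"
        by (rule integrable_cutoff[OF cutoffD(1)[OF q] cutoffD(4)[OF q] r(2)])
          (intro continuous_intros h C1_gradD(3)[OF C1_Pw1] C1_gradD(4)[OF C1_Pw2] | assumption)+
    qed
    moreover have "(\<lambda>z. h z * flux_density f f' z) = (\<lambda>z. f' (sqn z) * (4 * h z * (fst z * Pw1 z + snd z * Pw2 z)) + f (sqn z) * (2 * h z * (Pw1_x z + Pw2_y z)))"
      by (rule ext) (simp add: flux_density_def algebra_simps)
    ultimately show ?thesis by (simp only:)
  qed
  note c1 = cutoff_mult[OF q r(2) C1_Pw1] and c2 = cutoff_mult[OF q r(2) C1_Pw2]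
  let ?X = "\<lambda>z. f' (sqn z) * (2 * fst z) * Pw1 z + f (sqn z) * Pw1_x z"
  let ?Y = "\<lambda>z. f' (sqn z) * (2 * snd z) * Pw2 z + f (sqn z) * Pw2_y z"
  have i: "?X integrable_on square" "?Y integrable_on square"
    using cutoffD(2)[OF c1] cutoffD(3)[OF c2] by (auto intro!: integrable_continuous intro: continuous_on_subset)
  have "flux_density f f' = (\<lambda>z. 2 * (?X z + ?Y z))"
    by (rule ext) (simp add: flux_density_def algebra_simps)
  then have "integral square (flux_density f f') = 2 * (integral square ?X + integral square ?Y)"
    by (simp only: integral_mult_right integral_add[OF i])
  then show "integral square (flux_density f f') = 0"
    using integral_partial_eq_0(1)[OF c1 r(2)] integral_partial_eq_0(2)[OF c2 r(2)] by simp
qed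

end

lemma bump_flux_factor:
  fixes b l s w Q D :: real
  shows "2 * (2 * (b * (l / (2 * s) - 1 / w) * 1 + b * 0) * Q + b * 1 * D) = 2 * b * (l * Q / s - 2 * Q / w + D)"
proof -
  define u v where "u = 1 / s" and "v = 1 / w"
  have e: "l / (2 * s) = l * u / 2" "1 / w = v" "l * Q / s = l * Q * u" "2 * Q / w = 2 * Q * v"
    by (simp_all add: u_def v_def)
  show ?thesis unfolding e by (simp add: algebra_simps)
qed

context conformal_disc
begin

text \<open>
  The regularised logarithm with a cutoff. It is superharmonic where the cutoff function is one, with a flux density of
  at least \<open>1 / (2 d\<^sup>2)\<close> within distance \<open>d\<close> of the origin, and the bounds on the annulus and on the integral
  of the gradient hold uniformly in \<open>d\<close>.
\<close>

lemma profile_estimates: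
  assumes r: "0 < r1" "r1 < r2" "r2 < 1"
    and Z: "\<And>t. (Z has_real_derivative Z1 t) (at t)" "\<And>t. (Z1 has_real_derivative Z2 t) (at t)" "continuous_on UNIV Z2"
      "\<And>t. t \<le> r1\<^sup>2 \<Longrightarrow> Z t = 1 \<and> Z1 t = 0 \<and> Z2 t = 0" "\<And>t. t \<ge> r2\<^sup>2 \<Longrightarrow> Z t = 0 \<and> Z1 t = 0 \<and> Z2 t = 0"
      "\<And>t. 0 \<le> Z t" "\<And>t. Z t \<le> 1"
  obtains lam d0 C where "d0 > 0" "d0 \<le> 1" "C \<ge> 0"
    "\<And>d z. 0 < d \<Longrightarrow> d \<le> d0 \<Longrightarrow> sqn z \<le> r1\<^sup>2 \<Longrightarrow> 
       flux_density (\<lambda>t. bump_log lam d t * Z t) (\<lambda>t. bump_log' lam d t * Z t + bump_log lam d t * Z1 t) z \<ge> 0"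
    "\<And>d z. 0 < d \<Longrightarrow> d \<le> d0 \<Longrightarrow> sqn z \<le> r1\<^sup>2 \<Longrightarrow> sqn z < d * d \<Longrightarrow> 
       flux_density (\<lambda>t. bump_log lam d t * Z t) (\<lambda>t. bump_log' lam d t * Z t + bump_log lam d t * Z1 t) z \<ge> 1 / (2 * (d * d))"
    "\<And>d z. 0 < d \<Longrightarrow> d \<le> d0 \<Longrightarrow> r1\<^sup>2 \<le> sqn z \<Longrightarrow> sqn z \<le> r2\<^sup>2 \<Longrightarrow>
       \<bar>flux_density (\<lambda>t. bump_log lam d t * Z t) (\<lambda>t. bump_log' lam d t * Z t + bump_log lam d t * Z1 t) z\<bar> \<le> C"
    "\<And>d. 0 < d \<Longrightarrow> d \<le> d0 \<Longrightarrow> integral square (\<lambda>z. bump_log lam d (sqn z) * Z (sqn z) * norm z) \<le> C"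
proof -
  have r': "0 \<le> r1" "0 \<le> r2" using r by linarith+
  obtain L m D where LmD: "L > 0" "m > 0" "D > 0"
    "\<And>z. z \<in> cball 0 r2 \<Longrightarrow> m * sqn z \<le> fst z * Pw1 z + snd z * Pw2 z"
    "\<And>z. z \<in> cball 0 r2 \<Longrightarrow> fst z * Pw1 z + snd z * Pw2 z \<le> sqn z + L * norm z * sqn z"
    "\<And>z. z \<in> cball 0 r2 \<Longrightarrow> Pw1_x z + Pw2_y z \<ge> 2 - L * norm z"
    "\<And>z. z \<in> cball 0 r2 \<Longrightarrow> \<bar>Pw1_x z + Pw2_y z\<bar> \<le> D"
    by (rule radial_form_bounds[OF r'(2) r(3)]) (rule that)
  obtain CI where CI: "CI \<ge> 0" "\<And>d. d > 0 \<Longrightarrow> integral square (\<lambda>z. Z (sqn z) / sqrt (sqn z + d\<^sup>2)) \<le> CI"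
    by (rule integral_inverse_radius_bound[OF r'(1) r(2,3) Z(1,2) _ Z(6)]) (use Z(5) that in blast)+
  have cZ1: "continuous_on UNIV Z1" by (rule DERIV_continuous_on[where D=Z2]) (rule has_field_derivative_at_within[OF Z(2)])
  have cZ: "continuous_on UNIV Z" by (rule DERIV_continuous_on[where D=Z1]) (rule has_field_derivative_at_within[OF Z(1)])
  have cZs: "continuous_on A (\<lambda>z. Z (sqn z))" for A
    by (intro continuous_intros continuous_on_compose2[OF cZ]) simp
  have "bounded (Z1 ` {0..1})"
    by (intro compact_imp_bounded compact_continuous_image continuous_on_subset[OF cZ1]) auto
  then obtain B where B: "B > 0" "\<And>t. 0 \<le> t \<Longrightarrow> t \<le> 1 \<Longrightarrow> \<bar>Z1 t\<bar> \<le> B"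
    unfolding bounded_pos by auto
  \<comment> \<open>The value for which the margin absorbs the deviation \<open>L s\<close> of the coefficients from the standard ones in
    \<open>bump_bracket\<close>.\<close>
  define lam where "lam = 4 * L / m"
  have lam: "lam > 0" using LmD by (simp add: lam_def)
  define d0 where "d0 = min 1 (1 / (2 * L))"
  have d0: "d0 > 0" "d0 \<le> 1" "L * d0 \<le> 1/2" using LmD(1) by (auto simp: d0_def min_def field_simps)
  define P where "P = exp (2 * lam) / r1\<^sup>2"
  have P: "P > 0" using r by (simp add: P_def)
  define P' where "P' = P * (lam / (2 * r1) + 1 / r1\<^sup>2)"
  have P': "P' > 0" unfolding P'_def using P lam r(1) by (intro mult_pos_pos add_pos_pos) auto
  define C1 where "C1 = 2 * (2 * (P' * 1 + P * B) * (2 + L) + P * 1 * D)"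
  have C1: "C1 \<ge> 0" using P P' B(1) LmD by (simp add: C1_def)
  show thesis
  proof (rule that[of d0 "C1 + exp (2 * lam) * CI" lam])
    show "0 \<le> C1 + exp (2 * lam) * CI" using C1 CI(1) by simp
    fix d :: real assume d: "0 < d" "d \<le> d0"
    have "L * d \<le> L * d0" using d LmD(1) by simp
    then have Ld: "L * d \<le> 1 / 2" using d0 by linarith
    have d1: "d \<le> 1" using d d0 by linarith
    define w where "w z = sqn z + d\<^sup>2" for z
    define \<sigma> where "\<sigma> z = sqrt (w z)" for z
    have w0: "w z > 0" for z using d(1) add_nonneg_pos[OF sqn_ge_0, of "d\<^sup>2" z] by (simp add: w_def)
    have \<sigma>0: "\<sigma> z > 0" for z using w0[of z] by (simp add: \<sigma>_def)
    have \<sigma>2: "\<sigma> z * \<sigma> z = w z" for z using w0[of z] by (simp add: \<sigma>_def)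
    have s2: "norm z * norm z = sqn z" for z :: "real \<times> real" by (simp add: sqn_eq power2_eq_square)
    have b: "bump_log lam d (sqn z) = exp (lam * \<sigma> z) / w z" for z by (simp add: bump_log_def \<sigma>_def w_def)
    have b': "bump_log' lam d (sqn z) = bump_log lam d (sqn z) * (lam / (2 * \<sigma> z) - 1 / w z)" for z 
      by (simp add: bump_log'_def \<sigma>_def w_def)
    have b_pos: "bump_log lam d (sqn z) > 0" for z using w0[of z] by (simp add: b)
    let ?F = "flux_density (\<lambda>t. bump_log lam d t * Z t) (\<lambda>t. bump_log' lam d t * Z t + bump_log lam d t * Z1 t)"
    have inner: "?F z = 2 * bump_log lam d (sqn z) * (4 * L / m * (fst z * Pw1 z + snd z * Pw2 z) / \<sigma> z - 2 * (fst z * Pw1 z + snd z * Pw2 z) / w z + (Pw1_x z + Pw2_y z))"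
      if "sqn z \<le> r1\<^sup>2" for z
    proof -
      have "Z (sqn z) = 1" "Z1 (sqn z) = 0" using Z(4)[OF that] by auto
      then show ?thesis unfolding flux_density_def b' lam_def[symmetric] by (simp only: bump_flux_factor)
    qed
    have cb: "z \<in> cball 0 r2" if "sqn z \<le> r2\<^sup>2" for z
      using that r'(2) by (simp add: sqn_eq abs_le_square_iff[symmetric])
    have r12: "r1\<^sup>2 \<le> r2\<^sup>2" using r by (intro power_mono) auto
    note br = bump_bracket[OF norm_ge_zero s2 _ \<sigma>0 \<sigma>2 d(1) Ld LmD(1,2)]
    have ww: "w z = sqn z + d * d" for z by (simp add: w_def power2_eq_square)
    show "?F z \<ge> 0" if "sqn z \<le> r1\<^sup>2" for z
      unfolding inner[OF that]
      using br(1)[OF ww LmD(4,5,6), OF cb cb cb] that r12 b_pos[of z] by (intro mult_nonneg_nonneg) auto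
    show "?F z \<ge> 1 / (2 * (d * d))" if "sqn z \<le> r1\<^sup>2" "sqn z < d * d" for z
    proof -
      let ?K = "4 * L / m * (fst z * Pw1 z + snd z * Pw2 z) / \<sigma> z - 2 * (fst z * Pw1 z + snd z * Pw2 z) / w z + (Pw1_x z + Pw2_y z)"
      have K: "?K \<ge> 1/2"
        using br(2)[OF ww LmD(4,5,6), OF cb cb cb] that r12 by auto
      have "1 / (2 * (d * d)) \<le> 1 / w z" using that(2) w0[of z] ww[of z] by (intro divide_left_mono) auto
      also have "\<dots> \<le> bump_log lam d (sqn z)" unfolding b
        using w0[of z] lam \<sigma>0[of z] by (intro divide_right_mono) auto
      also have "\<dots> = 2 * bump_log lam d (sqn z) * (1/2)" by simp
      also have "\<dots> \<le> 2 * bump_log lam d (sqn z) * ?K" using K b_pos[of z] by (intro mult_left_mono) auto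
      finally show ?thesis unfolding inner[OF that(1)] .
    qed
    have \<sigma>_le: "\<sigma> z \<le> 2" if "sqn z \<le> 1" for z
    proof -
      have "d\<^sup>2 \<le> 1" using d(1) d1 by (simp add: power_le_one)
      then have "w z \<le> 2\<^sup>2" using that by (simp add: w_def)
      then show ?thesis unfolding \<sigma>_def by (intro real_le_lsqrt) auto
    qed
    show "\<bar>?F z\<bar> \<le> C1 + exp (2 * lam) * CI" if z: "r1\<^sup>2 \<le> sqn z" "sqn z \<le> r2\<^sup>2" for z
    proof -
      have r21: "r2\<^sup>2 \<le> 1" using r by (simp add: power_le_one)
      have q1: "sqn z \<le> 1" using z r21 by linarith
      have w1: "r1\<^sup>2 \<le> w z" using z(1) zero_le_power2[of d] unfolding w_def by linarith
      have \<sigma>1: "r1 \<le> \<sigma> z" unfolding \<sigma>_def using w1 by (rule real_le_rsqrt)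
      have bP: "\<bar>bump_log lam d (sqn z)\<bar> \<le> P"
      proof -
        have "lam * \<sigma> z \<le> lam * 2" using \<sigma>_le[OF q1] lam by simp
        then have "exp (lam * \<sigma> z) / w z \<le> exp (2 * lam) / r1\<^sup>2"
          using w1 r(1) by (intro frac_le) auto
        then show ?thesis using b_pos[of z] by (simp add: b P_def)
      qed
      have b'P: "\<bar>bump_log' lam d (sqn z)\<bar> \<le> P'"
      proof -
        have 1: "lam / (2 * \<sigma> z) \<le> lam / (2 * r1)" "1 / w z \<le> 1 / r1\<^sup>2"
          using \<sigma>1 w1 r(1) lam by (auto intro!: divide_left_mono mult_pos_pos \<sigma>0 w0)
        have 2: "0 \<le> lam / (2 * \<sigma> z)" "0 \<le> 1 / w z" using lam \<sigma>0[of z] w0[of z] by auto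
        have "\<bar>lam / (2 * \<sigma> z) - 1 / w z\<bar> \<le> lam / (2 * r1) + 1 / r1\<^sup>2" using 1 2 by linarith
        then show ?thesis unfolding b' abs_mult P'_def using bP P by (intro mult_mono) auto
      qed
      have ZZ: "\<bar>Z (sqn z)\<bar> \<le> 1" "\<bar>Z1 (sqn z)\<bar> \<le> B" using Z(6,7)[of "sqn z"] B(2)[OF sqn_ge_0 q1] by auto
      let ?Q = "fst z * Pw1 z + snd z * Pw2 z"
      have Q: "\<bar>?Q\<bar> \<le> 2 + L"
      proof -
        have zc: "z \<in> cball 0 r2" by (rule cb[OF z(2)])
        have n1: "norm z \<le> 1" using zc r by auto
        have "L * norm z * sqn z \<le> L * 1 * 1" using n1 q1 LmD(1) by (intro mult_mono) auto
        moreover have "0 \<le> m * sqn z" using LmD(2) by simp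
        ultimately show ?thesis using LmD(4,5)[OF zc] q1 by linarith
      qed
      have T1: "\<bar>bump_log' lam d (sqn z) * Z (sqn z) + bump_log lam d (sqn z) * Z1 (sqn z)\<bar> \<le> P' * 1 + P * B"
      proof -
        have "\<bar>bump_log' lam d (sqn z) * Z (sqn z)\<bar> \<le> P' * 1" unfolding abs_mult using b'P ZZ(1) P' by (intro mult_mono) auto
        moreover have "\<bar>bump_log lam d (sqn z) * Z1 (sqn z)\<bar> \<le> P * B" unfolding abs_mult using bP ZZ(2) P by (intro mult_mono) auto
        ultimately show ?thesis by linarith
      qed
      have T2: "\<bar>(bump_log' lam d (sqn z) * Z (sqn z) + bump_log lam d (sqn z) * Z1 (sqn z)) * ?Q\<bar> \<le> (P' * 1 + P * B) * (2 + L)"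
        unfolding abs_mult by (rule mult_mono[OF T1 Q]) (use P P' B(1) in auto)
      have T3: "\<bar>bump_log lam d (sqn z) * Z (sqn z) * (Pw1_x z + Pw2_y z)\<bar> \<le> P * 1 * D"
        unfolding abs_mult by (rule mult_mono[OF mult_mono[OF bP ZZ(1)] LmD(7)[OF cb[OF z(2)]]]) (use P in auto)
      have "?F z = 2 * (2 * ((bump_log' lam d (sqn z) * Z (sqn z) + bump_log lam d (sqn z) * Z1 (sqn z)) * ?Q)
          + bump_log lam d (sqn z) * Z (sqn z) * (Pw1_x z + Pw2_y z))" by (simp add: flux_density_def mult.assoc)
      also have "\<bar>\<dots>\<bar> \<le> 2 * (2 * ((P' * 1 + P * B) * (2 + L)) + P * 1 * D)"
      proof -
        have gen: "\<bar>2 * (2 * x + y)\<bar> \<le> 2 * (2 * A + B)" if "\<bar>x\<bar> \<le> A" "\<bar>y\<bar> \<le> B" for x y A B :: real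
          using that unfolding abs_le_iff by simp
        show ?thesis by (rule gen[OF T2 T3])
      qed
      also have "\<dots> = C1" by (simp add: C1_def mult.assoc)
      also have "\<dots> \<le> C1 + exp (2 * lam) * CI" using CI(1) by simp
      finally show ?thesis .
    qed
    show "integral square (\<lambda>z. bump_log lam d (sqn z) * Z (sqn z) * norm z) \<le> C1 + exp (2 * lam) * CI"
    proof -
      have c\<sigma>: "continuous_on square \<sigma>" "continuous_on square w" unfolding \<sigma>_def w_def by (intro continuous_intros)+
      have nz: "\<forall>z\<in>square. w z \<noteq> 0" "\<forall>z\<in>square. \<sigma> z \<noteq> 0" using w0 \<sigma>0 by (metis less_irrefl)+
      have "integral square (\<lambda>z. bump_log lam d (sqn z) * Z (sqn z) * norm z) \<le> integral square (\<lambda>z. exp (2 * lam) * (Z (sqn z) / \<sigma> z))"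
      proof (rule integral_le)
        show "(\<lambda>z. bump_log lam d (sqn z) * Z (sqn z) * norm z) integrable_on square"
          unfolding b using nz c\<sigma> by (intro integrable_continuous continuous_intros cZs)
        show "(\<lambda>z. exp (2 * lam) * (Z (sqn z) / \<sigma> z)) integrable_on square"
          using nz c\<sigma> by (intro integrable_continuous continuous_intros cZs)
        fix z :: "real \<times> real"
        show "bump_log lam d (sqn z) * Z (sqn z) * norm z \<le> exp (2 * lam) * (Z (sqn z) / \<sigma> z)"
        proof (cases "sqn z \<le> 1")
          case False
          have "r2\<^sup>2 \<le> 1" using r by (simp add: power_le_one)
          then have "Z (sqn z) = 0" using False Z(5)[of "sqn z"] by auto
          then show ?thesis by simp
        next
          case True
          have "norm z * norm z \<le> \<sigma> z * \<sigma> z" unfolding s2 \<sigma>2 w_def by simp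
          then have n: "norm z \<le> \<sigma> z" by (rule power2_le_imp_le[unfolded power2_eq_square]) (use \<sigma>0[of z] in simp)
          have "norm z / w z \<le> \<sigma> z / w z" using n w0[of z] by (intro divide_right_mono) auto
          also have "\<dots> = 1 / \<sigma> z" unfolding \<sigma>2[symmetric] using \<sigma>0[of z] by simp
          finally have "norm z / w z \<le> 1 / \<sigma> z" .
          moreover have "exp (lam * \<sigma> z) \<le> exp (2 * lam)" using \<sigma>_le[OF True] lam by (simp add: mult.commute)
          ultimately have "exp (lam * \<sigma> z) * (norm z / w z) \<le> exp (2 * lam) * (1 / \<sigma> z)"
            using w0[of z] by (intro mult_mono) auto
          then have "Z (sqn z) * (exp (lam * \<sigma> z) * (norm z / w z)) \<le> Z (sqn z) * (exp (2 * lam) * (1 / \<sigma> z))"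
            by (rule mult_left_mono[OF _ Z(6)])
          then show ?thesis by (simp add: b mult_ac)
        qed
      qed
      also have "\<dots> = exp (2 * lam) * integral square (\<lambda>z. Z (sqn z) / sqrt (sqn z + d\<^sup>2))"
        unfolding \<sigma>_def w_def by (rule integral_mult_right)
      also have "\<dots> \<le> exp (2 * lam) * CI" using CI(2)[OF d(1)] by simp
      finally show ?thesis using C1 by simp
    qed
  qed (use d0 in auto)
qed

end

section \<open>Almost holomorphic maps of the disc have no excess zeros\<close>

context conformal_disc
begin

text \<open>
  Let \<open>A\<close> and \<open>A0\<close> be the regularised logarithms of \<open>|h|\<close> and \<open>|w|\<close>, and let \<open>\<kappa>\<close> be the flux density of the test
  function. The difference of the two flux identities bounds the integral of \<open>(A0 - A) \<kappa>\<close> from above by a constant that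
  does not depend on \<open>d\<close>. Since \<open>h\<close> is Lipschitz and vanishes at the origin, \<open>A0 - A\<close> is bounded below, so the
  contribution of each region is bounded below. Since \<open>h = o(|w|)\<close>, the
  contribution of a small square of side \<open>d / 4\<close> near the origin, on which the integral of \<open>\<kappa>\<close> is bounded below, is
  arbitrarily large.
\<close>

theorem no_degenerate_zero:
  assumes sol: "almost_solution a ax ay b bx by"
    and r0: "0 \<le> r0" "r0 < 1"
    and l: "continuous_on {z. r0 < norm z \<and> norm z < 1} l"
    and eq: "\<And>z. r0 < norm z \<Longrightarrow> norm z < 1 \<Longrightarrow> Complex (a z) (b z) = Complex (fst z) (snd z) * exp (l z)"
    and zero: "a 0 = 0" "b 0 = 0" "ax 0 = 0" "ay 0 = 0" "bx 0 = 0" "by 0 = 0"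
  shows False
proof -
  have a: "C1_grad (ball 0 1) a ax ay" and b: "C1_grad (ball 0 1) b bx by"
    using sol by (auto simp: almost_solution_def)
  obtain r1 where r1: "r0 < r1" "r1 < 1" using r0(2) dense by blast
  obtain r2 where r2: "r1 < r2" "r2 < 1" using r1(2) dense by blast
  have pos: "0 < r1" "0 \<le> r1" "0 \<le> r2" using r0 r1 r2 by linarith+
  have r12: "r1\<^sup>2 < r2\<^sup>2" "r2\<^sup>2 < 1" using pos r1 r2 by (auto intro!: power_strict_mono simp: power_less_one_iff)
  obtain Z Z1 Z2 where Z: "\<And>t. (Z has_real_derivative Z1 t) (at t)" "\<And>t. (Z1 has_real_derivative Z2 t) (at t)"
    "continuous_on UNIV Z2" "\<And>t. t \<le> r1\<^sup>2 \<Longrightarrow> Z t = 1 \<and> Z1 t = 0 \<and> Z2 t = 0" "\<And>t. t \<ge> r2\<^sup>2 \<Longrightarrow> Z t = 0 \<and> Z1 t = 0 \<and> Z2 t = 0"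
    "\<And>t. 0 \<le> Z t" "\<And>t. Z t \<le> 1"
    by (rule C2_step_function[OF r12(1)]) (rule that)
  have cZ1: "continuous_on UNIV Z1" by (rule DERIV_continuous_on[where D=Z2]) (rule has_field_derivative_at_within[OF Z(2)])
  have cZ: "continuous_on UNIV Z" by (rule DERIV_continuous_on[where D=Z1]) (rule has_field_derivative_at_within[OF Z(1)])
  obtain lam d0 CP where prof: "d0 > 0" "d0 \<le> 1" "CP \<ge> 0"
    "\<And>d z. 0 < d \<Longrightarrow> d \<le> d0 \<Longrightarrow> sqn z \<le> r1\<^sup>2 \<Longrightarrow> 
       flux_density (\<lambda>t. bump_log lam d t * Z t) (\<lambda>t. bump_log' lam d t * Z t + bump_log lam d t * Z1 t) z \<ge> 0"
    "\<And>d z. 0 < d \<Longrightarrow> d \<le> d0 \<Longrightarrow> sqn z \<le> r1\<^sup>2 \<Longrightarrow> sqn z < d * d \<Longrightarrow> 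
       flux_density (\<lambda>t. bump_log lam d t * Z t) (\<lambda>t. bump_log' lam d t * Z t + bump_log lam d t * Z1 t) z \<ge> 1 / (2 * (d * d))"
    "\<And>d z. 0 < d \<Longrightarrow> d \<le> d0 \<Longrightarrow> r1\<^sup>2 \<le> sqn z \<Longrightarrow> sqn z \<le> r2\<^sup>2 \<Longrightarrow>
       \<bar>flux_density (\<lambda>t. bump_log lam d t * Z t) (\<lambda>t. bump_log' lam d t * Z t + bump_log lam d t * Z1 t) z\<bar> \<le> CP"
    "\<And>d. 0 < d \<Longrightarrow> d \<le> d0 \<Longrightarrow> integral square (\<lambda>z. bump_log lam d (sqn z) * Z (sqn z) * norm z) \<le> CP"
    by (rule profile_estimates[OF pos(1) r2 Z]) (assumption | rule that)+
  let ?m = "\<lambda>n. mass_density (eps n) a ax ay b bx by"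
  let ?mI = "\<lambda>n. mass_density (eps n) fst (\<lambda>_. 1) (\<lambda>_. 0) snd (\<lambda>_. 0) (\<lambda>_. 1)"
  obtain Ca where Ca: "Ca \<ge> 0" "\<And>\<epsilon> f f' \<Phi>. \<epsilon> > 0 \<Longrightarrow> radial_profile r2 f f' \<Phi> \<Longrightarrow>
     \<bar>integral square (\<lambda>z. ln ((a z)\<^sup>2 + (b z)\<^sup>2 + \<epsilon>\<^sup>2) / 2 * flux_density f f' z +
         \<Phi> (sqn z) * mass_density \<epsilon> a ax ay b bx by z)\<bar> \<le> Ca * integral square (\<lambda>z. f (sqn z) * norm z)"
    by (rule flux_identity[OF sol pos(3) r2(2)]) (rule that)
  obtain Ci where Ci: "Ci \<ge> 0" "\<And>\<epsilon> f f' \<Phi>. \<epsilon> > 0 \<Longrightarrow> radial_profile r2 f f' \<Phi> \<Longrightarrow>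
     \<bar>integral square (\<lambda>z. ln ((fst z)\<^sup>2 + (snd z)\<^sup>2 + \<epsilon>\<^sup>2) / 2 * flux_density f f' z +
         \<Phi> (sqn z) * mass_density \<epsilon> fst (\<lambda>_. 1) (\<lambda>_. 0) snd (\<lambda>_. 0) (\<lambda>_. 1) z)\<bar> \<le> Ci * integral square (\<lambda>z. f (sqn z) * norm z)"
    by (rule flux_identity[OF identity_almost_solution pos(3) r2(2)]) (rule that)
  define n where "n z = (a z)\<^sup>2 + (b z)\<^sup>2" for z
  have n_ge: "n z \<ge> 0" for z by (simp add: n_def)
  obtain La where La: "La > 0" "\<And>z. z \<in> cball 0 r2 \<Longrightarrow> \<bar>a z - a 0\<bar> \<le> La * norm z"
    by (rule C1_lipschitz_at_0[OF a pos(3) r2(2)]) (rule that)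
  obtain Lb where Lb: "Lb > 0" "\<And>z. z \<in> cball 0 r2 \<Longrightarrow> \<bar>b z - b 0\<bar> \<le> Lb * norm z"
    by (rule C1_lipschitz_at_0[OF b pos(3) r2(2)]) (rule that)
  define H where "H = 1 + La\<^sup>2 + Lb\<^sup>2"
  have H1: "H \<ge> 1" by (simp add: H_def)
  have nH: "n z \<le> H * sqn z" if z: "z \<in> cball 0 r2" for z
  proof -
    have "(a z)\<^sup>2 \<le> (La * norm z)\<^sup>2" "(b z)\<^sup>2 \<le> (Lb * norm z)\<^sup>2"
      using power_mono[OF La(2)[OF z], of 2] power_mono[OF Lb(2)[OF z], of 2] zero by simp_all
    then have "n z \<le> La\<^sup>2 * sqn z + Lb\<^sup>2 * sqn z" unfolding n_def sqn_eq by (simp add: power_mult_distrib)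
    also have "\<dots> \<le> H * sqn z" by (simp add: H_def distrib_right)
    finally show ?thesis .
  qed
  obtain c0 where c0: "c0 > 0" "c0 \<le> 1" "\<And>z. r1 \<le> norm z \<Longrightarrow> norm z \<le> r2 \<Longrightarrow> n z \<ge> c0"
  proof -
    let ?K = "{z::real\<times>real. r1 \<le> norm z \<and> norm z \<le> r2}"
    have "?K = cball 0 r2 - ball 0 r1" by auto
    then have "compact ?K" using compact_diff[of "cball (0::real\<times>real) r2" "ball 0 r1"] by simp
    moreover have "(r1, 0) \<in> ?K" using pos r2 by simp
    moreover have "continuous_on ?K n"
    proof -
      have "?K \<subseteq> ball 0 1" using r2 by auto
      then show ?thesis unfolding n_def using continuous_on_subset[OF C1_gradD(2)[OF a]] continuous_on_subset[OF C1_gradD(2)[OF b]]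
        by (intro continuous_intros) auto
    qed
    ultimately obtain z0 where z0: "z0 \<in> ?K" "\<And>z. z \<in> ?K \<Longrightarrow> n z0 \<le> n z"
      using continuous_attains_inf[of ?K n] by blast
    have "n z0 \<noteq> 0"
    proof
      assume "n z0 = 0"
      then have ab0: "a z0 = 0" "b z0 = 0" by (auto simp: n_def sum_power2_eq_zero_iff)
      have "Complex (a z0) (b z0) = Complex (fst z0) (snd z0) * exp (l z0)"
        using z0(1) r1 r2 by (intro eq) auto
      moreover have "Complex (a z0) (b z0) = 0" using ab0 by (simp add: complex_eq_iff)
      ultimately have "Complex (fst z0) (snd z0) * exp (l z0) = 0" by (simp only:)
      then have "Complex (fst z0) (snd z0) = 0" by (simp only: mult_eq_0_iff exp_not_eq_zero simp_thms)
      then have "z0 = 0" by (cases z0) (simp add: complex_eq_iff zero_prod_def)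
      then show False using z0(1) pos by simp
    qed
    then have "n z0 > 0" using n_ge[of z0] by linarith
    show thesis
    proof (rule that[of "min 1 (n z0)"])
      show "min 1 (n z0) > 0" using \<open>n z0 > 0\<close> by simp
      fix z :: "real \<times> real" assume "r1 \<le> norm z" "norm z \<le> r2"
      then have "n z0 \<le> n z" by (intro z0(2)) simp
      then show "min 1 (n z0) \<le> n z" by linarith
    qed simp
  qed
  \<comment> \<open>\<open>CB\<close> bounds \<open>A - A0\<close> from above, and \<open>C4\<close> bounds \<open>A0 - A\<close> from above on the annulus on which the cutoff
    function of the profile varies and the sign of \<open>\<kappa>\<close> is unknown.\<close>
  define CB where "CB = ln H / 2"
  define C4 where "C4 = ln (2 / c0) / 2"
  have CB0: "CB \<ge> 0" using H1 by (simp add: CB_def)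
  have C40: "C4 \<ge> 0" using c0 by (simp add: C4_def)
  define C5 where "C5 = (CB + C4) * CP"
  have C50: "C5 \<ge> 0" using CB0 C40 prof(3) by (simp add: C5_def)
  define K where "K = 1 + (Ca + Ci) * CP + 4 * C5"
  have K0: "K \<ge> 0" using Ca(1) Ci(1) prof(3) C50 by (simp add: K_def)
  \<comment> \<open>\<open>K\<close> is going to be an upper bound for the integral of \<open>F\<close>. The choice of \<open>\<eta>\<close> makes \<open>A0 - A \<ge> - ln (2 \<eta>) / 2 = 32 (K + 1)\<close> on
    the square \<open>?Q\<close>, whose area is \<open>d\<^sup>2 / 16\<close> and on which \<open>\<kappa> \<ge> 1 / (2 d\<^sup>2)\<close>.\<close>
  define \<eta> where "\<eta> = exp (- 64 * K - 64) / 2"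
  have "exp (- 64 * K - 64) \<le> 1" using K0 by simp
  moreover have "0 < exp (- 64 * K - 64)" by simp
  ultimately have \<eta>: "\<eta> > 0" "\<eta> \<le> 1" unfolding \<eta>_def by linarith+
  have "sqrt (\<eta>/2) > 0" using \<eta> by simp
  obtain da where da: "da > 0" "\<And>z. norm z < da \<Longrightarrow> \<bar>a z\<bar> \<le> sqrt (\<eta>/2) * norm z"
    by (rule C1_little_o_at_0[OF a zero(1,3,4) \<open>sqrt (\<eta>/2) > 0\<close>]) (rule that)
  obtain db where db: "db > 0" "\<And>z. norm z < db \<Longrightarrow> \<bar>b z\<bar> \<le> sqrt (\<eta>/2) * norm z"
    by (rule C1_little_o_at_0[OF b zero(2,5,6) \<open>sqrt (\<eta>/2) > 0\<close>]) (rule that)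
  have n\<eta>: "n z \<le> \<eta> * sqn z" if "norm z < min da db" for z
  proof -
    have "(a z)\<^sup>2 \<le> (sqrt (\<eta>/2) * norm z)\<^sup>2" "(b z)\<^sup>2 \<le> (sqrt (\<eta>/2) * norm z)\<^sup>2"
      using power_mono[OF da(2)[of z], of 2] power_mono[OF db(2)[of z], of 2] that by simp_all
    moreover have "(sqrt (\<eta>/2) * norm z)\<^sup>2 = \<eta>/2 * sqn z" using \<eta>(1) by (simp add: power_mult_distrib sqn_eq)
    ultimately show ?thesis by (simp add: n_def)
  qed
  define d where "d = min (min d0 r1) (min da db)"
  have d: "0 < d" "d \<le> d0" "d \<le> r1" "d \<le> min da db" using prof(1) pos da(1) db(1) by (auto simp: d_def)
  have d2: "d * d > 0" using d(1) by simp
  define f where "f t = bump_log lam d t * Z t" for t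
  define f' where "f' t = bump_log' lam d t * Z t + bump_log lam d t * Z1 t" for t
  define \<kappa> where "\<kappa> = flux_density f f'"
  have fun_f: "(\<lambda>t. bump_log lam d t * Z t) = f" "(\<lambda>t. bump_log' lam d t * Z t + bump_log lam d t * Z1 t) = f'"
    by (auto simp: f_def f'_def)
  have \<kappa>1: "\<kappa> z \<ge> 0" if "sqn z \<le> r1\<^sup>2" for z using prof(4)[OF d(1,2) that] unfolding fun_f \<kappa>_def .
  have \<kappa>2: "\<kappa> z \<ge> 1 / (2 * (d * d))" if "sqn z \<le> r1\<^sup>2" "sqn z < d * d" for z
    using prof(5)[OF d(1,2) that] unfolding fun_f \<kappa>_def .
  have \<kappa>3: "\<bar>\<kappa> z\<bar> \<le> CP" if "r1\<^sup>2 \<le> sqn z" "sqn z \<le> r2\<^sup>2" for z using prof(6)[OF d(1,2) that] unfolding fun_f \<kappa>_def .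
  have fI: "integral square (\<lambda>z. f (sqn z) * norm z) \<le> CP" using prof(7)[OF d(1,2)] unfolding f_def .
  have f_deriv: "(f has_real_derivative f' t) (at t)" if "t \<ge> 0" for t
  proof -
    have "t + d\<^sup>2 > 0" using that d(1) by (simp add: add_nonneg_pos)
    from DERIV_mult'[OF bump_log_deriv[OF this] Z(1)]
    show ?thesis unfolding f_def[abs_def] f'_def by (simp add: algebra_simps)
  qed
  have f'_cont: "continuous_on {0..} f'"
  proof -
    have p: "\<And>t. t \<in> {0..} \<Longrightarrow> t + d\<^sup>2 > 0" using d(1) by (simp add: add_nonneg_pos)
    show ?thesis unfolding f'_def
      by (intro continuous_intros continuous_bump_log[OF p] continuous_on_subset[OF cZ] continuous_on_subset[OF cZ1]) auto
  qed
  have f0: "f t = 0 \<and> f' t = 0" if "t \<ge> r2\<^sup>2" for t using Z(5)[OF that] by (simp add: f_def f'_def)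
  have f_ge: "f t \<ge> 0" if "t \<ge> 0" for t
  proof -
    have "t + d\<^sup>2 > 0" using that d(1) by (simp add: add_nonneg_pos)
    then show ?thesis unfolding f_def bump_log_def using Z(6) by (intro mult_nonneg_nonneg divide_nonneg_nonneg) auto
  qed
  have f_cont: "continuous_on {- (d\<^sup>2 / 2)..2} f"
  proof -
    have p: "t + d\<^sup>2 > 0" if "t \<in> {- (d\<^sup>2 / 2)..2}" for t
    proof -
      have "- (d\<^sup>2 / 2) \<le> t" "0 < d\<^sup>2" using that d(1) by auto
      then show ?thesis by linarith
    qed
    show ?thesis unfolding f_def
      by (intro continuous_intros continuous_bump_log(1)[OF p] continuous_on_subset[OF cZ]) auto
  qed
  have "d\<^sup>2 / 2 > 0" using d(1) by simp
  obtain \<Phi> where \<Phi>: "\<And>t. t \<ge> 0 \<Longrightarrow> (\<Phi> has_real_derivative - f t) (at t)" "\<And>t. t \<ge> r2\<^sup>2 \<Longrightarrow> \<Phi> t = 0"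
    "\<And>t. t \<ge> 0 \<Longrightarrow> 0 \<le> \<Phi> t" "\<And>t. t \<ge> 0 \<Longrightarrow> \<Phi> t \<le> \<Phi> 0"
    by (rule decreasing_primitive[OF \<open>d\<^sup>2 / 2 > 0\<close> f_cont conjunct1[OF f0] zero_le_power2 r12(2) f_ge]) (assumption | rule that)+
  have f\<Phi>0: "f t = 0 \<and> f' t = 0 \<and> \<Phi> t = 0" if "t \<ge> r2\<^sup>2" for t using f0[OF that] \<Phi>(2)[OF that] by simp
  have profile: "radial_profile r2 f f' \<Phi>"
    unfolding radial_profile_def using f_deriv f'_cont f\<Phi>0 \<Phi>(1) f_ge by blast
  have r02: "r0 < r2" using r1 r2 by linarith
  obtain V where V: "V \<longlonglongrightarrow> 0"
    "\<And>n. integral square (\<lambda>z. \<Phi> (sqn z) * ?m n z) - integral square (\<lambda>z. \<Phi> (sqn z) * ?mI n z) \<le> V n"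
    by (rule excess_mass_bound[OF sol r0(1) r02 r2(2) l eq \<Phi>]) (assumption | rule that)+
  have ev1: "\<forall>\<^sub>F k in sequentially. V k < 1" using V(1) by (rule order_tendstoD) simp
  have "0 < min 1 (sqrt \<eta> * d / 4)" using \<eta> d(1) by simp
  then have ev2: "\<forall>\<^sub>F k in sequentially. eps k < min 1 (sqrt \<eta> * d / 4)"
    using eps_tendsto by (intro order_tendstoD)
  obtain k where k: "V k < 1" "eps k < min 1 (sqrt \<eta> * d / 4)"
    using eventually_happens'[OF sequentially_bot eventually_conj[OF ev1 ev2]] by blast
  define \<epsilon> where "\<epsilon> = eps k"
  have \<epsilon>: "\<epsilon> > 0" "\<epsilon> < 1" "\<epsilon> < sqrt \<eta> * d / 4" using k eps_pos by (auto simp: \<epsilon>_def)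
  have \<epsilon>2: "\<epsilon>\<^sup>2 \<le> 1" "\<epsilon>\<^sup>2 > 0" using \<epsilon> by (auto simp: power_le_one)
  define A where "A z = ln (n z + \<epsilon>\<^sup>2) / 2" for z
  define A0 where "A0 z = ln (sqn z + \<epsilon>\<^sup>2) / 2" for z
  have np: "n z + \<epsilon>\<^sup>2 > 0" "sqn z + \<epsilon>\<^sup>2 > 0" for z using n_ge[of z] \<epsilon>2 by (auto intro: add_nonneg_pos)
  have cA: "continuous_on (ball 0 1) A" "continuous_on (ball 0 1) A0"
    unfolding A_def A0_def n_def 
    using np by (auto intro!: continuous_intros C1_gradD(2)[OF a] C1_gradD(2)[OF b] simp: n_def less_imp_neq[symmetric])
  have \<kappa>i: "(\<lambda>z. h z * \<kappa> z) integrable_on square" if "continuous_on (ball 0 1) h" for h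
    unfolding \<kappa>_def by (rule flux_density_integrable(1)[OF f_deriv f'_cont f0 pos(3) r2(2) that])
  have \<kappa>int: "integral square \<kappa> = 0"
    unfolding \<kappa>_def by (rule flux_density_integrable(2)[OF f_deriv f'_cont f0 pos(3) r2(2)])
  have c\<Phi>s: "continuous_on UNIV (\<lambda>z. \<Phi> (sqn z))"
  proof -
    have "continuous_on {0..} \<Phi>" by (rule DERIV_continuous_on[where D="\<lambda>t. - f t"]) (rule has_field_derivative_at_within[OF \<Phi>(1)], simp)
    then show ?thesis by (rule continuous_on_compose2) (auto intro!: continuous_intros)
  qed
  have \<Phi>s0: "\<Phi> (sqn z) = 0" if "r2 < norm z" for z using that pos by (intro \<Phi>(2)) (simp add: sqn_eq power_mono)
  have \<Phi>i: "(\<lambda>z. \<Phi> (sqn z) * h z) integrable_on square" if "continuous_on (ball 0 1) h" for h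
    by (rule integrable_cutoff[OF c\<Phi>s \<Phi>s0 r2(2) that])
  note mi = \<Phi>i[OF continuous_on_mass_density[OF a b \<epsilon>(1)]] and mIi = \<Phi>i[OF continuous_on_mass_density[OF C1_grad_fst C1_grad_snd \<epsilon>(1)]]
  have flux1: "- integral square (\<lambda>z. A z * \<kappa> z) \<le> integral square (\<lambda>z. \<Phi> (sqn z) * mass_density \<epsilon> a ax ay b bx by z) + Ca * CP"
  proof -
    have "\<bar>integral square (\<lambda>z. A z * \<kappa> z + \<Phi> (sqn z) * mass_density \<epsilon> a ax ay b bx by z)\<bar> \<le> Ca * integral square (\<lambda>z. f (sqn z) * norm z)"
      unfolding A_def n_def \<kappa>_def by (rule Ca(2)[OF \<epsilon>(1) profile])
    also have "\<dots> \<le> Ca * CP" by (rule mult_left_mono[OF fI Ca(1)])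
    finally show ?thesis using integral_add[OF \<kappa>i[OF cA(1)] mi] by linarith
  qed
  have flux2: "integral square (\<lambda>z. A0 z * \<kappa> z) \<le> Ci * CP - integral square (\<lambda>z. \<Phi> (sqn z) * mass_density \<epsilon> fst (\<lambda>_. 1) (\<lambda>_. 0) snd (\<lambda>_. 0) (\<lambda>_. 1) z)"
  proof -
    have "\<bar>integral square (\<lambda>z. A0 z * \<kappa> z + \<Phi> (sqn z) * mass_density \<epsilon> fst (\<lambda>_. 1) (\<lambda>_. 0) snd (\<lambda>_. 0) (\<lambda>_. 1) z)\<bar> \<le> Ci * integral square (\<lambda>z. f (sqn z) * norm z)"
      unfolding A0_def sqn_def[of z] \<kappa>_def using Ci(2)[OF \<epsilon>(1) profile] unfolding sqn_def[symmetric] .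
    also have "\<dots> \<le> Ci * CP" by (rule mult_left_mono[OF fI Ci(1)])
    finally show ?thesis using integral_add[OF \<kappa>i[OF cA(2)] mIi] by linarith
  qed
  \<comment> \<open>The integral of \<open>\<kappa>\<close> is zero, so adding the constant \<open>CB\<close> to \<open>A0 - A\<close> costs nothing; \<open>C5\<close> makes the integrand
    nonnegative on the annulus as well.\<close>
  define F where "F z = (CB * \<kappa> z + (A0 z * \<kappa> z - A z * \<kappa> z)) + C5" for z
  have F_alt: "F z = (CB + A0 z - A z) * \<kappa> z + C5" for z by (simp add: F_def algebra_simps)
  have \<kappa>i1: "(\<lambda>z. CB * \<kappa> z) integrable_on square" by (rule \<kappa>i) (rule continuous_on_const)
  have Fi: "F integrable_on square" unfolding F_def
    by (intro integrable_add integrable_diff \<kappa>i1 \<kappa>i cA integrable_const)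
  have F_le: "integral square F \<le> K"
  proof -
    have "integral square F = CB * integral square \<kappa> + (integral square (\<lambda>z. A0 z * \<kappa> z) - integral square (\<lambda>z. A z * \<kappa> z)) + 4 * C5"
      unfolding F_def
      by (subst integral_add integral_diff, (intro integrable_add integrable_diff \<kappa>i1 \<kappa>i cA integrable_const)+)+
        (simp add: measure_square)
    also have "\<dots> \<le> V k + (Ca + Ci) * CP + 4 * C5"
      using flux1 flux2 V(2)[of k] unfolding \<kappa>int \<epsilon>_def[symmetric] by (simp add: distrib_right)
    also have "\<dots> \<le> K" using k(1) by (simp add: K_def)
    finally show ?thesis .
  qed
  have diff_ge: "CB + A0 z - A z \<ge> 0" if "sqn z \<le> r2\<^sup>2" for z
  proof -
    have zc: "z \<in> cball 0 r2" using that pos by (simp add: sqn_eq abs_le_square_iff[symmetric])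
    have "n z + \<epsilon>\<^sup>2 \<le> H * sqn z + H * \<epsilon>\<^sup>2" using nH[OF zc] H1 \<epsilon>2 by (intro add_mono) (auto simp: mult_ge1_I)
    then have "n z + \<epsilon>\<^sup>2 \<le> H * (sqn z + \<epsilon>\<^sup>2)" by (simp add: distrib_left)
    then have "ln (n z + \<epsilon>\<^sup>2) \<le> ln (H * (sqn z + \<epsilon>\<^sup>2))" using np[of z] H1 by (subst ln_le_cancel_iff) (auto intro!: mult_pos_pos)
    also have "\<dots> = ln H + ln (sqn z + \<epsilon>\<^sup>2)" using np[of z] H1 by (intro ln_mult_pos) auto
    finally show ?thesis by (simp add: CB_def A_def A0_def)
  qed
  have F_ge: "F z \<ge> 0" for z
  proof -
    consider "sqn z \<le> r1\<^sup>2" | "r1\<^sup>2 \<le> sqn z" "sqn z \<le> r2\<^sup>2" | "sqn z \<ge> r2\<^sup>2" by linarith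
    then show ?thesis
    proof cases
      case 1
      then show ?thesis unfolding F_alt using \<kappa>1[OF 1] diff_ge[of z] r12(1) C50 by simp
    next
      case 3
      then have "\<kappa> z = 0" using f0[OF 3] by (simp add: \<kappa>_def flux_density_def)
      then show ?thesis unfolding F_alt using C50 by simp
    next
      case 2
      have n1: "r1 \<le> norm z" "norm z \<le> r2" using 2 pos by (simp_all add: sqn_eq abs_le_square_iff[symmetric])
      have "sqn z + \<epsilon>\<^sup>2 \<le> 2" using 2 r12 \<epsilon>2 by linarith
      also have "2 = (2 / c0) * c0" using c0 by simp
      also have "\<dots> \<le> (2 / c0) * (n z + \<epsilon>\<^sup>2)"
      proof (rule mult_left_mono)
        show "c0 \<le> n z + \<epsilon>\<^sup>2" using c0(3)[OF n1] \<epsilon>2(2) by linarith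
      qed (use c0(1) in simp)
      finally have "ln (sqn z + \<epsilon>\<^sup>2) \<le> ln ((2 / c0) * (n z + \<epsilon>\<^sup>2))" using np[of z] c0(1) by (subst ln_le_cancel_iff) (auto intro!: mult_pos_pos)
      also have "\<dots> = ln (2 / c0) + ln (n z + \<epsilon>\<^sup>2)" using np[of z] c0 by (intro ln_mult_pos) auto
      finally have up: "CB + A0 z - A z \<le> CB + C4" by (simp add: C4_def A_def A0_def)
      have "\<bar>(CB + A0 z - A z) * \<kappa> z\<bar> \<le> (CB + C4) * CP"
        unfolding abs_mult using diff_ge[OF 2(2)] up \<kappa>3[OF 2] by (intro mult_mono) auto
      then show ?thesis unfolding F_alt C5_def by linarith
    qed
  qed
  let ?Q = "cbox (d/4, 0) (d/2, d/4)"
  have QS: "?Q \<subseteq> square" using d(1,3) r1 by (auto simp: cbox_Pair_eq)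
  have FQ: "F z \<ge> (K + 1) * 32 * (1 / (2 * (d * d)))" if z: "z \<in> ?Q" for z
  proof -
    have x: "d/4 \<le> fst z" "fst z \<le> d/2" "0 \<le> snd z" "snd z \<le> d/4" using z by (cases z, auto simp: cbox_Pair_eq)+
    have "(d/4)\<^sup>2 \<le> (fst z)\<^sup>2" "(fst z)\<^sup>2 \<le> (d/2)\<^sup>2" "(snd z)\<^sup>2 \<le> (d/4)\<^sup>2" using x d(1) by (auto intro!: power_mono)
    then have "d\<^sup>2 / 16 \<le> (fst z)\<^sup>2" "(fst z)\<^sup>2 \<le> d\<^sup>2 / 4" "(snd z)\<^sup>2 \<le> d\<^sup>2 / 16" by (simp_all add: power_divide)
    then have sq: "d\<^sup>2 / 16 \<le> sqn z" "sqn z \<le> d\<^sup>2 / 4 + d\<^sup>2 / 16"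
      using zero_le_power2[of "snd z"] unfolding sqn_def by linarith+
    have sqd: "sqn z < d * d" using sq(2) d2 by (simp add: power2_eq_square)
    have "d * d \<le> r1 * r1" using d by (intro mult_mono) auto
    then have sqr: "sqn z \<le> r1\<^sup>2" using sqd by (simp add: power2_eq_square)
    have nd: "norm z < d" using sqd d(1) by (simp add: sqn_eq power2_eq_square[symmetric] power2_less_imp_less)
    have sq0: "sqn z > 0" using sq(1) zero_less_power[OF d(1), of 2] by linarith
    have "\<epsilon>\<^sup>2 \<le> (sqrt \<eta> * d / 4)\<^sup>2" using \<epsilon> by (intro power_mono) auto
    also have "\<dots> = \<eta> * (d\<^sup>2 / 16)" using \<eta>(1) by (simp add: power_mult_distrib power_divide)
    also have "\<dots> \<le> \<eta> * sqn z" using sq(1) \<eta>(1) by (intro mult_left_mono) auto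
    finally have "n z + \<epsilon>\<^sup>2 \<le> 2 * \<eta> * sqn z" using n\<eta>[of z] nd d(4) by simp
    also have "\<dots> \<le> 2 * \<eta> * (sqn z + \<epsilon>\<^sup>2)" using \<eta>(1) \<epsilon>2 by (intro mult_left_mono) auto
    finally have "ln (n z + \<epsilon>\<^sup>2) \<le> ln (2 * \<eta> * (sqn z + \<epsilon>\<^sup>2))" using np[of z] \<eta>(1) by (subst ln_le_cancel_iff) (auto intro!: mult_pos_pos)
    also have "\<dots> = ln (2 * \<eta>) + ln (sqn z + \<epsilon>\<^sup>2)" using np[of z] \<eta> by (intro ln_mult_pos) auto
    also have "ln (2 * \<eta>) = - 64 * K - 64" by (simp add: \<eta>_def)
    finally have "CB + A0 z - A z \<ge> (K + 1) * 32" using CB0 by (simp add: A_def A0_def)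
    then have "(K + 1) * 32 * (1 / (2 * (d * d))) \<le> (CB + A0 z - A z) * \<kappa> z"
      using \<kappa>2[OF sqr sqd] K0 d2 by (intro mult_mono) auto
    then show ?thesis unfolding F_alt using C50 by linarith
  qed
  have FiQ: "F integrable_on ?Q" using integrable_on_subcbox[OF Fi QS] .
  have mQ: "measure lborel ?Q = (d * d) / 16" using d(1) by (subst content_Pair) simp
  have "integral ?Q (\<lambda>_. (K + 1) * 32 * (1 / (2 * (d * d)))) \<le> integral ?Q F"
    by (rule integral_le[OF integrable_const FiQ FQ])
  also have "\<dots> \<le> integral square F"
    by (rule integral_subset_le[OF QS FiQ Fi]) (use F_ge in blast)
  also have "\<dots> \<le> K" by (rule F_le)
  also have "integral ?Q (\<lambda>_. (K + 1) * 32 * (1 / (2 * (d * d)))) = K + 1"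
  proof -
    have "integral ?Q (\<lambda>_. (K + 1) * 32 * (1 / (2 * (d * d)))) = (d * d) / 16 * ((K + 1) * 32 * (1 / (2 * (d * d))))"
      by (simp only: integral_const mQ real_scaleR_def)
    also have "\<dots> = K + 1" using d(1) by simp
    finally show ?thesis .
  qed
  finally show False by simp
qed

end

section \<open>Domains are conformal discs, and the winding number of a self map\<close>

text \<open>
  A contractible compact set does not separate the plane, by Borsuk's theorem. The complement of the interior is the
  closure of the complement.
\<close>

lemma planar_domain_complement_connected:
  assumes "planar_domain S"
  shows "connected (- interior S)"
proof -
  define \<iota> where "\<iota> p = Complex (fst p) (snd p)" for p :: "real \<times> real"
  define \<iota>' where "\<iota>' w = (Re w, Im w)" for w
  have S: "compact S" "contractible S" using assms by (auto simp: planar_domain_def compact_eq_bounded_closed)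
  have c\<iota>: "continuous_on A \<iota>" for A unfolding \<iota>_def Complex_eq by (intro continuous_intros)
  have c\<iota>': "continuous_on A \<iota>'" for A unfolding \<iota>'_def by (intro continuous_intros)
  have inv: "\<iota>' (\<iota> p) = p" "\<iota> (\<iota>' w) = w" for p w by (simp_all add: \<iota>_def \<iota>'_def)
  have "homeomorphism S (\<iota> ` S) \<iota> \<iota>'"
    by (rule homeomorphismI[OF c\<iota> c\<iota>']) (auto simp: inv image_image)
  then have "S homeomorphic (\<iota> ` S)" by (auto simp: homeomorphic_def)
  then have "contractible (\<iota> ` S)" using homeomorphic_contractible S(2) by blast
  moreover have "compact (\<iota> ` S)" by (rule compact_continuous_image[OF c\<iota> S(1)])
  ultimately have "connected (- (\<iota> ` S))"
    using contractible_imp_Borsukian Borsukian_separation_compact by blast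
  then have "connected (\<iota>' ` (- (\<iota> ` S)))" by (rule connected_continuous_image[OF c\<iota>'])
  moreover have "\<iota>' ` (- (\<iota> ` S)) = - S"
  proof (intro equalityI subsetI)
    fix p assume "p \<in> \<iota>' ` (- (\<iota> ` S))"
    then obtain w where w: "w \<notin> \<iota> ` S" "p = \<iota>' w" by auto
    then show "p \<in> - S" using inv(2)[of w] by (metis ComplI imageI)
  next
    fix p assume p: "p \<in> - S"
    then have "\<iota> p \<in> - (\<iota> ` S)" using inv(1) by (metis ComplD ComplI imageE)
    then show "p \<in> \<iota>' ` (- (\<iota> ` S))" using inv(1)[of p] by (metis imageI)
  qed
  ultimately have "connected (- S)" by simp
  then have "connected (closure (- S))" by (rule connected_imp_connected_closure)
  then show ?thesis by (simp add: closure_complement)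
qed

text \<open>
  By the Riemann mapping theorem, followed by an automorphism of the disc that moves the base point to the origin. The map is
  conformal for the coordinates \<open>(x, y / \<kappa>)\<close>; the factor \<open>\<kappa>\<close> will make the almost complex structure standard at \<open>s0\<close>.
\<close>

lemma conformal_parametrisation:
  assumes S: "planar_domain S" and s0: "s0 \<in> interior S" and \<kappa>: "\<kappa> > 0"
  obtains \<psi> \<phi> where "\<psi> holomorphic_on ball 0 1" "\<psi> 0 = Complex (fst s0) (snd s0 / \<kappa>)"
    "\<And>w. w \<in> ball 0 1 \<Longrightarrow> (Re (\<psi> w), \<kappa> * Im (\<psi> w)) \<in> interior S \<and> \<phi> (\<psi> w) = w"
    "continuous_on (interior S) (\<lambda>p. \<phi> (Complex (fst p) (snd p / \<kappa>)))"
    "\<And>p. p \<in> interior S \<Longrightarrow> \<phi> (Complex (fst p) (snd p / \<kappa>)) \<in> ball 0 1 \<and>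
       \<psi> (\<phi> (Complex (fst p) (snd p / \<kappa>))) = Complex (fst p) (snd p / \<kappa>)"
proof -
  define \<iota> where "\<iota> p = Complex (fst p) (snd p / \<kappa>)" for p :: "real \<times> real"
  define \<iota>' where "\<iota>' w = (Re w, \<kappa> * Im w)" for w
  define \<Omega> where "\<Omega> = \<iota> ` interior S"
  have c\<iota>: "continuous_on A \<iota>" for A unfolding \<iota>_def Complex_eq using \<kappa> by (intro continuous_intros) auto
  have c\<iota>': "continuous_on A \<iota>'" for A unfolding \<iota>'_def by (intro continuous_intros)
  have inv: "\<iota>' (\<iota> p) = p" "\<iota> (\<iota>' w) = w" for p w using \<kappa> by (simp_all add: \<iota>_def \<iota>'_def)
  have mem_image: "w \<in> \<iota> ` A \<longleftrightarrow> \<iota>' w \<in> A" for w A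
  proof
    assume "\<iota>' w \<in> A"
    then have "\<iota> (\<iota>' w) \<in> \<iota> ` A" by (rule imageI)
    then show "w \<in> \<iota> ` A" by (simp only: inv(2))
  qed (auto simp: inv(1))
  have \<Omega>_alt: "\<Omega> = \<iota>' -` interior S"
    unfolding \<Omega>_def by (rule set_eqI) (simp only: mem_image vimage_eq)
  have "open \<Omega>" unfolding \<Omega>_alt
    by (rule continuous_open_vimage[OF open_interior]) (use c\<iota>' continuous_on_eq_continuous_at open_UNIV in blast)
  moreover have "bounded \<Omega>"
  proof -
    have "compact S" using S by (auto simp: planar_domain_def compact_eq_bounded_closed)
    then have "bounded (\<iota> ` S)" by (intro compact_imp_bounded compact_continuous_image[OF c\<iota>])
    then show ?thesis unfolding \<Omega>_def using interior_subset by (meson bounded_subset image_mono)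
  qed
  moreover have "connected \<Omega>" unfolding \<Omega>_def
    using S by (intro connected_continuous_image[OF c\<iota>]) (simp add: planar_domain_def)
  moreover have "connected (- \<Omega>)"
  proof -
    have "- \<Omega> = \<iota> ` (- interior S)"
      unfolding \<Omega>_alt by (rule set_eqI) (simp only: mem_image vimage_eq Compl_iff)
    then show ?thesis using connected_continuous_image[OF c\<iota> planar_domain_complement_connected[OF S]] by simp
  qed
  ultimately have "open \<Omega> \<and> simply_connected \<Omega>" and bd: "bounded \<Omega>" by (auto simp: simply_connected_iff_simple)
  moreover have "\<Omega> \<noteq> {}" using s0 by (auto simp: \<Omega>_def)
  moreover have "\<Omega> \<noteq> UNIV" using bd not_bounded_UNIV by auto
  ultimately obtain f g where fg: "f holomorphic_on \<Omega>" "g holomorphic_on ball 0 1"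
    "\<forall>z\<in>\<Omega>. f z \<in> ball 0 1 \<and> g (f z) = z" "\<forall>z\<in>ball 0 1. g z \<in> \<Omega> \<and> f (g z) = z"
    using Riemann_mapping_theorem[of \<Omega>] by blast
  have z0: "\<iota> s0 \<in> \<Omega>" using s0 by (simp add: \<Omega>_def)
  obtain F G where FG: "F (f (\<iota> s0)) = 0" "F holomorphic_on ball 0 1" "F ` ball 0 1 \<subseteq> ball 0 1"
    "G holomorphic_on ball 0 1" "G ` ball 0 1 \<subseteq> ball 0 1"
    "\<And>z. z \<in> ball 0 1 \<Longrightarrow> F (G z) = z" "\<And>z. z \<in> ball 0 1 \<Longrightarrow> G (F z) = z"
    using ball_biholomorphism_exists[of "f (\<iota> s0)"] fg(3) z0 by blast
  have mem: "f z \<in> ball 0 1" "g (f z) = z" if "z \<in> \<Omega>" for z using fg(3) that by auto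
  have mem': "g w \<in> \<Omega>" "f (g w) = w" if "w \<in> ball 0 1" for w using fg(4) that by auto
  have Fb: "F w \<in> ball 0 1" "G w \<in> ball 0 1" if "w \<in> ball 0 1" for w using FG(3,5) that by blast+
  show thesis
  proof (rule that[of "\<lambda>w. g (G w)" "\<lambda>z. F (f z)"])
    show "(\<lambda>w. g (G w)) holomorphic_on ball 0 1"
      using holomorphic_on_compose_gen[OF FG(4) fg(2) FG(5)] by (simp add: o_def)
    have "G 0 = f (\<iota> s0)" using FG(7)[OF mem(1)[OF z0]] FG(1) by simp
    then show "g (G 0) = Complex (fst s0) (snd s0 / \<kappa>)" using mem(2)[OF z0] by (simp add: \<iota>_def)
    show "(Re (g (G w)), \<kappa> * Im (g (G w))) \<in> interior S \<and> F (f (g (G w))) = w" if w: "w \<in> ball 0 1" for w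
    proof
      have "g (G w) \<in> \<Omega>" by (rule mem'(1)[OF Fb(2)[OF w]])
      then show "(Re (g (G w)), \<kappa> * Im (g (G w))) \<in> interior S" unfolding \<Omega>_alt by (simp add: \<iota>'_def)
      show "F (f (g (G w))) = w" using mem'(2)[OF Fb(2)[OF w]] FG(6)[OF w] by simp
    qed
    have "continuous_on \<Omega> (F \<circ> f)"
      by (rule holomorphic_on_imp_continuous_on[OF holomorphic_on_compose_gen[OF fg(1) FG(2)]]) (use mem(1) in blast)
    then have "continuous_on \<Omega> (\<lambda>z. F (f z))" by (simp add: o_def)
    then show "continuous_on (interior S) (\<lambda>p. F (f (Complex (fst p) (snd p / \<kappa>))))"
      using continuous_on_compose2[OF _ c\<iota>, of \<Omega> "\<lambda>z. F (f z)" "interior S"] by (simp add: \<Omega>_def \<iota>_def)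
    show "F (f (Complex (fst p) (snd p / \<kappa>))) \<in> ball 0 1 \<and> g (G (F (f (Complex (fst p) (snd p / \<kappa>))))) = Complex (fst p) (snd p / \<kappa>)"
      if "p \<in> interior S" for p
    proof -
      have p: "\<iota> p \<in> \<Omega>" using that by (simp add: \<Omega>_def)
      then show ?thesis using Fb(1)[OF mem(1)[OF p]] FG(7)[OF mem(1)[OF p]] mem(2)[OF p] by (simp add: \<iota>_def)
    qed
  qed
qed

lemma C1_grad_holomorphic:
  assumes "f holomorphic_on ball 0 1"
  shows "C1_grad (ball 0 1) (\<lambda>z. Re (f (Complex (fst z) (snd z)))) (\<lambda>z. Re (deriv f (Complex (fst z) (snd z)))) (\<lambda>z. - Im (deriv f (Complex (fst z) (snd z))))"
    and "C1_grad (ball 0 1) (\<lambda>z. Im (f (Complex (fst z) (snd z)))) (\<lambda>z. Im (deriv f (Complex (fst z) (snd z)))) (\<lambda>z. Re (deriv f (Complex (fst z) (snd z))))"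
proof -
  have C: "Complex (fst z) (snd z) \<in> ball 0 1" if "z \<in> ball 0 1" for z
    using that by (simp add: cmod_def norm_prod_def)
  have cC: "continuous_on A (\<lambda>z::real\<times>real. Complex (fst z) (snd z))" for A unfolding Complex_eq by (intro continuous_intros)
  have cd: "continuous_on (ball 0 1) (\<lambda>z::real\<times>real. deriv f (Complex (fst z) (snd z)))"
    by (rule continuous_on_compose2[OF holomorphic_on_imp_continuous_on[OF holomorphic_deriv[OF assms open_ball]] cC]) (use C in auto)
  have d: "((\<lambda>z. f (Complex (fst z) (snd z))) has_derivative (\<lambda>h. deriv f (Complex (fst z) (snd z)) * Complex (fst h) (snd h))) (at z)"
    if z: "z \<in> ball 0 1" for z
  proof -
    have "((\<lambda>z. Complex (fst z) (snd z)) has_derivative (\<lambda>h. Complex (fst h) (snd h))) (at z)"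
      unfolding Complex_eq by (intro has_derivative_add has_derivative_of_real has_derivative_mult_right has_derivative_fst has_derivative_snd has_derivative_ident)
    moreover have "(f has_derivative (*) (deriv f (Complex (fst z) (snd z)))) (at (Complex (fst z) (snd z)))"
      using holomorphic_derivI[OF assms open_ball C[OF z]] by (simp add: has_field_derivative_def)
    ultimately show ?thesis using diff_chain_at by (fastforce simp: o_def)
  qed
  show "C1_grad (ball 0 1) (\<lambda>z. Re (f (Complex (fst z) (snd z)))) (\<lambda>z. Re (deriv f (Complex (fst z) (snd z)))) (\<lambda>z. - Im (deriv f (Complex (fst z) (snd z))))"
    unfolding C1_grad_def using has_derivative_Re[OF d] cd by (auto intro!: continuous_intros)
  show "C1_grad (ball 0 1) (\<lambda>z. Im (f (Complex (fst z) (snd z)))) (\<lambda>z. Im (deriv f (Complex (fst z) (snd z)))) (\<lambda>z. Re (deriv f (Complex (fst z) (snd z))))"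
    unfolding C1_grad_def using has_derivative_Im[OF d] cd by (auto intro!: continuous_intros simp: algebra_simps)
qed

text \<open>
  The quotient of the two ends of a homotopy of nonvanishing functions is homotopic to a constant, hence inessential.
\<close>

lemma logarithm_of_homotopic_ratio:
  fixes H :: "real \<times> (real \<times> real) \<Rightarrow> complex"
  assumes H: "continuous_on ({0..1} \<times> A) H" and nz: "\<And>t z. t \<in> {0..1} \<Longrightarrow> z \<in> A \<Longrightarrow> H (t, z) \<noteq> 0"
  obtains g where "continuous_on A g" "\<And>z. z \<in> A \<Longrightarrow> H (1, z) = H (0, z) * exp (g z)"
proof -
  define Q where "Q x = H x / H (0, snd x)" for x
  have cQ: "continuous_on ({0..1} \<times> A) Q"
    unfolding Q_def using nz
    by (intro continuous_on_divide H continuous_on_compose2[OF H]) (auto intro!: continuous_intros)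
  have "homotopic_with_canon (\<lambda>h. True) A (- {0}) (\<lambda>z. Q (0, z)) (\<lambda>z. Q (1, z))"
    unfolding homotopic_with_def
    by (rule exI[of _ Q]) (use cQ nz in \<open>auto simp: Q_def prod_topology_subtopology euclidean_product_topology
        subtopology_subtopology continuous_map_in_subtopology Times_Int_Times\<close>)
  then have "homotopic_with_canon (\<lambda>h. True) A (- {0}) (\<lambda>z. Q (1, z)) (\<lambda>z. Q (0, z))"
    by (rule homotopic_with_symD)
  then have "homotopic_with_canon (\<lambda>h. True) A (- {0}) (\<lambda>z. Q (1, z)) (\<lambda>z. 1)"
    by (rule homotopic_with_eq) (use nz in \<open>auto simp: Q_def\<close>)
  then obtain g where g: "continuous_on A g" "\<forall>z\<in>A. Q (1, z) = exp (g z)"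
    using inessential_eq_continuous_logarithm[of A "\<lambda>z. Q (1, z)"] by blast
  show thesis
  proof (rule that[OF g(1)])
    fix z assume z: "z \<in> A"
    then have "H (1, z) / H (0, z) = exp (g z)" using g(2) by (auto simp: Q_def)
    then show "H (1, z) = H (0, z) * exp (g z)" using nz[OF _ z, of 0] by (simp add: field_simps)
  qed
qed

text \<open>
  The difference quotient of an injective holomorphic function, completed by the derivative at the origin, is continuous
  without zeros on the disc.
\<close>

lemma difference_quotient_logarithm:
  assumes \<psi>: "\<psi> holomorphic_on ball 0 1" and inj: "inj_on \<psi> (ball 0 1)"
  obtains h where "continuous_on (ball 0 1) h" "\<And>w. w \<in> ball 0 1 \<Longrightarrow> \<psi> w - \<psi> 0 = w * exp (h w)"
proof -
  define f where "f w = (if w = 0 then deriv \<psi> 0 else (\<psi> w - \<psi> 0) / w)" for w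
  have "isCont f w" if w: "w \<in> ball 0 1" for w
  proof (cases "w = 0")
    case True
    have "(\<psi> has_field_derivative deriv \<psi> 0) (at 0)"
      by (rule holomorphic_derivI[OF \<psi> open_ball]) simp
    then have "((\<lambda>w. (\<psi> w - \<psi> 0) / (w - 0)) \<longlongrightarrow> deriv \<psi> 0) (at 0)"
      by (simp add: has_field_derivative_iff)
    then have "(f \<longlongrightarrow> deriv \<psi> 0) (at 0)"
      by (rule Lim_transform_eventually) (auto simp: f_def eventually_at_filter)
    then show ?thesis unfolding True isCont_def by (simp add: f_def)
  next
    case False
    have "isCont \<psi> w" using holomorphic_on_imp_continuous_on[OF \<psi>] w by (simp add: continuous_on_eq_continuous_at)
    then have "isCont (\<lambda>w. (\<psi> w - \<psi> 0) / w) w" using False by (intro continuous_intros)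
    moreover have "\<forall>\<^sub>F x in nhds w. f x = (\<psi> x - \<psi> 0) / x"
      using t1_space_nhds[OF False] by (rule eventually_mono) (simp add: f_def)
    ultimately show ?thesis by (rule iffD2[OF isCont_cong, rotated])
  qed
  then have c: "continuous_on (ball 0 1) f" by (simp add: continuous_at_imp_continuous_on)
  have nz: "f w \<noteq> 0" if w: "w \<in> ball 0 1" for w
  proof (cases "w = 0")
    case True
    then show ?thesis using holomorphic_injective_imp_regular[OF \<psi> open_ball inj] by (simp add: f_def)
  next
    case False
    then have "\<psi> w \<noteq> \<psi> 0" using inj w by (auto simp: inj_on_def)
    then show ?thesis using False by (simp add: f_def)
  qed
  obtain h where h: "continuous_on (ball 0 1) h" "\<And>z. z \<in> ball 0 1 \<Longrightarrow> f z = exp (h z)"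
    by (rule continuous_logarithm_on_ball[OF c nz]) (assumption | rule that)+
  show thesis
  proof (rule that[OF h(1)])
    fix w :: complex assume "w \<in> ball 0 1"
    from h(2)[OF this] show "\<psi> w - \<psi> 0 = w * exp (h w)" by (cases "w = 0") (auto simp: f_def field_simps)
  qed
qed

text \<open>
  The self map \<open>G\<close> has its values in a compact set, hence within radius \<open>r0\<close> in the disc coordinate. For \<open>|w| > r0\<close> the
  point \<open>w\<close> therefore never meets \<open>t \<mu>\<close>, where \<open>\<mu>\<close> is the value of \<open>G\<close> in the disc coordinate and
  \<open>0 \<le> t \<le> 1\<close>. The homotopy shrinks \<open>t\<close> to \<open>0\<close> and at the same time the positive factor \<open>\<tau>\<close> of the second component to \<open>1\<close>.
\<close>

lemma self_map_logarithm:
  fixes G :: "real \<times> real \<Rightarrow> real \<times> real"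
  assumes \<kappa>: "\<kappa> > 0" and \<psi>: "\<psi> holomorphic_on ball 0 1"
    and \<psi>V: "\<And>w. w \<in> ball 0 1 \<Longrightarrow> (Re (\<psi> w), \<kappa> * Im (\<psi> w)) \<in> V \<and> \<phi> (\<psi> w) = w"
    and c\<phi>: "continuous_on V (\<lambda>p. \<phi> (Complex (fst p) (snd p / \<kappa>)))"
    and \<phi>: "\<And>p. p \<in> V \<Longrightarrow> \<phi> (Complex (fst p) (snd p / \<kappa>)) \<in> ball 0 1 \<and>
       \<psi> (\<phi> (Complex (fst p) (snd p / \<kappa>))) = Complex (fst p) (snd p / \<kappa>)"
    and K: "compact K" "K \<subseteq> V" and G: "continuous_on V G" "G ` V \<subseteq> K"
    and \<tau>: "continuous_on (ball 0 1) \<tau>" "\<And>z. z \<in> ball 0 1 \<Longrightarrow> \<tau> z > 0"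
  defines "P \<equiv> \<lambda>z::real\<times>real. (Re (\<psi> (Complex (fst z) (snd z))), \<kappa> * Im (\<psi> (Complex (fst z) (snd z))))"
  obtains r0 l where "0 \<le> r0" "r0 < 1" "continuous_on {z. r0 < norm z \<and> norm z < 1} l"
    "\<And>z. r0 < norm z \<Longrightarrow> norm z < 1 \<Longrightarrow> Complex (fst (G (P z)) - fst (P z)) (\<tau> z / \<kappa> * (snd (G (P z)) - snd (P z)))
       = Complex (fst z) (snd z) * exp (l z)"
proof -
  define cz where "cz z = Complex (fst z) (snd z)" for z :: "real \<times> real"
  have n: "norm (cz z) = norm z" for z by (simp add: cz_def cmod_def norm_prod_def)
  have czb: "cz z \<in> ball 0 1 \<longleftrightarrow> z \<in> ball 0 1" for z using n by simp
  have ccz: "continuous_on A cz" for A unfolding cz_def Complex_eq by (intro continuous_intros)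
  have c\<psi>: "continuous_on (ball 0 1) \<psi>" by (rule holomorphic_on_imp_continuous_on[OF \<psi>])
  have inj: "inj_on \<psi> (ball 0 1)" by (rule inj_on_inverseI[of _ \<phi>]) (use \<psi>V in blast)
  have PV: "P z \<in> V" if "z \<in> ball 0 1" for z using \<psi>V[of "cz z"] that czb by (simp add: P_def cz_def)
  have c\<psi>z: "continuous_on (ball 0 1) (\<lambda>z. \<psi> (cz z))"
    by (rule continuous_on_compose2[OF c\<psi> ccz]) (use czb in blast)
  have cP: "continuous_on (ball 0 1) P" using c\<psi>z unfolding P_def cz_def by (intro continuous_intros)
  \<comment> \<open>The inverse of the parametrisation of \<open>V\<close> by the disc.\<close>
  define \<alpha> where "\<alpha> p = \<phi> (Complex (fst p) (snd p / \<kappa>))" for p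
  have c\<alpha>: "continuous_on V \<alpha>" using c\<phi> unfolding \<alpha>_def .
  have "compact (\<alpha> ` K)" by (rule compact_continuous_image[OF continuous_on_subset[OF c\<alpha> K(2)] K(1)])
  moreover have "\<alpha> ` K \<subseteq> ball 0 1" using \<phi> K(2) unfolding \<alpha>_def by blast
  ultimately obtain r0 where r0: "0 \<le> r0" "r0 < 1" "\<And>w. w \<in> \<alpha> ` K \<Longrightarrow> norm w \<le> r0"
  proof (cases "\<alpha> ` K = {}")
    case True
    then show thesis by (intro that[of 0]) auto
  next
    case False
    assume A: "compact (\<alpha> ` K)" "\<alpha> ` K \<subseteq> ball 0 1"
    obtain w0 where w0: "w0 \<in> \<alpha> ` K" "\<forall>y\<in>\<alpha> ` K. norm y \<le> norm w0"
      using continuous_attains_sup[OF A(1) False continuous_on_norm[OF continuous_on_id]] by blast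
    then have "norm w0 < 1" using A(2) by auto
    then show thesis using w0(2) by (intro that[of "norm w0"]) auto
  qed
  define A where "A = {z::real\<times>real. r0 < norm z \<and> norm z < 1}"
  have AB: "A \<subseteq> ball 0 1" by (auto simp: A_def)
  define \<mu> where "\<mu> z = \<alpha> (G (P z))" for z
  have \<mu>K: "norm (\<mu> z) \<le> r0" if "z \<in> ball 0 1" for z
    unfolding \<mu>_def using G(2) PV[OF that] by (intro r0(3)) blast
  have c\<mu>: "continuous_on (ball 0 1) \<mu>"
    unfolding \<mu>_def
  proof (rule continuous_on_compose2[OF c\<alpha>])
    show "continuous_on (ball 0 1) (\<lambda>z. G (P z))"
      by (rule continuous_on_compose2[OF G(1) cP]) (use PV in blast)
    show "(\<lambda>z. G (P z)) ` ball 0 1 \<subseteq> V" using PV G(2) K(2) by blast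
  qed
  define H where "H x = Complex (Re (\<psi> (of_real (fst x) * \<mu> (snd x)) - \<psi> (cz (snd x))))
     (((1 - fst x) + fst x * \<tau> (snd x)) * Im (\<psi> (of_real (fst x) * \<mu> (snd x)) - \<psi> (cz (snd x))))" for x :: "real \<times> (real \<times> real)"
  have t\<mu>: "norm (of_real t * \<mu> z) \<le> r0" if "t \<in> {0..1}" "z \<in> A" for t z
  proof -
    have "\<bar>t\<bar> * norm (\<mu> z) \<le> 1 * r0" using that \<mu>K[of z] AB by (intro mult_mono) auto
    then show ?thesis by (simp add: norm_mult)
  qed
  have cH: "continuous_on ({0..1} \<times> A) H"
  proof -
    have s: "continuous_on ({0..1} \<times> A) (\<lambda>x. \<mu> (snd x))" "continuous_on ({0..1} \<times> A) (\<lambda>x. \<tau> (snd x))"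
      "continuous_on ({0..1} \<times> A) (\<lambda>x. \<psi> (cz (snd x)))"
      by (rule continuous_on_compose2[OF c\<mu> continuous_on_snd[OF continuous_on_id]]
          continuous_on_compose2[OF \<tau>(1) continuous_on_snd[OF continuous_on_id]]
          continuous_on_compose2[OF c\<psi>z continuous_on_snd[OF continuous_on_id]]; use AB in auto)+
    have "continuous_on ({0..1} \<times> A) (\<lambda>x. \<psi> (of_real (fst x) * \<mu> (snd x)))"
    proof (rule continuous_on_compose2[OF c\<psi>])
      show "continuous_on ({0..1} \<times> A) (\<lambda>x. of_real (fst x) * \<mu> (snd x))" using s(1) by (intro continuous_intros)
      show "(\<lambda>x. of_real (fst x) * \<mu> (snd x)) ` ({0..1} \<times> A) \<subseteq> ball 0 1"
        using t\<mu> r0(2) by fastforce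
    qed
    with s show ?thesis unfolding H_def Complex_eq by (intro continuous_intros)
  qed
  have nz: "H (t, z) \<noteq> 0" if "t \<in> {0..1}" "z \<in> A" for t z
  proof
    assume "H (t, z) = 0"
    then have re: "Re (\<psi> (of_real t * \<mu> z) - \<psi> (cz z)) = 0" and im: "((1 - t) + t * \<tau> z) * Im (\<psi> (of_real t * \<mu> z) - \<psi> (cz z)) = 0"
      unfolding H_def by (auto simp only: complex_eq_iff complex.sel fst_conv snd_conv zero_complex.sel)
    have z: "z \<in> ball 0 1" using that(2) AB by blast
    have "(1 - t) + t * \<tau> z > 0"
    proof (cases "t = 0")
      case False
      then have "t * \<tau> z > 0" using that(1) \<tau>(2)[OF z] by (intro mult_pos_pos) auto
      then show ?thesis using that(1) by simp
    qed simp
    then have "Im (\<psi> (of_real t * \<mu> z) - \<psi> (cz z)) = 0" using im by simp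
    then have "\<psi> (of_real t * \<mu> z) = \<psi> (cz z)" using re by (simp add: complex_eq_iff)
    moreover have "of_real t * \<mu> z \<in> ball 0 1" using t\<mu>[OF that] r0(2) by simp
    ultimately have "of_real t * \<mu> z = cz z" by (rule inj_onD[OF inj]) (use czb z in blast)
    then have "norm z \<le> r0" using t\<mu>[OF that] n[of z] by simp
    then show False using that(2) by (simp add: A_def)
  qed
  obtain g where g: "continuous_on A g" "\<And>z. z \<in> A \<Longrightarrow> H (1, z) = H (0, z) * exp (g z)"
    by (rule logarithm_of_homotopic_ratio[OF cH nz]) (assumption | rule that)+
  obtain h where h: "continuous_on (ball 0 1) h" "\<And>w. w \<in> ball 0 1 \<Longrightarrow> \<psi> w - \<psi> 0 = w * exp (h w)"
    by (rule difference_quotient_logarithm[OF \<psi> inj]) (rule that)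
  show thesis
  proof (rule that[OF r0(1,2), of "\<lambda>z. h (cz z) + \<i> * of_real pi + g z"])
    show "continuous_on {z. r0 < norm z \<and> norm z < 1} (\<lambda>z. h (cz z) + \<i> * of_real pi + g z)"
      unfolding A_def[symmetric] using AB czb
      by (intro continuous_intros g(1) continuous_on_compose2[OF h(1) ccz]) blast
    fix z :: "real \<times> real" assume z: "r0 < norm z" "norm z < 1"
    then have zA: "z \<in> A" and zb: "z \<in> ball 0 1" by (auto simp: A_def)
    have GV: "G (P z) \<in> V" using PV[OF zb] G(2) K(2) by blast
    have \<psi>\<mu>: "\<psi> (\<mu> z) = Complex (fst (G (P z))) (snd (G (P z)) / \<kappa>)"
      using \<phi>[OF GV] by (simp add: \<mu>_def \<alpha>_def)
    have "H (1, z) = Complex (fst (G (P z)) - fst (P z)) (\<tau> z / \<kappa> * (snd (G (P z)) - snd (P z)))"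
      unfolding H_def using \<kappa> by (simp add: \<psi>\<mu> P_def cz_def field_simps)
    moreover have "H (0, z) = - (\<psi> (cz z) - \<psi> 0)"
      by (simp add: H_def complex_eq_iff)
    moreover have "\<psi> (cz z) - \<psi> 0 = cz z * exp (h (cz z))" using zb czb by (intro h(2)) blast
    ultimately have "Complex (fst (G (P z)) - fst (P z)) (\<tau> z / \<kappa> * (snd (G (P z)) - snd (P z))) = - (cz z * exp (h (cz z))) * exp (g z)"
      using g(2)[OF zA] by simp
    also have "\<dots> = cz z * exp (h (cz z) + \<i> * of_real pi + g z)"
      by (simp add: exp_add)
    finally show "Complex (fst (G (P z)) - fst (P z)) (\<tau> z / \<kappa> * (snd (G (P z)) - snd (P z)))
       = Complex (fst z) (snd z) * exp (h (cz z) + \<i> * of_real pi + g z)" by (simp add: cz_def)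
  qed
qed

section \<open>Degenerate fixed points\<close>

text \<open>
  The matrix \<open>[[0, 1 / \<tau>], [- \<tau>, 0]]\<close> conjugated by the rotation and dilation \<open>[[m, n], [- n, m]]\<close>.
\<close>

lemma rotated_coefficients:
  fixes m n D \<tau> u :: real
  assumes D: "D = m * m + n * n" "D \<noteq> 0" and u: "u * \<tau> = 1"
  defines "e \<equiv> m * n * (u - \<tau>) * inverse D" and "g \<equiv> (m * m * u + \<tau> * (n * n)) * inverse D"
    and "k \<equiv> (n * n * u + \<tau> * (m * m)) * inverse D"
  shows "g * k - e\<^sup>2 = 1" "e * m - g * n = - (\<tau> * n)" "e * n + g * m = u * m" "k * m - e * n = \<tau> * m" "k * n + e * m = u * n"
proof -
  define i where "i = inverse D"
  have iD: "i * (m * m + n * n) = 1" using D by (simp add: i_def)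
  have "g * k - e\<^sup>2 = ((m * m * u + \<tau> * (n * n)) * (n * n * u + \<tau> * (m * m)) - (m * n * (u - \<tau>)) * (m * n * (u - \<tau>))) * (i * i)"
    by (simp add: e_def g_def k_def i_def power2_eq_square algebra_simps)
  also have "(m * m * u + \<tau> * (n * n)) * (n * n * u + \<tau> * (m * m)) - (m * n * (u - \<tau>)) * (m * n * (u - \<tau>))
     = (u * \<tau>) * ((m * m + n * n) * (m * m + n * n))" by (simp add: algebra_simps)
  also have "(u * \<tau>) * ((m * m + n * n) * (m * m + n * n)) * (i * i) = (u * \<tau>) * ((i * (m * m + n * n)) * (i * (m * m + n * n)))"
    by (simp only: mult_ac)
  also have "\<dots> = 1" unfolding iD u by simp
  finally show "g * k - e\<^sup>2 = 1" .
  have c: "x * (m * m + n * n) * i = x" for x using iD by (simp add: mult.assoc mult.commute[of i])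
  have "e * m - g * n = - (\<tau> * n) * (m * m + n * n) * i" by (simp add: e_def g_def i_def algebra_simps)
  then show "e * m - g * n = - (\<tau> * n)" unfolding c .
  have "e * n + g * m = (u * m) * (m * m + n * n) * i" by (simp add: e_def g_def i_def algebra_simps)
  then show "e * n + g * m = u * m" unfolding c .
  have "k * m - e * n = (\<tau> * m) * (m * m + n * n) * i" by (simp add: e_def k_def i_def algebra_simps)
  then show "k * m - e * n = \<tau> * m" unfolding c .
  have "k * n + e * m = (u * n) * (m * m + n * n) * i" by (simp add: e_def k_def i_def algebra_simps)
  then show "k * n + e * m = u * n" unfolding c .
qed

text \<open>
  The displacement \<open>(F1, F2)\<close> of a self map, pulled back to the disc. The factor \<open>\<rho>\<close> on the second component turns
  \<open>F1x = F2y\<close>, \<open>F1y = - \<rho>\<^sup>2 F2x\<close> into a system whose matrix has the square \<open>-1\<close>, at the cost of a term of order zero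
  from the derivatives of \<open>\<rho>\<close>. A conformal change of coordinates preserves this form; the normalisation by \<open>\<kappa>\<close>
  makes the matrix standard at the origin.
\<close>

lemma no_degenerate_fixed_point:
  assumes S: "planar_domain S" and s0: "s0 \<in> interior S"
    and F1: "C1_grad (interior S) F1 F1x F1y" and F2: "C1_grad (interior S) F2 F2x F2y"
    and \<rho>: "C1_grad (interior S) \<rho> \<rho>x \<rho>y" and \<rho>_pos: "\<And>z. z \<in> interior S \<Longrightarrow> \<rho> z > 0"
    and K: "compact K" "K \<subseteq> interior S" and self: "\<And>z. z \<in> interior S \<Longrightarrow> (fst z + F1 z, snd z + F2 z) \<in> K"
    and \<Theta>_nonneg: "\<And>z. z \<in> interior S \<Longrightarrow> \<Theta> z \<ge> 0" and \<Theta>: "continuous_on (interior S) \<Theta>"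
      "\<And>z. z \<in> interior S \<Longrightarrow> \<bar>F1x z - F2y z\<bar> \<le> \<Theta> z * \<bar>F2 z\<bar>"
      "\<And>z. z \<in> interior S \<Longrightarrow> \<bar>F1y z + (\<rho> z)\<^sup>2 * F2x z\<bar> \<le> \<Theta> z * \<bar>F2 z\<bar>"
    and zero: "F1 s0 = 0" "F2 s0 = 0" "F1x s0 = 0" "F1y s0 = 0" "F2x s0 = 0" "F2y s0 = 0"
  shows False
proof -
  define \<kappa> where "\<kappa> = 1 / \<rho> s0"
  have \<kappa>: "\<kappa> > 0" using \<rho>_pos[OF s0] by (simp add: \<kappa>_def)
  obtain \<psi> \<phi> where \<psi>: "\<psi> holomorphic_on ball 0 1" "\<psi> 0 = Complex (fst s0) (snd s0 / \<kappa>)"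
    and \<psi>V: "\<And>w. w \<in> ball 0 1 \<Longrightarrow> (Re (\<psi> w), \<kappa> * Im (\<psi> w)) \<in> interior S \<and> \<phi> (\<psi> w) = w"
    and c\<phi>: "continuous_on (interior S) (\<lambda>p. \<phi> (Complex (fst p) (snd p / \<kappa>)))"
    and \<phi>: "\<And>p. p \<in> interior S \<Longrightarrow> \<phi> (Complex (fst p) (snd p / \<kappa>)) \<in> ball 0 1 \<and>
       \<psi> (\<phi> (Complex (fst p) (snd p / \<kappa>))) = Complex (fst p) (snd p / \<kappa>)"
    by (rule conformal_parametrisation[OF S s0 \<kappa>]) (rule that)
  have inj: "inj_on \<psi> (ball 0 1)" by (rule inj_on_inverseI[of _ \<phi>]) (use \<psi>V in blast)
  define cz where "cz z = Complex (fst z) (snd z)" for z :: "real \<times> real"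
  have czb: "cz z \<in> ball 0 1" if "z \<in> ball 0 1" for z using that by (simp add: cz_def cmod_def norm_prod_def)
  have cz0: "cz 0 = 0" by (simp add: cz_def complex_eq_iff)
  define m where "m z = Re (deriv \<psi> (cz z))" for z
  define n where "n z = Im (deriv \<psi> (cz z))" for z
  define X where "X z = Re (\<psi> (cz z))" for z
  define Y where "Y z = \<kappa> * Im (\<psi> (cz z))" for z
  have CX: "C1_grad (ball 0 1) X m (\<lambda>z. - n z)"
    using C1_grad_holomorphic(1)[OF \<psi>(1)] unfolding X_def m_def n_def cz_def .
  have CY: "C1_grad (ball 0 1) Y (\<lambda>z. \<kappa> * n z) (\<lambda>z. \<kappa> * m z)"
    using C1_grad_cmult[OF C1_grad_holomorphic(2)[OF \<psi>(1)]] unfolding Y_def m_def n_def cz_def .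
  have XV: "(X z, Y z) \<in> interior S" if "z \<in> ball 0 1" for z
    using \<psi>V[OF czb[OF that]] by (simp add: X_def Y_def)
  have XY0: "(X 0, Y 0) = s0" using \<psi>(2) \<kappa> by (simp add: X_def Y_def cz0)
  have h\<psi>': "deriv \<psi> holomorphic_on ball 0 1" by (rule holomorphic_deriv[OF \<psi>(1) open_ball])
  have Cm: "C1_fun (ball 0 1) m" using C1_grad_holomorphic(1)[OF h\<psi>'] unfolding m_def cz_def by (rule C1_funI)
  have Cn: "C1_fun (ball 0 1) n" using C1_grad_holomorphic(2)[OF h\<psi>'] unfolding n_def cz_def by (rule C1_funI)
  define D where "D z = m z * m z + n z * n z" for z
  have D0: "D z \<noteq> 0" if "z \<in> ball 0 1" for z
  proof
    assume "D z = 0"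
    then have "m z = 0" "n z = 0" unfolding D_def by (simp_all add: sum_squares_eq_zero_iff)
    then have "deriv \<psi> (cz z) = 0" by (simp add: complex_eq_iff m_def n_def)
    then show False using holomorphic_injective_imp_regular[OF \<psi>(1) open_ball inj czb[OF that]] by simp
  qed
  define \<tau> where "\<tau> z = \<kappa> * \<rho> (X z, Y z)" for z
  have \<tau>_pos: "\<tau> z > 0" if "z \<in> ball 0 1" for z using \<kappa> \<rho>_pos[OF XV[OF that]] by (simp add: \<tau>_def)
  have C\<tau>': "C1_grad (ball 0 1) \<tau> (\<lambda>z. \<kappa> * (\<rho>x (X z, Y z) * m z + \<rho>y (X z, Y z) * (\<kappa> * n z)))
     (\<lambda>z. \<kappa> * (\<rho>x (X z, Y z) * - n z + \<rho>y (X z, Y z) * (\<kappa> * m z)))"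
    unfolding \<tau>_def by (rule C1_grad_cmult[OF C1_grad_compose[OF \<rho> CX CY XV]])
  note C\<tau> = C1_funI[OF C\<tau>']
  define u where "u z = inverse (\<tau> z)" for z
  have Cu: "C1_fun (ball 0 1) u" unfolding u_def by (rule C1_fun_inverse[OF C\<tau>]) (use \<tau>_pos in force)
  have CD: "C1_fun (ball 0 1) D" unfolding D_def by (intro C1_fun_arith Cm Cn)
  have CiD: "C1_fun (ball 0 1) (\<lambda>z. inverse (D z))" by (rule C1_fun_inverse[OF CD D0])
  define e where "e z = m z * n z * (u z - \<tau> z) * inverse (D z)" for z
  define g where "g z = (m z * m z * u z + \<tau> z * (n z * n z)) * inverse (D z)" for z
  define k where "k z = (n z * n z * u z + \<tau> z * (m z * m z)) * inverse (D z)" for z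
  have "C1_fun (ball 0 1) e" "C1_fun (ball 0 1) g" "C1_fun (ball 0 1) k"
    unfolding e_def g_def k_def by (intro C1_fun_arith Cm Cn C\<tau> Cu CiD)+
  then obtain ex ey gx gy kx ky where Ce: "C1_grad (ball 0 1) e ex ey" and Cg: "C1_grad (ball 0 1) g gx gy"
    and Ck: "C1_grad (ball 0 1) k kx ky" unfolding C1_fun_def by blast
  have u\<tau>: "u z * \<tau> z = 1" if "z \<in> ball 0 1" for z using \<tau>_pos[OF that] by (simp add: u_def)
  have rot: "g z * k z - (e z)\<^sup>2 = 1" "e z * m z - g z * n z = - (\<tau> z * n z)" "e z * n z + g z * m z = u z * m z"
    "k z * m z - e z * n z = \<tau> z * m z" "k z * n z + e z * m z = u z * n z" if z: "z \<in> ball 0 1" for z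
    unfolding e_def g_def k_def by (rule rotated_coefficients[OF D_def D0[OF z] u\<tau>[OF z]])+
  have \<tau>0: "\<tau> 0 = 1" unfolding \<tau>_def XY0 using \<rho>_pos[OF s0] by (simp add: \<kappa>_def)
  interpret C: conformal_disc e ex ey g gx gy k kx ky
  proof
    show "C1_grad (ball 0 1) e ex ey" "C1_grad (ball 0 1) g gx gy" "C1_grad (ball 0 1) k kx ky" by (rule Ce Cg Ck)+
    fix z :: "real \<times> real" assume z: "z \<in> ball 0 1"
    show "g z * k z - (e z)\<^sup>2 = 1" by (rule rot(1)[OF z])
    have "D z > 0" using D0[OF z] unfolding D_def by (simp add: sum_squares_gt_zero_iff)
    moreover have "n z * n z * u z + \<tau> z * (m z * m z) > 0"
    proof -
      have "u z > 0" using \<tau>_pos[OF z] by (simp add: u_def)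
      then have nn: "0 \<le> n z * n z * u z" "0 \<le> \<tau> z * (m z * m z)" using \<tau>_pos[OF z] by simp_all
      show ?thesis
      proof (cases "m z = 0")
        case True
        then have "n z \<noteq> 0" using D0[OF z] by (simp add: D_def)
        then have "0 < n z * n z" using not_real_square_gt_zero by blast
        then have "0 < n z * n z * u z" using \<open>u z > 0\<close> by (rule mult_pos_pos)
        then show ?thesis using nn by linarith
      next
        case False
        then have "0 < m z * m z" using not_real_square_gt_zero by blast
        then have "0 < \<tau> z * (m z * m z)" using mult_pos_pos[OF \<tau>_pos[OF z]] by blast
        then show ?thesis using nn by linarith
      qed
    qed
    ultimately show "k z > 0" by (simp add: k_def)
  next
    have b0: "(0::real\<times>real) \<in> ball 0 1" by simp
    show "e 0 = 0" by (simp add: e_def u_def \<tau>0)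
    show "g 0 = 1" "k 0 = 1" using D0[OF b0] by (simp_all add: g_def k_def u_def \<tau>0 D_def add.commute)
  qed
  have C\<beta>: "C1_grad (interior S) (\<lambda>z. \<rho> z * F2 z) (\<lambda>z. \<rho>x z * F2 z + \<rho> z * F2x z) (\<lambda>z. \<rho>y z * F2 z + \<rho> z * F2y z)"
    by (rule C1_grad_mult[OF \<rho> F2])
  define a where "a z = F1 (X z, Y z)" for z
  define ax where "ax z = F1x (X z, Y z) * m z + F1y (X z, Y z) * (\<kappa> * n z)" for z
  define ay where "ay z = F1x (X z, Y z) * - n z + F1y (X z, Y z) * (\<kappa> * m z)" for z
  have Ca: "C1_grad (ball 0 1) a ax ay" unfolding a_def ax_def ay_def by (rule C1_grad_compose[OF F1 CX CY XV])
  define \<beta>x where "\<beta>x p = \<rho>x p * F2 p + \<rho> p * F2x p" for p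
  define \<beta>y where "\<beta>y p = \<rho>y p * F2 p + \<rho> p * F2y p" for p
  define b where "b z = \<rho> (X z, Y z) * F2 (X z, Y z)" for z
  define bx where "bx z = \<beta>x (X z, Y z) * m z + \<beta>y (X z, Y z) * (\<kappa> * n z)" for z
  define b'y where "b'y z = \<beta>x (X z, Y z) * - n z + \<beta>y (X z, Y z) * (\<kappa> * m z)" for z
  have Cb: "C1_grad (ball 0 1) b bx b'y"
    unfolding b_def bx_def b'y_def \<beta>x_def \<beta>y_def by (rule C1_grad_compose[OF C\<beta> CX CY XV])
  \<comment> \<open>The residuals of the system for \<open>(F1, \<rho> F2)\<close> in the original coordinates.\<close>
  define \<delta>1 where "\<delta>1 p = F1x p - \<beta>y p / \<rho> p" for p
  define \<delta>2 where "\<delta>2 p = F1y p + \<rho> p * \<beta>x p" for p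
  have res: "C.res1 ax bx b'y z = \<delta>1 (X z, Y z) * m z + \<delta>2 (X z, Y z) * (\<kappa> * n z)"
    "C.res2 ay bx b'y z = - (\<delta>1 (X z, Y z) * n z) + \<delta>2 (X z, Y z) * (\<kappa> * m z)" if z: "z \<in> ball 0 1" for z
  proof -
    define p where "p = (X z, Y z)"
    have \<kappa>u: "\<kappa> * u z * w = w / \<rho> p" for w using \<kappa> \<rho>_pos[OF XV[OF z]] by (simp add: u_def \<tau>_def p_def divide_inverse)
    have \<tau>p: "\<tau> z = \<kappa> * \<rho> p" by (simp add: \<tau>_def p_def)
    have "e z * bx z + g z * b'y z = \<beta>x p * (e z * m z - g z * n z) + \<kappa> * \<beta>y p * (e z * n z + g z * m z)"
      unfolding bx_def b'y_def p_def[symmetric] by (simp add: algebra_simps)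
    also have "\<dots> = - (\<rho> p * \<beta>x p * (\<kappa> * n z)) + (\<kappa> * u z * \<beta>y p) * m z"
      unfolding rot(2)[OF z] rot(3)[OF z] \<tau>p by (simp add: algebra_simps)
    finally show "C.res1 ax bx b'y z = \<delta>1 (X z, Y z) * m z + \<delta>2 (X z, Y z) * (\<kappa> * n z)"
      unfolding C.res1_def \<kappa>u ax_def \<delta>1_def \<delta>2_def p_def[symmetric] by (simp only: algebra_simps)
    have "k z * bx z + e z * b'y z = \<beta>x p * (k z * m z - e z * n z) + \<kappa> * \<beta>y p * (k z * n z + e z * m z)"
      unfolding bx_def b'y_def p_def[symmetric] by (simp add: algebra_simps)
    also have "\<dots> = \<rho> p * \<beta>x p * (\<kappa> * m z) + (\<kappa> * u z * \<beta>y p) * n z"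
      unfolding rot(4)[OF z] rot(5)[OF z] \<tau>p by (simp add: algebra_simps)
    finally show "C.res2 ay bx b'y z = - (\<delta>1 (X z, Y z) * n z) + \<delta>2 (X z, Y z) * (\<kappa> * m z)"
      unfolding C.res2_def \<kappa>u ay_def \<delta>1_def \<delta>2_def p_def[symmetric] by (simp only: algebra_simps)
  qed
  define c where "c p = (\<Theta> p + \<bar>\<rho>y p\<bar> / \<rho> p) + (\<Theta> p + \<rho> p * \<bar>\<rho>x p\<bar>)" for p
  have \<delta>_bound: "\<bar>\<delta>1 p\<bar> + \<bar>\<delta>2 p\<bar> \<le> c p * \<bar>F2 p\<bar>" if p: "p \<in> interior S" for p
  proof -
    have r: "\<rho> p > 0" by (rule \<rho>_pos[OF p])
    have "\<beta>y p / \<rho> p = \<rho>y p / \<rho> p * F2 p + F2y p" using r by (simp add: \<beta>y_def field_simps)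
    then have "\<delta>1 p = (F1x p - F2y p) - \<rho>y p / \<rho> p * F2 p" by (simp add: \<delta>1_def)
    then have "\<bar>\<delta>1 p\<bar> \<le> \<bar>F1x p - F2y p\<bar> + \<bar>\<rho>y p / \<rho> p * F2 p\<bar>" by (simp only: abs_triangle_ineq4)
    also have "\<bar>\<rho>y p / \<rho> p * F2 p\<bar> = \<bar>\<rho>y p\<bar> / \<rho> p * \<bar>F2 p\<bar>" using r by (simp add: abs_mult)
    finally have 1: "\<bar>\<delta>1 p\<bar> \<le> \<Theta> p * \<bar>F2 p\<bar> + \<bar>\<rho>y p\<bar> / \<rho> p * \<bar>F2 p\<bar>" using \<Theta>(2)[OF p] by linarith
    have "\<delta>2 p = (F1y p + (\<rho> p)\<^sup>2 * F2x p) + \<rho> p * \<rho>x p * F2 p" by (simp add: \<delta>2_def \<beta>x_def power2_eq_square algebra_simps)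
    then have "\<bar>\<delta>2 p\<bar> \<le> \<bar>F1y p + (\<rho> p)\<^sup>2 * F2x p\<bar> + \<bar>\<rho> p * \<rho>x p * F2 p\<bar>" by (simp only: abs_triangle_ineq)
    also have "\<bar>\<rho> p * \<rho>x p * F2 p\<bar> = \<rho> p * \<bar>\<rho>x p\<bar> * \<bar>F2 p\<bar>" using r by (simp add: abs_mult)
    finally have 2: "\<bar>\<delta>2 p\<bar> \<le> \<Theta> p * \<bar>F2 p\<bar> + \<rho> p * \<bar>\<rho>x p\<bar> * \<bar>F2 p\<bar>" using \<Theta>(3)[OF p] by linarith
    show ?thesis using 1 2 unfolding c_def distrib_right by linarith
  qed
  define \<Xi> where "\<Xi> z = c (X z, Y z) * ((1 + \<kappa>) * (\<bar>m z\<bar> + \<bar>n z\<bar>)) / \<rho> (X z, Y z)" for z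
  have c\<Xi>: "continuous_on (ball 0 1) \<Xi>"
  proof -
    have cX: "continuous_on (ball 0 1) (\<lambda>z. (X z, Y z))" using C1_gradD(2)[OF CX] C1_gradD(2)[OF CY] by (intro continuous_intros)
    have comp: "continuous_on (ball 0 1) (\<lambda>z. f (X z, Y z))" if "continuous_on (interior S) f" for f :: "real \<times> real \<Rightarrow> real"
      by (rule continuous_on_compose2[OF that cX]) (use XV in blast)
    have nz: "\<rho> (X z, Y z) \<noteq> 0" if "z \<in> ball 0 1" for z using \<rho>_pos[OF XV[OF that]] by simp
    have "continuous_on (ball 0 1) m" "continuous_on (ball 0 1) n"
      using C1_gradD(3)[OF CX] continuous_on_minus[OF C1_gradD(4)[OF CX]] by simp_all
    then show ?thesis unfolding \<Xi>_def c_def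
      using nz comp[OF \<Theta>(1)] comp[OF C1_gradD(2)[OF \<rho>]] comp[OF C1_gradD(3)[OF \<rho>]] comp[OF C1_gradD(4)[OF \<rho>]]
      by (intro continuous_intros) auto
  qed
  have res_bound: "\<bar>C.res1 ax bx b'y z\<bar> \<le> \<Xi> z * sqrt ((a z)\<^sup>2 + (b z)\<^sup>2)" "\<bar>C.res2 ay bx b'y z\<bar> \<le> \<Xi> z * sqrt ((a z)\<^sup>2 + (b z)\<^sup>2)"
    if z: "z \<in> ball 0 1" for z
  proof -
    define p where "p = (X z, Y z)"
    have p: "p \<in> interior S" using XV[OF z] by (simp add: p_def)
    have r: "\<rho> p > 0" by (rule \<rho>_pos[OF p])
    define W where "W = (1 + \<kappa>) * (\<bar>m z\<bar> + \<bar>n z\<bar>)"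
    have W: "\<bar>m z\<bar> \<le> W" "\<bar>n z\<bar> \<le> W" "\<bar>\<kappa> * m z\<bar> \<le> W" "\<bar>\<kappa> * n z\<bar> \<le> W" "W \<ge> 0"
      using \<kappa> by (auto simp: W_def abs_mult algebra_simps)
    have "\<bar>F2 p\<bar> = \<bar>b z\<bar> / \<rho> p" using r by (simp add: b_def p_def[symmetric] abs_mult)
    also have "\<dots> \<le> sqrt ((a z)\<^sup>2 + (b z)\<^sup>2) / \<rho> p" using r by (intro divide_right_mono) (auto simp: real_le_rsqrt)
    finally have F: "\<bar>F2 p\<bar> \<le> sqrt ((a z)\<^sup>2 + (b z)\<^sup>2) / \<rho> p" .
    have c0: "c p \<ge> 0" using \<Theta>_nonneg[OF p] r by (simp add: c_def)
    have mn: "\<bar>\<delta>1 p\<bar> * W + \<bar>\<delta>2 p\<bar> * W \<le> \<Xi> z * sqrt ((a z)\<^sup>2 + (b z)\<^sup>2)"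
    proof -
      have "\<bar>\<delta>1 p\<bar> * W + \<bar>\<delta>2 p\<bar> * W = (\<bar>\<delta>1 p\<bar> + \<bar>\<delta>2 p\<bar>) * W" by (simp add: distrib_right)
      also have "\<dots> \<le> (c p * \<bar>F2 p\<bar>) * W" by (rule mult_right_mono[OF \<delta>_bound[OF p] W(5)])
      also have "\<dots> \<le> (c p * (sqrt ((a z)\<^sup>2 + (b z)\<^sup>2) / \<rho> p)) * W"
        by (rule mult_right_mono[OF mult_left_mono[OF F c0] W(5)])
      also have "\<dots> = \<Xi> z * sqrt ((a z)\<^sup>2 + (b z)\<^sup>2)" by (simp add: \<Xi>_def W_def p_def)
      finally show ?thesis .
    qed
    have "\<bar>\<delta>1 p * m z + \<delta>2 p * (\<kappa> * n z)\<bar> \<le> \<bar>\<delta>1 p\<bar> * \<bar>m z\<bar> + \<bar>\<delta>2 p\<bar> * \<bar>\<kappa> * n z\<bar>"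
      using abs_triangle_ineq[of "\<delta>1 p * m z" "\<delta>2 p * (\<kappa> * n z)"] by (simp only: abs_mult)
    also have "\<dots> \<le> \<bar>\<delta>1 p\<bar> * W + \<bar>\<delta>2 p\<bar> * W" by (intro add_mono mult_left_mono W abs_ge_zero)
    finally show "\<bar>C.res1 ax bx b'y z\<bar> \<le> \<Xi> z * sqrt ((a z)\<^sup>2 + (b z)\<^sup>2)" unfolding res(1)[OF z] p_def[symmetric] using mn by linarith
    have "\<bar>- (\<delta>1 p * n z) + \<delta>2 p * (\<kappa> * m z)\<bar> \<le> \<bar>\<delta>1 p\<bar> * \<bar>n z\<bar> + \<bar>\<delta>2 p\<bar> * \<bar>\<kappa> * m z\<bar>"
      using abs_triangle_ineq[of "- (\<delta>1 p * n z)" "\<delta>2 p * (\<kappa> * m z)"] by (simp only: abs_mult abs_minus_cancel)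
    also have "\<dots> \<le> \<bar>\<delta>1 p\<bar> * W + \<bar>\<delta>2 p\<bar> * W" by (intro add_mono mult_left_mono W abs_ge_zero)
    finally show "\<bar>C.res2 ay bx b'y z\<bar> \<le> \<Xi> z * sqrt ((a z)\<^sup>2 + (b z)\<^sup>2)" unfolding res(2)[OF z] p_def[symmetric] using mn by linarith
  qed
  have sol: "C.almost_solution a ax ay b bx b'y"
    unfolding C.almost_solution_def
  proof (intro conjI allI impI Ca Cb)
    fix r :: real assume r: "r < 1"
    obtain M where M: "M > 0" "\<And>z. z \<in> cball 0 r \<Longrightarrow> \<bar>\<Xi> z\<bar> \<le> M"
      by (rule bounded_on_cball[OF c\<Xi> r]) (rule that)
    have "\<bar>C.res1 ax bx b'y z\<bar> \<le> M * sqrt ((a z)\<^sup>2 + (b z)\<^sup>2) \<and> \<bar>C.res2 ay bx b'y z\<bar> \<le> M * sqrt ((a z)\<^sup>2 + (b z)\<^sup>2)"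
      if z: "z \<in> cball 0 r" for z
    proof -
      have zb: "z \<in> ball 0 1" using z r by auto
      have "\<Xi> z * sqrt ((a z)\<^sup>2 + (b z)\<^sup>2) \<le> M * sqrt ((a z)\<^sup>2 + (b z)\<^sup>2)"
        using M(2)[OF z] by (intro mult_right_mono) auto
      then show ?thesis using res_bound[OF zb] by linarith
    qed
    then show "\<exists>K. \<forall>z\<in>cball 0 r. \<bar>C.res1 ax bx b'y z\<bar> \<le> K * sqrt ((a z)\<^sup>2 + (b z)\<^sup>2) \<and> \<bar>C.res2 ay bx b'y z\<bar> \<le> K * sqrt ((a z)\<^sup>2 + (b z)\<^sup>2)"
      by blast
  qed
  define G where "G p = (fst p + F1 p, snd p + F2 p)" for p
  have cG: "continuous_on (interior S) G"
    unfolding G_def using C1_gradD(2)[OF F1] C1_gradD(2)[OF F2] by (intro continuous_intros)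
  have GK: "G ` interior S \<subseteq> K" using self by (auto simp: G_def)
  obtain r0 l where r0: "0 \<le> r0" "r0 < 1" and l: "continuous_on {z. r0 < norm z \<and> norm z < 1} l"
    and eq: "\<And>z. r0 < norm z \<Longrightarrow> norm z < 1 \<Longrightarrow>
      Complex (fst (G (Re (\<psi> (Complex (fst z) (snd z))), \<kappa> * Im (\<psi> (Complex (fst z) (snd z))))) - fst (Re (\<psi> (Complex (fst z) (snd z))), \<kappa> * Im (\<psi> (Complex (fst z) (snd z)))))
       (\<tau> z / \<kappa> * (snd (G (Re (\<psi> (Complex (fst z) (snd z))), \<kappa> * Im (\<psi> (Complex (fst z) (snd z))))) - snd (Re (\<psi> (Complex (fst z) (snd z))), \<kappa> * Im (\<psi> (Complex (fst z) (snd z))))))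
       = Complex (fst z) (snd z) * exp (l z)"
    by (rule self_map_logarithm[OF \<kappa> \<psi>(1) \<psi>V c\<phi> \<phi> K cG GK C1_gradD(2)[OF C\<tau>'] \<tau>_pos]) (assumption | rule that)+
  have eq': "Complex (a z) (b z) = Complex (fst z) (snd z) * exp (l z)" if "r0 < norm z" "norm z < 1" for z
    using eq[OF that] \<kappa> by (simp add: G_def a_def b_def X_def Y_def cz_def \<tau>_def)
  show False
  proof (rule C.no_degenerate_zero[OF sol r0 l eq'])
    show "a 0 = 0" "b 0 = 0" "ax 0 = 0" "ay 0 = 0" "bx 0 = 0" "b'y 0 = 0"
      unfolding a_def b_def ax_def ay_def bx_def b'y_def \<beta>x_def \<beta>y_def XY0 by (simp_all add: zero)
  qed
qed

section \<open>The two solutions\<close>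

lemma C1_onD:
  assumes "C1_on S f" "z \<in> S"
  shows "(f has_derivative (\<lambda>h. partial_x S f z * fst h + partial_y S f z * snd h)) (at z within S)"
proof -
  have d: "f differentiable (at z within S)" using assms by (simp add: C1_on_def differentiable_on_def)
  then have D: "(f has_derivative frechet_derivative f (at z within S)) (at z within S)"
    by (simp only: frechet_derivative_works)
  interpret linear "frechet_derivative f (at z within S)"
    using D by (rule has_derivative_linear)
  have "frechet_derivative f (at z within S) h = partial_x S f z * fst h + partial_y S f z * snd h" for h
  proof -
    have "h = fst h *\<^sub>R (1, 0) + snd h *\<^sub>R (0, 1)" by (simp add: prod_eq_iff)
    then have "frechet_derivative f (at z within S) h = frechet_derivative f (at z within S) (fst h *\<^sub>R (1, 0) + snd h *\<^sub>R (0, 1))"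
      by (simp only:)
    also have "\<dots> = partial_x S f z * fst h + partial_y S f z * snd h"
      by (simp only: add scaleR partial_x_def partial_y_def real_scaleR_def mult.commute)
    finally show ?thesis .
  qed
  then have "frechet_derivative f (at z within S) = (\<lambda>h. partial_x S f z * fst h + partial_y S f z * snd h)" by (rule ext)
  with D show ?thesis by (simp only:)
qed

lemma C1_on_interior:
  assumes "C1_on S f"
  shows "C1_grad (interior S) f (partial_x S f) (partial_y S f)"
  unfolding C1_grad_def
proof (intro conjI ballI)
  fix z assume z: "z \<in> interior S"
  then have "z \<in> S" using interior_subset by blast
  from C1_onD[OF assms this] at_within_interior[OF z]
  show "(f has_derivative (\<lambda>h. partial_x S f z * fst h + partial_y S f z * snd h)) (at z)" by simp
next
  have c: "continuous_on S (partial_x S f)" "continuous_on S (partial_y S f)" using assms by (auto simp: C1_on_def)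
  show "continuous_on (interior S) (partial_x S f)" by (rule continuous_on_subset[OF c(1) interior_subset])
  show "continuous_on (interior S) (partial_y S f)" by (rule continuous_on_subset[OF c(2) interior_subset])
qed

lemma C1_on_continuous: "C1_on S f \<Longrightarrow> continuous_on S f"
  unfolding C1_on_def by (blast intro: differentiable_imp_continuous_on)

text \<open>
  The inner map may send interior points of \<open>S\<close> to boundary points of \<open>T\<close>. The chain rule for derivatives within sets still
  applies because the image lies in \<open>T\<close>, whatever the choice of derivative at such points.
\<close>

lemma C1_on_compose:
  assumes f: "C1_on T f" and p: "C1_on S p" and q: "C1_on S q" and ST: "\<And>z. z \<in> S \<Longrightarrow> (p z, q z) \<in> T"
  defines "c \<equiv> \<lambda>z. (p z, q z)"
  shows "C1_grad (interior S) (\<lambda>z. f (c z))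
     (\<lambda>z. partial_x T f (c z) * partial_x S p z + partial_y T f (c z) * partial_x S q z)
     (\<lambda>z. partial_x T f (c z) * partial_y S p z + partial_y T f (c z) * partial_y S q z)"
  unfolding C1_grad_def
proof (intro conjI ballI)
  note P = C1_on_interior[OF p] and Q = C1_on_interior[OF q]
  fix z assume z: "z \<in> interior S"
  then have zS: "z \<in> S" using interior_subset by blast
  have cT: "c ` interior S \<subseteq> T" using ST interior_subset unfolding c_def by blast
  have "(c has_derivative (\<lambda>h. (partial_x S p z * fst h + partial_y S p z * snd h, partial_x S q z * fst h + partial_y S q z * snd h))) (at z within interior S)"
    unfolding c_def by (rule has_derivative_Pair[OF has_derivative_at_withinI[OF C1_gradD(1)[OF P z]] has_derivative_at_withinI[OF C1_gradD(1)[OF Q z]]])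
  moreover have "(f has_derivative (\<lambda>h. partial_x T f (c z) * fst h + partial_y T f (c z) * snd h)) (at (c z) within c ` interior S)"
    by (rule has_derivative_subset[OF C1_onD[OF f] cT]) (use ST[OF zS] in \<open>simp add: c_def\<close>)
  ultimately have "(f \<circ> c has_derivative (\<lambda>h. partial_x T f (c z) * fst h + partial_y T f (c z) * snd h) \<circ>
     (\<lambda>h. (partial_x S p z * fst h + partial_y S p z * snd h, partial_x S q z * fst h + partial_y S q z * snd h))) (at z within interior S)"
    by (rule diff_chain_within)
  then show "((\<lambda>z. f (c z)) has_derivative
     (\<lambda>h. (partial_x T f (c z) * partial_x S p z + partial_y T f (c z) * partial_x S q z) * fst h +
       (partial_x T f (c z) * partial_y S p z + partial_y T f (c z) * partial_y S q z) * snd h)) (at z)"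
    using at_within_open[OF z open_interior] by (simp add: o_def algebra_simps)
next
  note P = C1_on_interior[OF p] and Q = C1_on_interior[OF q]
  have cc: "continuous_on (interior S) c" unfolding c_def using C1_gradD(2)[OF P] C1_gradD(2)[OF Q] by (intro continuous_intros)
  have cT: "c ` interior S \<subseteq> T" using ST interior_subset unfolding c_def by blast
  have "continuous_on T (partial_x T f)" "continuous_on T (partial_y T f)" using f by (auto simp: C1_on_def)
  then have "continuous_on (interior S) (\<lambda>z. partial_x T f (c z))" "continuous_on (interior S) (\<lambda>z. partial_y T f (c z))"
    using continuous_on_compose2[OF _ cc cT] by blast+
  then show "continuous_on (interior S) (\<lambda>z. partial_x T f (c z) * partial_x S p z + partial_y T f (c z) * partial_x S q z)"
    "continuous_on (interior S) (\<lambda>z. partial_x T f (c z) * partial_y S p z + partial_y T f (c z) * partial_y S q z)"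
    using C1_gradD(3,4)[OF P] C1_gradD(3,4)[OF Q] by (auto intro!: continuous_intros)
qed

text \<open>
  The coefficients of the two systems at corresponding points. They agree at a fixed point, since the roles
  of the second coordinate and of the second component are exchanged.
\<close>

lemma inverse_sqrt_diff_bound:
  fixes v y w a :: real
  assumes "a \<noteq> 0"
  shows "\<bar>1 / (2 * sqrt (v\<^sup>2 + y\<^sup>2 + a\<^sup>2)) - 1 / (2 * sqrt (w\<^sup>2 + v\<^sup>2 + a\<^sup>2))\<bar> \<le> \<bar>w - y\<bar> / (2 * a\<^sup>2)"
proof -
  define A where "A = sqrt (v\<^sup>2 + y\<^sup>2 + a\<^sup>2)" define B where "B = sqrt (w\<^sup>2 + v\<^sup>2 + a\<^sup>2)"
  have a2: "a\<^sup>2 > 0" using assms by simp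
  have A: "\<bar>a\<bar> \<le> A" "\<bar>y\<bar> \<le> A" "A > 0"
    using a2 by (auto simp: A_def intro!: real_le_rsqrt add_nonneg_pos)
  have B: "\<bar>a\<bar> \<le> B" "\<bar>w\<bar> \<le> B" "B > 0"
    using a2 by (auto simp: B_def intro!: real_le_rsqrt add_nonneg_pos)
  have "A * A = v\<^sup>2 + y\<^sup>2 + a\<^sup>2" "B * B = w\<^sup>2 + v\<^sup>2 + a\<^sup>2" by (simp_all add: A_def B_def)
  then have "(B - A) * (B + A) = (w - y) * (w + y)" by (simp add: power2_eq_square algebra_simps)
  then have "\<bar>B - A\<bar> * (B + A) = \<bar>w - y\<bar> * \<bar>w + y\<bar>" using A(3) B(3) by (metis abs_mult abs_of_pos add_pos_pos)
  also have "\<dots> \<le> \<bar>w - y\<bar> * (B + A)" using A(2) B(2) by (intro mult_left_mono) auto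
  finally have BA: "\<bar>B - A\<bar> \<le> \<bar>w - y\<bar>" using A(3) B(3) by (simp add: mult_le_cancel_right)
  have "a\<^sup>2 \<le> A * B" using mult_mono[OF A(1) B(1)] A(3) by (simp add: power2_eq_square abs_mult[symmetric])
  have "\<bar>1 / (2 * A) - 1 / (2 * B)\<bar> = \<bar>B - A\<bar> / (2 * (A * B))"
  proof -
    have "1 / (2 * A) - 1 / (2 * B) = (B - A) / (2 * (A * B))" using A(3) B(3) by (simp add: field_simps)
    then show ?thesis using A(3) B(3) by (simp add: abs_mult)
  qed
  also have "\<dots> \<le> \<bar>w - y\<bar> / (2 * a\<^sup>2)"
    using BA \<open>a\<^sup>2 \<le> A * B\<close> a2 by (intro frac_le) auto
  finally show ?thesis by (simp add: A_def B_def)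
qed

text \<open>
  For \<open>C = c\<close> the two derivative matrices generate a commutative field, and their product has the same form again. The right-hand
  sides measure the failure.
\<close>

lemma composed_system:
  fixes ux uy vx vy px py qx qy C c :: real
  assumes f: "ux = vy" "uy = - C * vx" and fh: "px = qy" "py = - c * qx"
  shows "(ux * px + uy * qx - 1) - (vx * py + vy * qy - 1) = (c - C) * (vx * qx)"
    and "(ux * py + uy * qy) + c * (vx * px + vy * qx) = (c - C) * (vx * qy)"
  unfolding f fh by (simp_all add: algebra_simps)

lemma solves_systemD:
  assumes "solves_system a S u v" "z \<in> S" "a \<noteq> 0"
  shows "partial_x S u z = partial_y S v z"
    "partial_y S u z = - (1 / (2 * sqrt ((v z)\<^sup>2 + (snd z)\<^sup>2 + a\<^sup>2))) * partial_x S v z"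
proof -
  obtain x y where z: "z = (x, y)" by (cases z)
  have e: "partial_x S u z = partial_y S v z" "partial_x S v z = - 2 * ((v z)\<^sup>2 + (snd z)\<^sup>2 + a\<^sup>2) powr (1/2) * partial_y S u z"
    using assms(1,2) unfolding solves_system_def z by auto
  show "partial_x S u z = partial_y S v z" by (rule e(1))
  have W: "(v z)\<^sup>2 + (snd z)\<^sup>2 + a\<^sup>2 > 0" using assms(3) by (simp add: add_nonneg_pos)
  define R where "R = sqrt ((v z)\<^sup>2 + (snd z)\<^sup>2 + a\<^sup>2)"
  have R: "R > 0" using W by (simp add: R_def)
  have "partial_x S v z = - 2 * R * partial_y S u z" using e(2) W by (simp add: powr_half_sqrt R_def)
  then show "partial_y S u z = - (1 / (2 * sqrt ((v z)\<^sup>2 + (snd z)\<^sup>2 + a\<^sup>2))) * partial_x S v z"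
    unfolding R_def[symmetric] using R by simp
qed

theorem theorem6p9:
  fixes S T :: "(real \<times> real) set"
    and a xh0 yh0 uh0 vh0 ph0 qh0 x0 y0 u0 v0 p0 q0 :: real
    and uh vh :: "real \<times> real \<Rightarrow> real"
  assumes "planar_domain S" and "planar_domain T"
    and "a \<noteq> 0"
    and "(xh0, yh0) \<in> interior S" and "(uh0, vh0) \<in> interior T"
    and "(ph0, qh0) \<noteq> (0, 0)"
    and "\<forall>z\<in>S. (uh z, vh z) \<in> T"
    and "C1_on S uh" and "C1_on S vh"
    and "solves_system a S uh vh"
    and "uh (xh0, yh0) = uh0" and "vh (xh0, yh0) = vh0"
    and "partial_x S vh (xh0, yh0) = ph0" and "partial_y S vh (xh0, yh0) = qh0"
    and "x0 = uh0" and "y0 = vh0" and "u0 = xh0" and "v0 = yh0"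
    and "p0 = - (ph0 / (1/2 * (vh0\<^sup>2 + yh0\<^sup>2 + a\<^sup>2) powr (- 1/2) * ph0\<^sup>2 + qh0\<^sup>2))"
    and "q0 = qh0 / (1/2 * (vh0\<^sup>2 + yh0\<^sup>2 + a\<^sup>2) powr (- 1/2) * ph0\<^sup>2 + qh0\<^sup>2)"
  shows "\<not> (\<exists>u v :: real \<times> real \<Rightarrow> real.
           (\<forall>z\<in>T. (u z, v z) \<in> interior S) \<and>
           C1_on T u \<and> C1_on T v \<and>
           solves_system a T u v \<and>
           u (x0, y0) = u0 \<and> v (x0, y0) = v0 \<and>
           partial_x T v (x0, y0) = p0 \<and> partial_y T v (x0, y0) = q0)"
proof
  assume "\<exists>u v :: real \<times> real \<Rightarrow> real.
           (\<forall>z\<in>T. (u z, v z) \<in> interior S) \<and>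
           C1_on T u \<and> C1_on T v \<and>
           solves_system a T u v \<and>
           u (x0, y0) = u0 \<and> v (x0, y0) = v0 \<and>
           partial_x T v (x0, y0) = p0 \<and> partial_y T v (x0, y0) = q0"
  then obtain u v where uvS: "\<And>z. z \<in> T \<Longrightarrow> (u z, v z) \<in> interior S" and Cu: "C1_on T u" and Cv: "C1_on T v"
    and sys: "solves_system a T u v" and init: "u (x0, y0) = u0" "v (x0, y0) = v0"
      "partial_x T v (x0, y0) = p0" "partial_y T v (x0, y0) = q0" by blast
  note S = assms(1) and a0 = assms(3) and s0 = assms(4) and Cuh = assms(8) and Cvh = assms(9) and sysh = assms(10)
  have hT: "\<And>z. z \<in> S \<Longrightarrow> (uh z, vh z) \<in> T" using assms(7) by blast
  let ?V = "interior S"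
  have VS: "z \<in> S" if "z \<in> ?V" for z using that interior_subset by blast
  define c where "c z = (uh z, vh z)" for z
  have cT: "c z \<in> T" if "z \<in> S" for z using hT[OF that] by (simp add: c_def)
  define ux where "ux z = partial_x T u (c z)" for z
  define uy where "uy z = partial_y T u (c z)" for z
  define vx where "vx z = partial_x T v (c z)" for z
  define vy where "vy z = partial_y T v (c z)" for z
  define px where "px = partial_x S uh" define py where "py = partial_y S uh"
  define qx where "qx = partial_x S vh" define qy where "qy = partial_y S vh"
  define F1 where "F1 z = u (c z) - fst z" for z
  define F2 where "F2 z = v (c z) - snd z" for z
  have CF1: "C1_grad ?V F1 (\<lambda>z. ux z * px z + uy z * qx z - 1) (\<lambda>z. ux z * py z + uy z * qy z)"
    using C1_grad_diff[OF C1_on_compose[OF Cu Cuh Cvh hT] C1_grad_fst]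
    unfolding F1_def ux_def uy_def px_def py_def qx_def qy_def c_def by simp
  have CF2: "C1_grad ?V F2 (\<lambda>z. vx z * px z + vy z * qx z) (\<lambda>z. vx z * py z + vy z * qy z - 1)"
    using C1_grad_diff[OF C1_on_compose[OF Cv Cuh Cvh hT] C1_grad_snd]
    unfolding F2_def vx_def vy_def px_def py_def qx_def qy_def c_def by simp
  define W where "W z = (vh z)\<^sup>2 + (snd z)\<^sup>2 + a\<^sup>2" for z
  have W_pos: "W z > 0" for z using a0 by (simp add: W_def add_nonneg_pos)
  \<comment> \<open>\<open>\<rho>\<^sup>2\<close> is the coefficient \<open>c\<close> of the system for \<open>(uh, vh)\<close>.\<close>
  define \<rho> where "\<rho> z = sqrt (1 / (2 * sqrt (W z)))" for z
  have \<rho>_pos: "\<rho> z > 0" for z using W_pos[of z] by (simp add: \<rho>_def)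
  have \<rho>2: "(\<rho> z)\<^sup>2 = 1 / (2 * sqrt (W z))" for z using W_pos[of z] by (simp add: \<rho>_def)
  note Q = C1_on_interior[OF Cvh]
  obtain Wx Wy where CW: "C1_grad ?V W Wx Wy"
    using C1_grad_add[OF C1_grad_add[OF C1_grad_mult[OF Q Q] C1_grad_mult[OF C1_grad_snd C1_grad_snd]] C1_grad_const[of _ "a\<^sup>2"]]
    unfolding W_def power2_eq_square by blast
  obtain \<rho>x \<rho>y where C\<rho>: "C1_grad ?V \<rho> \<rho>x \<rho>y"
  proof -
    define h' where "h' w = inverse (sqrt (1 / (2 * sqrt w))) / 2 * (- (1 / (2 * sqrt w) ^ 2) * (2 * (inverse (sqrt w) / 2)))" for w :: real
    have d: "((\<lambda>w. sqrt (1 / (2 * sqrt w))) has_real_derivative h' w) (at w)" if w: "w > 0" for w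
    proof -
      have 1: "((\<lambda>w. 2 * sqrt w) has_real_derivative 2 * (inverse (sqrt w) / 2)) (at w)"
        by (rule DERIV_cmult[OF DERIV_real_sqrt[OF w]])
      have 2: "((\<lambda>s. 1 / s) has_real_derivative - (1 / s ^ 2)) (at s)" if "s > 0" for s :: real
        using DERIV_inverse[of s UNIV] that by (simp add: inverse_eq_divide power2_eq_square)
      have 3: "((\<lambda>w. 1 / (2 * sqrt w)) has_real_derivative - (1 / (2 * sqrt w) ^ 2) * (2 * (inverse (sqrt w) / 2))) (at w)"
        by (rule DERIV_chain2[OF 2 1]) (use w in simp)
      show ?thesis unfolding h'_def
        by (rule DERIV_chain2[OF DERIV_real_sqrt 3]) (use w in simp)
    qed
    have "C1_grad ?V (\<lambda>z. sqrt (1 / (2 * sqrt (W z)))) (\<lambda>z. h' (W z) * Wx z) (\<lambda>z. h' (W z) * Wy z)"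
    proof (rule C1_grad_chain[OF CW d[OF W_pos]])
      have nz: "sqrt (W z) \<noteq> 0" "2 * sqrt (W z) \<noteq> 0" "(2 * sqrt (W z))\<^sup>2 \<noteq> 0" "sqrt (1 / (2 * sqrt (W z))) \<noteq> 0" for z
        using W_pos[of z] by auto
      show "continuous_on ?V (\<lambda>z. h' (W z))" unfolding h'_def
        using nz C1_gradD(2)[OF CW] by (intro continuous_intros) auto
    qed
    then show thesis unfolding \<rho>_def[symmetric] by (rule that)
  qed
  define K where "K = (\<lambda>z. (u (c z), v (c z))) ` S"
  have cc: "continuous_on S c"
    unfolding c_def using C1_on_continuous[OF Cuh] C1_on_continuous[OF Cvh] by (rule continuous_on_Pair)
  have cuv: "continuous_on S (\<lambda>z. u (c z))" "continuous_on S (\<lambda>z. v (c z))"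
    by (rule continuous_on_compose2[OF C1_on_continuous[OF Cu] cc] continuous_on_compose2[OF C1_on_continuous[OF Cv] cc]; use cT in blast)+
  have K: "compact K" unfolding K_def
  proof (rule compact_continuous_image)
    show "continuous_on S (\<lambda>z. (u (c z), v (c z)))" using cuv by (rule continuous_on_Pair)
    show "compact S" using S by (auto simp: planar_domain_def compact_eq_bounded_closed)
  qed
  have KV: "K \<subseteq> ?V" unfolding K_def using uvS cT by blast
  have self: "(fst z + F1 z, snd z + F2 z) \<in> K" if "z \<in> ?V" for z
    using VS[OF that] by (auto simp: K_def F1_def F2_def)
  define \<Theta> where "\<Theta> z = (\<bar>vx z * qx z\<bar> + \<bar>vx z * qy z\<bar>) / (2 * a\<^sup>2)" for z
  have sysT: "ux z = vy z" "uy z = - (1 / (2 * sqrt ((v (c z))\<^sup>2 + (vh z)\<^sup>2 + a\<^sup>2))) * vx z" if "z \<in> S" for z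
    using solves_systemD[OF sys cT[OF that] a0] unfolding ux_def uy_def vx_def vy_def by (auto simp: c_def)
  have sysS: "px z = qy z" "py z = - (1 / (2 * sqrt (W z))) * qx z" if "z \<in> S" for z
    using solves_systemD[OF sysh that a0] unfolding px_def py_def qx_def qy_def W_def by auto
  have coef: "\<bar>1 / (2 * sqrt (W z)) - 1 / (2 * sqrt ((v (c z))\<^sup>2 + (vh z)\<^sup>2 + a\<^sup>2))\<bar> \<le> \<bar>F2 z\<bar> / (2 * a\<^sup>2)" for z
    unfolding W_def F2_def by (rule inverse_sqrt_diff_bound[OF a0])
  have le: "\<bar>s * t\<bar> \<le> (\<bar>vx z * qx z\<bar> + \<bar>vx z * qy z\<bar>) / (2 * a\<^sup>2) * \<bar>F2 z\<bar>"
    if "\<bar>s\<bar> \<le> \<bar>F2 z\<bar> / (2 * a\<^sup>2)" "\<bar>t\<bar> \<le> \<bar>vx z * qx z\<bar> + \<bar>vx z * qy z\<bar>" for s t z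
  proof -
    have "\<bar>s\<bar> * \<bar>t\<bar> \<le> \<bar>F2 z\<bar> / (2 * a\<^sup>2) * (\<bar>vx z * qx z\<bar> + \<bar>vx z * qy z\<bar>)"
      by (rule mult_mono[OF that]) auto
    then show ?thesis by (simp add: abs_mult mult.commute)
  qed
  show False
  proof (rule no_degenerate_fixed_point[OF S s0 CF1 CF2 C\<rho> \<rho>_pos K KV self, of \<Theta>])
    show "\<Theta> z \<ge> 0" for z by (simp add: \<Theta>_def)
    have "continuous_on S vx"
      unfolding vx_def by (rule continuous_on_compose2[OF _ cc, of T]) (use Cv cT in \<open>auto simp: C1_on_def\<close>)
    then have cvx: "continuous_on ?V vx" using interior_subset continuous_on_subset by blast
    show "continuous_on ?V \<Theta>" unfolding \<Theta>_def qx_def qy_def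
      using a0 by (intro continuous_intros cvx C1_gradD(3,4)[OF Q]) auto
    fix z assume z: "z \<in> ?V"
    note cs = composed_system[OF sysT[OF VS[OF z]] sysS[OF VS[OF z]]]
    show "\<bar>(ux z * px z + uy z * qx z - 1) - (vx z * py z + vy z * qy z - 1)\<bar> \<le> \<Theta> z * \<bar>F2 z\<bar>"
      unfolding cs(1) \<Theta>_def by (rule le[OF coef]) simp
    show "\<bar>(ux z * py z + uy z * qy z) + (\<rho> z)\<^sup>2 * (vx z * px z + vy z * qx z)\<bar> \<le> \<Theta> z * \<bar>F2 z\<bar>"
      unfolding \<rho>2 cs(2) \<Theta>_def by (rule le[OF coef]) simp
  next
    define s where "s = (xh0, yh0)"
    have sS: "s \<in> S" using VS[OF s0] by (simp add: s_def)
    have cs: "c s = (x0, y0)" using assms(11,12,15,16) by (simp add: c_def s_def)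
    show "F1 (xh0, yh0) = 0" "F2 (xh0, yh0) = 0"
      using init(1,2) cs assms(17,18) by (simp_all add: F1_def F2_def s_def)
    define k where "k = 1 / (2 * sqrt (vh0\<^sup>2 + yh0\<^sup>2 + a\<^sup>2))"
    have W0: "vh0\<^sup>2 + yh0\<^sup>2 + a\<^sup>2 > 0" using a0 by (simp add: add_nonneg_pos)
    have k: "k > 0" using W0 by (simp add: k_def)
    have kp: "1/2 * (vh0\<^sup>2 + yh0\<^sup>2 + a\<^sup>2) powr (- 1/2) = k"
      using W0 by (simp add: powr_minus_divide powr_half_sqrt k_def)
    define D where "D = k * ph0\<^sup>2 + qh0\<^sup>2"
    have D: "D \<noteq> 0"
    proof
      assume D0: "D = 0"
      have "0 \<le> k * ph0\<^sup>2" using k by simp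
      then have "qh0\<^sup>2 = 0" "k * ph0\<^sup>2 = 0" using D0 zero_le_power2[of qh0] unfolding D_def by linarith+
      then show False using k assms(6) by simp
    qed
    have pq: "vx s = - (ph0 / D)" "vy s = qh0 / D"
      using init(3,4) assms(19,20) unfolding vx_def vy_def cs kp D_def by simp_all
    have qs: "qx s = ph0" "qy s = qh0" using assms(13,14) by (simp_all add: qx_def qy_def s_def)
    have vhs: "vh s = vh0" "snd s = yh0" "v (c s) = yh0" using assms(12,18) init(2) cs by (simp_all add: s_def)
    have ps: "px s = qh0" "py s = - k * ph0" using sysS[OF sS] unfolding W_def vhs k_def qs by simp_all
    have us: "ux s = qh0 / D" "uy s = k * (ph0 / D)"
      using sysT[OF sS] unfolding vhs pq by (simp_all add: k_def add.commute)
    have DD: "qh0 * qh0 / D + k * (ph0 * ph0) / D = 1"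
      using D by (simp add: add_divide_distrib[symmetric]) (simp add: D_def power2_eq_square add.commute)
    show "ux (xh0, yh0) * px (xh0, yh0) + uy (xh0, yh0) * qx (xh0, yh0) - 1 = 0"
      unfolding s_def[symmetric] us ps qs using DD by (simp add: mult.assoc)
    show "vx (xh0, yh0) * py (xh0, yh0) + vy (xh0, yh0) * qy (xh0, yh0) - 1 = 0"
      unfolding s_def[symmetric] pq ps qs using DD by (simp add: algebra_simps)
    show "ux (xh0, yh0) * py (xh0, yh0) + uy (xh0, yh0) * qy (xh0, yh0) = 0"
      unfolding s_def[symmetric] us ps qs by simp
    show "vx (xh0, yh0) * px (xh0, yh0) + vy (xh0, yh0) * qx (xh0, yh0) = 0"
      unfolding s_def[symmetric] pq ps qs by simp
  qed
qed

end
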